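(* With the processes defined in the context, and $K$ a constant: for all $t\in[0,T]$ we have $$|X^{0,N}_t-X^0_t|+|X^N_t-\bar X_t|\le e^{Kt}\,\frac DN\sum_{i=1}^NW^i_t.$$ As a result, for all $t\in[0,T]$, as $N\to\infty$, $$X^{0,N}_t\to X^0_t,\quad X^N_t\to\bar X_t,\quad Y^{0,N}_t\to\bar P^0_t,\quad Y^N_t\to\bar P_t,\quad\text{a.s.},$$ and finally the optimal controls for the finite-player games converge towards the limiting optimal control: $$u^{0,N}_t\to u^0_t\quad\text{a.s.},\quad\forall t\in[0,T].$$
   Context: All processes are one-dimensional; $a,b,c,q,D_0,D$ are constants; $W,W^0,W^1,W^2,\dots$ are independent Wiener processes; $(\mathcal F^0_t)$ is the filtration generated by $W^0$; an overline (bar) denotes conditional expectation given $\mathcal F^0_t$. **Finite-player game.** States $dX^{0,N}_t=(\frac aN\sum_{i=1}^NX^{i,N}_t+bu^{0,N}_t)dt+D_0dW^0_t$, $X^{0,N}_0=x^0_0$, and $dX^{i,N}_t=cX^{0,N}_tdt+DdW^i_t$, $X^{i,N}_0=x_0$, $1\le i\le N$; the major player minimizes $\mathbb E\int_0^T(q|X^{0,N}_t|^2+|u^{0,N}_t|^2)dt$ over square-integrable $(\mathcal F^0_t)$-progressively measurable controls, and minor player $i$ minimizes $\mathbb E\int_0^T|u^{i,N}_t|^2dt$ (so the minor players use the control $0$). The stochastic maximum principle gives the system $$\begin{cases}dX^{0,N}_t=(\frac aN\sum_{i=1}^NX^{i,N}_t-\frac12b^2Y^{0,N}_t)dt+D_0dW^0_t,\\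 dX^{i,N}_t=cX^{0,N}_tdt+DdW^i_t,\quad1\le i\le N,\\ dY^{0,N}_t=-(c\sum_{i=1}^NY^{i,N}_t+2qX^{0,N}_t)dt+\sum_{j=0}^NZ^{0,j,N}_tdW^j_t,\\ dY^{i,N}_t=-\frac aNY^{0,N}_tdt+\sum_{j=0}^NZ^{i,j,N}_tdW^j_t,\quad1\le i\le N,\end{cases}$$ with $Y^{i,N}_T=0$, $0\le i\le N$. Put $X^N_t=\frac1N\sum_{i=1}^NX^{i,N}_t$ and $Y^N_t=\sum_{i=1}^NY^{i,N}_t$. Aggregating, and conditioning the backward equations with respect to $\mathcal F^0_t$, leads to $$\begin{cases}dX^{0,N}_t=(aX^N_t-\frac12b^2\bar Y^{0,N}_t)dt+D_0dW^0_t,\\ dX^N_t=cX^{0,N}_tdt+\frac DNd(\sum_{i=1}^NW^i_t),\\ d\bar Y^{0,N}_t=-(c\bar Y^N_t+2qX^{0,N}_t)dt+Z^{0,0}_tdW^0_t,\\ d\bar Y^N_t=-a\bar Y^{0,N}_tdt+\sum_iZ^{i,0}_tdW^0_t.\end{cases}$$ It is assumed that the Riccati equation $\dot S_t+S_tA+\hat BS_t+S_tBS_t+\hat A=0$, $S_T=0$, with $$A=\begin{pmatrix}0 & a \\ c & 0\end{pmatrix},\ B=\begin{pmatrix}-\frac{b^2}2 & 0 \\ 0 & 0\end{pmatrix},\ \hat A=\begin{pmatrix}2q & 0 \\ 0 & 0\end{pmatrix},\ \hat B=\begin{pmatrix}0 & c \\ a & 0\end{pmatrix},$$ is uniquely solvable,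 with solution $S=\begin{pmatrix}S^{0,0} & S^{0,1} \\ S^{1,0} & S^{1,1}\end{pmatrix}$. The optimally controlled dynamics are then obtained by solving $$dX^{0,N}_t=\big(aX^N_t-\tfrac12b^2(S^{0,0}_tX^{0,N}_t+S^{0,1}_tX^N_t)\big)dt+D_0dW^0_t,\qquad dX^N_t=cX^{0,N}_tdt+\tfrac DNd\Big(\sum_{i=1}^NW^i_t\Big),$$ and the major player's optimal control is $u^{0,N}_t=-\frac b2\bar Y^{0,N}_t$. **Limiting problem.** Minimize $\mathbb E\int_0^T[q(X^0_t)^2+(u^0_t)^2]dt$ subject to $dX^0_t=(a\,\mathbb E[X_t|\mathcal F^0_t]+bu^0_t)dt+D_0dW^0_t$, $dX_t=cX^0_tdt+DdW_t$, $X^0_0=x^0_0$, $X_0=x_0$. With $\bar X_t=\mathbb E[X_t|\mathcal F^0_t]$, the solution is characterized by $$\begin{cases}dX^0_t=(a\bar X_t-\frac12b^2\bar P^0_t)dt+D_0dW^0_t,\\ d\bar X_t=cX^0_tdt,\\ d\bar P^0_t=-(2qX^0_t+c\bar P_t)dt+\bar Q^{00}_tdW^0_t,\\ d\bar P_t=-a\bar P^0_tdt+\bar Q^{10}_tdW^0_t,\end{cases}$$ with $X^0_0=x^0_0$, $\bar X_0=x_0$, $\bar P^0_T=\bar P_T=0$; it is associated with the same Riccati equation, so that $(X^0,\bar X)$ solves $dX^0_t=(a\bar X_t-\frac12b^2(S^{0,0}_tX^0_t+S^{0,1}_t\bar X_t))dt+D_0dW^0_t$, $d\bar X_t=cX^0_tdt$.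 The optimal control is $u^0_t=-\frac b2\bar P^0_t$.
   Formalization: The printed bound is false, since its right-hand side is negative with positive probability; it is proved a.s., for all t at once, with |D|/N times the supremum over s ≤ t of |W^1_s+…+W^N_s| in place of (D/N) times the sum of W^i_t. *)

theory Defs
  imports "HOL-Probability.Probability"
begin

type_synonym 'a process = "real \<Rightarrow> 'a \<Rightarrow> real"

section \<open>Wiener processes and filtrations\<close>

text \<open>
  The raw (not completed) filtration generated by a set of processes. Only its space and
  its sets matter: as a measure it is trivial, and it is used as the sub-sigma-algebra
  argument of \<^const>\<open>real_cond_exp\<close>.
\<close>

definition natural_filtration :: "'a measure \<Rightarrow> 'a process set \<Rightarrow> real \<Rightarrow> 'a measure" where
  "natural_filtration M V t =
     sigma (space M) {X s -` B \<inter> space M | X s B. X \<in> V \<and> s \<in> {0..t} \<and> B \<in> sets borel}"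

definition wiener_process :: "'a measure \<Rightarrow> 'a process \<Rightarrow> bool" where
  "wiener_process M W \<longleftrightarrow>
     (\<forall>t\<ge>0. W t \<in> borel_measurable M) \<and>
     (AE \<omega> in M. W 0 \<omega> = 0) \<and>
     (AE \<omega> in M. continuous_on {0..} (\<lambda>t. W t \<omega>)) \<and>
     (\<forall>s t. 0 \<le> s \<and> s < t \<longrightarrow>
        distributed M lborel (\<lambda>\<omega>. W t \<omega> - W s \<omega>) (normal_density 0 (sqrt (t - s))) \<and>
        prob_space.indep_set M (sets (natural_filtration M {W} s))
          {(\<lambda>\<omega>. W t \<omega> - W s \<omega>) -` B \<inter> space M | B. B \<in> sets borel})"

text \<open>Independence of processes is independence of the path-valued random variables.\<close>

definition independent_wiener_processes :: "'a measure \<Rightarrow> ('i \<Rightarrow> 'a process) \<Rightarrow> bool" where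
  "independent_wiener_processes M W \<longleftrightarrow>
     (\<forall>i. wiener_process M (W i)) \<and>
     prob_space.indep_vars M (\<lambda>_. \<Pi>\<^sub>M t\<in>{0..}. borel) (\<lambda>i \<omega>. \<lambda>t\<in>{0..}. W i t \<omega>) UNIV"

definition progressively_measurable ::
    "(real \<Rightarrow> 'a measure) \<Rightarrow> real \<Rightarrow> 'a process \<Rightarrow> bool" where
  "progressively_measurable F T H \<longleftrightarrow>
     (\<forall>t\<in>{0..T}. (\<lambda>(s, \<omega>). H s \<omega>) \<in> borel_measurable (restrict_space borel {0..t} \<Otimes>\<^sub>M F t))"

definition square_integrable_progressive ::
    "'a measure \<Rightarrow> (real \<Rightarrow> 'a measure) \<Rightarrow> real \<Rightarrow> 'a process \<Rightarrow> bool" where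
  "square_integrable_progressive M F T H \<longleftrightarrow>
     progressively_measurable F T H \<and>
     (\<integral>\<^sup>+\<omega>. (\<integral>\<^sup>+t\<in>{0..T}. ennreal ((H t \<omega>)\<^sup>2) \<partial>lborel) \<partial>M) < \<infinity>"


section \<open>The Ito integral of square-integrable progressive processes\<close>

definition simple_integrand ::
    "(real \<Rightarrow> 'a measure) \<Rightarrow> real \<Rightarrow> nat \<Rightarrow> (nat \<Rightarrow> real) \<Rightarrow> (nat \<Rightarrow> 'a \<Rightarrow> real) \<Rightarrow> bool" where
  "simple_integrand F T n \<tau> \<xi> \<longleftrightarrow>
     0 \<le> \<tau> 0 \<and> \<tau> n \<le> T \<and>
     (\<forall>k<n. \<tau> k \<le> \<tau> (Suc k) \<and> \<xi> k \<in> borel_measurable (F (\<tau> k)) \<and>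
            (\<exists>C. \<forall>\<omega>\<in>space (F (\<tau> k)). \<bar>\<xi> k \<omega>\<bar> \<le> C))"

definition simple_process ::
    "nat \<Rightarrow> (nat \<Rightarrow> real) \<Rightarrow> (nat \<Rightarrow> 'a \<Rightarrow> real) \<Rightarrow> 'a process" where
  "simple_process n \<tau> \<xi> t \<omega> = (\<Sum>k<n. \<xi> k \<omega> * indicator {\<tau> k<..\<tau> (Suc k)} t)"

definition simple_integral ::
    "'a process \<Rightarrow> nat \<Rightarrow> (nat \<Rightarrow> real) \<Rightarrow> (nat \<Rightarrow> 'a \<Rightarrow> real) \<Rightarrow> 'a process" where
  "simple_integral W n \<tau> \<xi> t \<omega> =
     (\<Sum>k<n. \<xi> k \<omega> * (W (min (\<tau> (Suc k)) t) \<omega> - W (min (\<tau> k) t) \<omega>))"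

text \<open>
  \<open>is_ito_integral M F T W H I\<close>: the process \<open>I\<close> is (a version, with almost surely
  continuous paths, of) the stochastic integral of \<open>H\<close> with respect to the Wiener process
  \<open>W\<close> on \<open>[0, T]\<close>, obtained as the \<open>L\<^sup>2\<close>-limit of integrals of simple processes. It is a
  relation because the integral is determined only up to indistinguishability.
\<close>

definition is_ito_integral ::
    "'a measure \<Rightarrow> (real \<Rightarrow> 'a measure) \<Rightarrow> real \<Rightarrow> 'a process \<Rightarrow> 'a process \<Rightarrow> 'a process \<Rightarrow> bool"
  where
  "is_ito_integral M F T W H I \<longleftrightarrow>
     square_integrable_progressive M F T H \<and>
     (\<forall>t\<in>{0..T}. I t \<in> borel_measurable M) \<and>
     (AE \<omega> in M. continuous_on {0..T} (\<lambda>t. I t \<omega>)) \<and>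
     (\<exists>n \<tau> \<xi>.
        (\<forall>m. simple_integrand F T (n m) (\<tau> m) (\<xi> m)) \<and>
        (\<lambda>m. \<integral>\<^sup>+\<omega>. (\<integral>\<^sup>+t\<in>{0..T}.
                 ennreal ((simple_process (n m) (\<tau> m) (\<xi> m) t \<omega> - H t \<omega>)\<^sup>2) \<partial>lborel) \<partial>M)
          \<longlonglongrightarrow> 0 \<and>
        (\<forall>t\<in>{0..T}.
           (\<lambda>m. \<integral>\<^sup>+\<omega>. ennreal ((simple_integral W (n m) (\<tau> m) (\<xi> m) t \<omega> - I t \<omega>)\<^sup>2) \<partial>M)
             \<longlonglongrightarrow> 0))"


section \<open>Forward and backward equations\<close>

text \<open>
  \<open>dX = f dt + \<sigma> dW\<close>, \<open>X\<^sub>0 = x\<close>, with constant \<open>\<sigma>\<close>: the stochastic integral of a constant is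
  \<open>\<sigma> (W\<^sub>t - W\<^sub>0)\<close>.
\<close>

definition forward_equation ::
    "'a measure \<Rightarrow> (real \<Rightarrow> 'a measure) \<Rightarrow> real \<Rightarrow> 'a process \<Rightarrow> real
       \<Rightarrow> real \<Rightarrow> 'a process \<Rightarrow> 'a process \<Rightarrow> bool" where
  "forward_equation M F T W \<sigma> x f X \<longleftrightarrow>
     square_integrable_progressive M F T X \<and>
     (AE \<omega> in M. \<forall>t\<in>{0..T}.
        X t \<omega> = x + (LINT s:{0..t}|lborel. f s \<omega>) + \<sigma> * (W t \<omega> - W 0 \<omega>))"

text \<open>\<open>dY = - f dt + (\<Sum>j\<in>J. Z\<^sup>j dW\<^sup>j)\<close> with terminal value \<open>Y\<^sub>T = 0\<close>.\<close>

definition backward_equation ::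
    "'a measure \<Rightarrow> (real \<Rightarrow> 'a measure) \<Rightarrow> real \<Rightarrow> 'i set \<Rightarrow> ('i \<Rightarrow> 'a process)
       \<Rightarrow> 'a process \<Rightarrow> 'a process \<Rightarrow> ('i \<Rightarrow> 'a process) \<Rightarrow> bool" where
  "backward_equation M F T J W f Y Z \<longleftrightarrow>
     square_integrable_progressive M F T Y \<and>
     (\<exists>I. (\<forall>j\<in>J. is_ito_integral M F T (W j) (Z j) (I j)) \<and>
          (AE \<omega> in M. \<forall>t\<in>{0..T}.
             Y t \<omega> = (LINT s:{t..T}|lborel. f s \<omega>) - (\<Sum>j\<in>J. I j T \<omega> - I j t \<omega>)))"


section \<open>The finite-player system and the limiting system\<close>

definition empirical_mean :: "nat \<Rightarrow> (nat \<Rightarrow> 'a process) \<Rightarrow> 'a process" where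
  "empirical_mean N X t \<omega> = (1 / real N) * (\<Sum>i=1..N. X i t \<omega>)"

definition aggregate :: "nat \<Rightarrow> (nat \<Rightarrow> 'a process) \<Rightarrow> 'a process" where
  "aggregate N Y t \<omega> = (\<Sum>i=1..N. Y i t \<omega>)"

text \<open>
  Index \<open>0\<close> is the major player. The backward components are not conditioned here;
  everything is adapted to the filtration of \<open>W\<^sup>0, \<dots>, W\<^sup>N\<close>.
\<close>

definition finite_player_system ::
    "'a measure \<Rightarrow> (nat \<Rightarrow> 'a process) \<Rightarrow> real \<Rightarrow> real \<Rightarrow> real \<Rightarrow> real \<Rightarrow> real \<Rightarrow> real \<Rightarrow> real
       \<Rightarrow> real \<Rightarrow> real \<Rightarrow> nat \<Rightarrow> (nat \<Rightarrow> 'a process) \<Rightarrow> (nat \<Rightarrow> 'a process)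
       \<Rightarrow> (nat \<Rightarrow> nat \<Rightarrow> 'a process) \<Rightarrow> bool" where
  "finite_player_system M W T a b c q D0 D x00 x0 N X Y Z \<longleftrightarrow>
    (let F = natural_filtration M (W ` {0..N}) in
       forward_equation M F T (W 0) D0 x00
         (\<lambda>t \<omega>. a * empirical_mean N X t \<omega> - (1/2) * b\<^sup>2 * Y 0 t \<omega>) (X 0) \<and>
       (\<forall>i\<in>{1..N}. forward_equation M F T (W i) D x0 (\<lambda>t \<omega>. c * X 0 t \<omega>) (X i)) \<and>
       backward_equation M F T {0..N} W
         (\<lambda>t \<omega>. c * aggregate N Y t \<omega> + 2 * q * X 0 t \<omega>) (Y 0) (Z 0) \<and>
       (\<forall>i\<in>{1..N}. backward_equation M F T {0..N} W
         (\<lambda>t \<omega>. (a / real N) * Y 0 t \<omega>) (Y i) (Z i)))"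

text \<open>
  \<open>W0\<close> and \<open>W\<close> drive the major and the representative minor player. The fourth argument
  of \<^const>\<open>forward_equation\<close> is irrelevant for \<open>Xbar\<close>, whose noise coefficient is \<open>0\<close>.
\<close>

definition limiting_system ::
    "'a measure \<Rightarrow> 'a process \<Rightarrow> 'a process \<Rightarrow> real \<Rightarrow> real \<Rightarrow> real \<Rightarrow> real \<Rightarrow> real \<Rightarrow> real \<Rightarrow> real
       \<Rightarrow> real \<Rightarrow> real \<Rightarrow> 'a process \<Rightarrow> 'a process \<Rightarrow> 'a process \<Rightarrow> 'a process \<Rightarrow> 'a process
       \<Rightarrow> 'a process \<Rightarrow> 'a process \<Rightarrow> bool" where
  "limiting_system M W0 W T a b c q D0 D x00 x0 X0 X Xbar P0bar Pbar Q00 Q10 \<longleftrightarrow>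
    (let F0 = natural_filtration M {W0} in
       forward_equation M F0 T W0 D0 x00
         (\<lambda>t \<omega>. a * Xbar t \<omega> - (1/2) * b\<^sup>2 * P0bar t \<omega>) X0 \<and>
       forward_equation M (natural_filtration M {W0, W}) T W D x0 (\<lambda>t \<omega>. c * X0 t \<omega>) X \<and>
       (\<forall>t\<in>{0..T}. AE \<omega> in M. Xbar t \<omega> = real_cond_exp M (F0 t) (X t) \<omega>) \<and>
       forward_equation M F0 T W0 0 x0 (\<lambda>t \<omega>. c * X0 t \<omega>) Xbar \<and>
       backward_equation M F0 T {()} (\<lambda>_. W0)
         (\<lambda>t \<omega>. 2 * q * X0 t \<omega> + c * Pbar t \<omega>) P0bar (\<lambda>_. Q00) \<and>
       backward_equation M F0 T {()} (\<lambda>_. W0) (\<lambda>t \<omega>. a * P0bar t \<omega>) Pbar (\<lambda>_. Q10))"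


section \<open>The Riccati equation\<close>

definition mat22 :: "real \<Rightarrow> real \<Rightarrow> real \<Rightarrow> real \<Rightarrow> real^2^2" where
  "mat22 p q r s = vector [vector [p, q], vector [r, s]]"

definition riccati_solution ::
    "real \<Rightarrow> real^2^2 \<Rightarrow> real^2^2 \<Rightarrow> real^2^2 \<Rightarrow> real^2^2 \<Rightarrow> (real \<Rightarrow> real^2^2) \<Rightarrow> bool" where
  "riccati_solution T A B Ahat Bhat S \<longleftrightarrow>
     S T = 0 \<and>
     (\<forall>t\<in>{0..T}. \<exists>S'. (S has_vector_derivative S') (at t within {0..T}) \<and>
        S' + S t ** A + Bhat ** S t + S t ** B ** S t + Ahat = 0)"

definition riccati_uniquely_solvable ::
    "real \<Rightarrow> real^2^2 \<Rightarrow> real^2^2 \<Rightarrow> real^2^2 \<Rightarrow> real^2^2 \<Rightarrow> bool" where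
  "riccati_uniquely_solvable T A B Ahat Bhat \<longleftrightarrow>
     (\<exists>S. riccati_solution T A B Ahat Bhat S \<and>
        (\<forall>R. riccati_solution T A B Ahat Bhat R \<longrightarrow> (\<forall>t\<in>{0..T}. R t = S t)))"

end

theory Submission
  imports Defs
begin

text \<open>
  No stochastic calculus beyond the martingale property is needed. If \<open>A\<close> is an event of the
  filtration at time \<open>\<tau>\<close>, the truncated means \<open>E[1\<^sub>A X\<^sub>s]\<close> and \<open>E[1\<^sub>A Y\<^sub>s]\<close>, \<open>s \<ge> \<tau>\<close>, solve a
  deterministic linear forward-backward system, which the Riccati equation decouples; taking
  \<open>s = \<tau>\<close> and varying \<open>A\<close> gives \<open>Y\<^sub>\<tau> = S\<^sub>\<tau> X\<^sub>\<tau>\<close> almost surely, for the finite-player system as well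
  as for the limit. Hence the difference of the two forward states solves, path by path, a linear
  integral equation driven by \<open>(D / N) \<Sum>\<^sub>i W\<^sup>i\<close>, and Gronwall's inequality gives the bound. The
  fourth moments of the Gaussian averages are summable in \<open>N\<close>, which gives the almost sure limits.
  Finally, the truncated means of the difference over an event \<open>A\<close> of the filtration of \<open>W\<^sup>0\<close>
  vanish, because the driving noise is centred and independent of \<open>A\<close>; so the conditional
  expectation of the major player's adjoint process, and with it the optimal control, is equal to
  the limiting one for every \<open>N\<close>.
\<close>

section \<open>Deterministic linear systems and the Riccati equation\<close>

text \<open>The bound carries \<open>\<bar>D\<bar>\<close> and a supremum over \<open>{0..t}\<close>
  because the sum of the Wiener processes is signed and may return to zero at \<open>t\<close> after
  having pushed the states apart; its value at \<open>t\<close> alone cannot control the difference.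
  Gronwall's inequality gives the noise at \<open>t\<close> plus an integral of its past, and
  folding both into one exponential doubles the rate. That integral also makes a law of large
  numbers at each fixed time insufficient for the limits: the time integral of the absolute average
  has to vanish too, which calls for joint measurability of the Wiener paths.

  The decoupling holds at each time off a null set that depends on the time. Fubini's theorem turns
  this into a single null set off which it holds at almost every time, enough for use under the
  drift integral.

  The controls contain a conditional expectation of \<open>Y N 0 t\<close>, and almost sure
  convergence does not pass through a conditional expectation by itself; hence the separate argument
  by truncated means.\<close>

lemma gronwall_integrable:
  fixes v g :: "real \<Rightarrow> real"
  assumes "0 \<le> K" and v: "v integrable_on {0..T}" and g: "g integrable_on {0..T}"
    and g0: "\<And>t. t \<in> {0..T} \<Longrightarrow> 0 \<le> g t"
    and le: "\<And>t. t \<in> {0..T} \<Longrightarrow> v t \<le> g t + K * integral {0..t} v"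
    and t: "t \<in> {0..T}"
  shows "v t \<le> g t + K * (exp (K * t) * integral {0..t} g)"
proof -
  \<comment> \<open>As \<open>v\<close> is merely integrable, the comparison runs on its primitive
    \<open>h\<close>, which is continuous. The majorant \<open>\<theta>\<close> of \<open>h\<close>
    is then differentiable, and \<open>\<theta>' = K * h \<le> K * \<theta>\<close> makes
    \<open>\<theta> s * exp (- (K * s))\<close> nonincreasing.\<close>
  define h where "h = (\<lambda>s. integral {0..s} v)"
  define G where "G = integral {0..t} g"
  have sub: "f integrable_on {0..s}" if "f integrable_on {0..T}" "s \<le> T" for f :: "real \<Rightarrow> real" and s
    using that by (auto intro: integrable_on_subinterval)
  have ch: "continuous_on {0..t} h"
    unfolding h_def by (rule indefinite_integral_continuous_1) (use sub[OF v] t in auto)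
  have ih: "h integrable_on {0..s}" if "s \<le> t" for s
    by (intro integrable_continuous_real continuous_on_subset[OF ch]) (use that in auto)
  define \<theta> where "\<theta> = (\<lambda>s. G + K * integral {0..s} h)"
  have h_le: "h s \<le> \<theta> s" if s: "s \<in> {0..t}" for s
  proof -
    have "h s \<le> integral {0..s} (\<lambda>r. g r + K * h r)"
      unfolding h_def
      by (rule integral_le)
        (use s t le in \<open>auto intro!: integrable_add sub[OF v] sub[OF g] integrable_on_mult_right
            ih[unfolded h_def]\<close>)
    also have "\<dots> = integral {0..s} g + K * integral {0..s} h"
      using s t by (subst integral_add) (auto intro!: integrable_on_mult_right ih sub[OF g])
    also have "integral {0..s} g \<le> G"
      unfolding G_def by (rule integral_subset_le) (use s t g0 in \<open>auto intro!: sub[OF g]\<close>)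
    finally show ?thesis by (simp add: \<theta>_def)
  qed
  have der: "(\<theta> has_real_derivative K * h s) (at s within {0..t})" if "s \<in> {0..t}" for s
    unfolding \<theta>_def by (auto intro!: derivative_eq_intros integral_has_real_derivative ch that)
  have "\<theta> t * exp (- (K * t)) \<le> \<theta> 0 * exp (- (K * 0))"
  proof (rule DERIV_nonpos_imp_decreasing_open[where f = "\<lambda>s. \<theta> s * exp (- (K * s))"])
    show "0 \<le> t" using t by auto
    show "continuous_on {0..t} (\<lambda>s. \<theta> s * exp (- (K * s)))"
      by (intro continuous_intros DERIV_continuous_on[OF der])
    fix s assume s: "0 < s" "s < t"
    have "(\<theta> has_real_derivative K * h s) (at s)"
      using der[of s] s by (simp add: at_within_Icc_at)
    then have "((\<lambda>s. \<theta> s * exp (- (K * s))) has_real_derivative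
        K * (h s - \<theta> s) * exp (- (K * s))) (at s)"
      by (auto intro!: derivative_eq_intros simp: algebra_simps)
    moreover have "K * (h s - \<theta> s) * exp (- (K * s)) \<le> 0"
      using h_le[of s] s \<open>0 \<le> K\<close> by (intro mult_nonpos_nonneg mult_nonneg_nonpos) auto
    ultimately show "\<exists>y. ((\<lambda>s. \<theta> s * exp (- (K * s))) has_real_derivative y) (at s) \<and> y \<le> 0"
      by blast
  qed
  then have "\<theta> t \<le> exp (K * t) * G"
    by (simp add: \<theta>_def exp_minus field_simps)
  moreover have "h t \<le> \<theta> t" using h_le t by auto
  ultimately have "K * h t \<le> K * (exp (K * t) * G)"
    using \<open>0 \<le> K\<close> by (intro mult_left_mono) auto
  with le[OF t] show ?thesis by (simp add: h_def G_def)
qed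

text \<open>Gronwall backwards in time for the energy \<open>V = u^2 + v^2\<close>: the bound on the
  coefficients gives \<open>V' \<ge> - 4 * K * V\<close>, so \<open>V s * exp (4 * K * s)\<close> is
  nonnegative and nondecreasing and ends at zero.\<close>

lemma linear_ode_terminal_zero:
  fixes u v :: "real \<Rightarrow> real"
  assumes u: "\<And>s. s \<in> {\<tau>..T} \<Longrightarrow>
      (u has_real_derivative p s * u s + p' s * v s) (at s within {\<tau>..T})"
    and v: "\<And>s. s \<in> {\<tau>..T} \<Longrightarrow>
      (v has_real_derivative r s * u s + r' s * v s) (at s within {\<tau>..T})"
    and bd: "\<And>s. s \<in> {\<tau>..T} \<Longrightarrow> \<bar>p s\<bar> \<le> K \<and> \<bar>p' s\<bar> \<le> K \<and> \<bar>r s\<bar> \<le> K \<and> \<bar>r' s\<bar> \<le> K"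
    and "u T = 0" "v T = 0" "t \<in> {\<tau>..T}"
  shows "u t = 0 \<and> v t = 0"
proof -
  define V where "V = (\<lambda>s. (u s)\<^sup>2 + (v s)\<^sup>2)"
  define V' where "V' = (\<lambda>s. 2 * (u s * (p s * u s + p' s * v s)) + 2 * (v s * (r s * u s + r' s * v s)))"
  have dV: "(V has_real_derivative V' s) (at s within {\<tau>..T})" if "s \<in> {\<tau>..T}" for s
    unfolding V_def V'_def
    by (auto intro!: derivative_eq_intros u[OF that] v[OF that] simp: algebra_simps)
  have V'_ge: "- (4 * K) * V s \<le> V' s" if s: "s \<in> {\<tau>..T}" for s
  proof -
    define x y where "x = \<bar>u s\<bar>" and "y = \<bar>v s\<bar>"
    have m: "- (z * (\<alpha> * w)) \<le> K * (\<bar>z\<bar> * \<bar>w\<bar>)" if "\<bar>\<alpha>\<bar> \<le> K" for z w \<alpha> :: real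
    proof -
      have "- (z * (\<alpha> * w)) \<le> \<bar>\<alpha>\<bar> * (\<bar>z\<bar> * \<bar>w\<bar>)"
        using abs_ge_minus_self[of "z * (\<alpha> * w)"] by (simp add: abs_mult ac_simps)
      also have "\<dots> \<le> K * (\<bar>z\<bar> * \<bar>w\<bar>)" using that by (rule mult_right_mono) simp
      finally show ?thesis .
    qed
    have K: "0 \<le> K" using bd[OF s] by linarith
    have V: "V s = x\<^sup>2 + y\<^sup>2" by (simp add: V_def x_def y_def)
    have uv: "x * y \<le> V s / 2"
      using sum_squares_bound[of x y] by (simp add: V)
    have "- V' s \<le> 2 * (K * (x * x) + K * (x * y)) + 2 * (K * (x * y) + K * (y * y))"
      using m[of "p s" "u s" "u s", folded x_def] m[of "p' s" "u s" "v s", folded x_def y_def]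
        m[of "r s" "v s" "u s", folded x_def y_def, unfolded mult.commute[of y x]] m[of "r' s" "v s" "v s", folded y_def] bd[OF s]
      unfolding V'_def distrib_left by auto
    also have "\<dots> = 2 * K * V s + 4 * (K * (x * y))"
      by (simp add: V power2_eq_square algebra_simps)
    also have "K * (x * y) \<le> K * (V s / 2)"
      using uv K by (rule mult_left_mono)
    finally show ?thesis by (simp add: algebra_simps)
  qed
  have "V t * exp (4 * K * t) \<le> V T * exp (4 * K * T)"
  proof (rule DERIV_nonneg_imp_increasing_open[where f = "\<lambda>s. V s * exp (4 * K * s)"])
    show "t \<le> T" using assms by auto
    have "continuous_on {\<tau>..T} (\<lambda>s. V s * exp (4 * K * s))"
      by (intro continuous_intros DERIV_continuous_on[OF dV])
    then show "continuous_on {t..T} (\<lambda>s. V s * exp (4 * K * s))"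
      by (rule continuous_on_subset) (use assms in auto)
    fix s assume s: "t < s" "s < T"
    have "(V has_real_derivative V' s) (at s)"
      using dV[of s] s \<open>t \<in> _\<close> by (simp add: at_within_Icc_at)
    then have "((\<lambda>s. V s * exp (4 * K * s)) has_real_derivative
        (V' s + 4 * K * V s) * exp (4 * K * s)) (at s)"
      by (auto intro!: derivative_eq_intros simp: algebra_simps)
    moreover have "0 \<le> (V' s + 4 * K * V s) * exp (4 * K * s)"
      using V'_ge[of s] s \<open>t \<in> _\<close> by (intro mult_nonneg_nonneg) auto
    ultimately show "\<exists>y. ((\<lambda>s. V s * exp (4 * K * s)) has_real_derivative y) (at s) \<and> 0 \<le> y"
      by blast
  qed
  then have "V t * exp (4 * K * t) \<le> 0" using assms by (simp add: V_def)
  then have "V t \<le> 0" by (simp add: mult_le_0_iff)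
  then show ?thesis by (simp add: V_def sum_power2_le_zero_iff)
qed

section \<open>Entries of the Riccati solution, and decoupling of deterministic systems\<close>

lemma mat22_nth [simp]:
  "mat22 p q r s $ 1 $ 1 = p" "mat22 p q r s $ 1 $ 2 = q"
  "mat22 p q r s $ 2 $ 1 = r" "mat22 p q r s $ 2 $ 2 = s"
  by (simp_all add: mat22_def)

text \<open>Row and column 1 belong to the major player, row and column 2 to the aggregated minor
  players, so \<open>S t $ 1 $ 2\<close> is the entry written with superscripts 0,1 in the
  mathematical notation.\<close>

definition lq_riccati ::
    "real \<Rightarrow> real \<Rightarrow> real \<Rightarrow> real \<Rightarrow> real \<Rightarrow> (real \<Rightarrow> real^2^2) \<Rightarrow> bool" where
  "lq_riccati T a b c q S \<longleftrightarrow>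
     riccati_solution T (mat22 0 a c 0) (mat22 (- (b\<^sup>2 / 2)) 0 0 0) (mat22 (2 * q) 0 0 0)
       (mat22 0 c a 0) S"

lemma lq_riccati_deriv:
  assumes "lq_riccati T a b c q S" "t \<in> {0..T}"
  shows "((\<lambda>t. S t $ 1 $ 1) has_real_derivative
           b\<^sup>2 / 2 * (S t $ 1 $ 1)\<^sup>2 - c * S t $ 1 $ 2 - c * S t $ 2 $ 1 - 2 * q) (at t within {0..T})"
    and "((\<lambda>t. S t $ 1 $ 2) has_real_derivative
           b\<^sup>2 / 2 * (S t $ 1 $ 1 * S t $ 1 $ 2) - a * S t $ 1 $ 1 - c * S t $ 2 $ 2)
           (at t within {0..T})"
    and "((\<lambda>t. S t $ 2 $ 1) has_real_derivative
           b\<^sup>2 / 2 * (S t $ 2 $ 1 * S t $ 1 $ 1) - c * S t $ 2 $ 2 - a * S t $ 1 $ 1)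
           (at t within {0..T})"
    and "((\<lambda>t. S t $ 2 $ 2) has_real_derivative
           b\<^sup>2 / 2 * (S t $ 2 $ 1 * S t $ 1 $ 2) - a * S t $ 2 $ 1 - a * S t $ 1 $ 2)
           (at t within {0..T})"
proof -
  obtain S' where S': "(S has_vector_derivative S') (at t within {0..T})"
    and eq: "S' + S t ** mat22 0 a c 0 + mat22 0 c a 0 ** S t
       + S t ** mat22 (- (b\<^sup>2 / 2)) 0 0 0 ** S t + mat22 (2 * q) 0 0 0 = 0"
    using assms unfolding lq_riccati_def riccati_solution_def by blast
  have comp: "((\<lambda>t. S t $ i $ j) has_real_derivative S' $ i $ j) (at t within {0..T})" for i j
    using bounded_linear.has_vector_derivative[OF
        bounded_linear_compose[OF bounded_linear_vec_nth bounded_linear_vec_nth] S', of i j]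
    by (simp add: has_real_derivative_iff_has_vector_derivative)
  have eq': "(S' + S t ** mat22 0 a c 0 + mat22 0 c a 0 ** S t
       + S t ** mat22 (- (b\<^sup>2 / 2)) 0 0 0 ** S t + mat22 (2 * q) 0 0 0) $ i $ j = 0" for i j
    unfolding eq by simp
  note E = eq'[of 1 1] eq'[of 1 2] eq'[of 2 1] eq'[of 2 2]
  note E' = E[unfolded vector_add_component matrix_matrix_mult_def vec_lambda_beta sum_2 mat22_nth]
  show "((\<lambda>t. S t $ 1 $ 1) has_real_derivative
           b\<^sup>2 / 2 * (S t $ 1 $ 1)\<^sup>2 - c * S t $ 1 $ 2 - c * S t $ 2 $ 1 - 2 * q) (at t within {0..T})"
    by (rule DERIV_cong[OF comp]) (use E'(1) in \<open>simp add: algebra_simps power2_eq_square\<close>)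
  show "((\<lambda>t. S t $ 1 $ 2) has_real_derivative
           b\<^sup>2 / 2 * (S t $ 1 $ 1 * S t $ 1 $ 2) - a * S t $ 1 $ 1 - c * S t $ 2 $ 2)
           (at t within {0..T})"
    by (rule DERIV_cong[OF comp]) (use E'(2) in \<open>simp add: algebra_simps power2_eq_square\<close>)
  show "((\<lambda>t. S t $ 2 $ 1) has_real_derivative
           b\<^sup>2 / 2 * (S t $ 2 $ 1 * S t $ 1 $ 1) - c * S t $ 2 $ 2 - a * S t $ 1 $ 1)
           (at t within {0..T})"
    by (rule DERIV_cong[OF comp]) (use E'(3) in \<open>simp add: algebra_simps power2_eq_square\<close>)
  show "((\<lambda>t. S t $ 2 $ 2) has_real_derivative
           b\<^sup>2 / 2 * (S t $ 2 $ 1 * S t $ 1 $ 2) - a * S t $ 2 $ 1 - a * S t $ 1 $ 2)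
           (at t within {0..T})"
    by (rule DERIV_cong[OF comp]) (use E'(4) in \<open>simp add: algebra_simps power2_eq_square\<close>)
qed

lemma lq_riccati_terminal:
  "lq_riccati T a b c q S \<Longrightarrow> S T = 0"
  by (simp add: lq_riccati_def riccati_solution_def)

lemma lq_riccati_continuous:
  assumes "lq_riccati T a b c q S"
  shows "continuous_on {0..T} S"
proof -
  have "\<exists>S'. (S has_vector_derivative S') (at t within {0..T})" if "t \<in> {0..T}" for t
    using assms that unfolding lq_riccati_def riccati_solution_def by blast
  then show ?thesis
    unfolding continuous_on_eq_continuous_within
    by (metis has_vector_derivative_continuous)
qed

lemma lq_riccati_bounded:
  assumes "lq_riccati T a b c q S"
  obtains C where "0 \<le> C" "\<And>t i j. t \<in> {0..T} \<Longrightarrow> \<bar>S t $ i $ j\<bar> \<le> C"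
proof -
  from lq_riccati_continuous[OF assms] have "bounded (S ` {0..T})"
    by (intro compact_imp_bounded compact_continuous_image) auto
  then obtain C where "\<forall>x\<in>S ` {0..T}. norm x \<le> C"
    unfolding bounded_iff by blast
  then have C: "\<And>t. t \<in> {0..T} \<Longrightarrow> norm (S t) \<le> C" by blast
  have "\<bar>S t $ i $ j\<bar> \<le> max C 0" if "t \<in> {0..T}" for t i j
    using Finite_Cartesian_Product.norm_nth_le[of "S t" i]
      Finite_Cartesian_Product.norm_nth_le[of "S t $ i" j] C[OF that] by simp
  with that[of "max C 0"] show ?thesis by simp
qed

text \<open>The residuals \<open>n0 - (S m)\<close> and \<open>n1 - (S m)\<close> vanish at
  \<open>T\<close>. In their derivatives the Riccati equation is exactly what cancels every term in
  \<open>m0\<close> and \<open>m1\<close>, leaving a homogeneous linear system in the residuals with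
  bounded coefficients, whose only solution with zero terminal value is zero.\<close>

lemma riccati_decoupling:
  fixes m0 m1 n0 n1 :: "real \<Rightarrow> real"
  assumes S: "lq_riccati T a b c q S" and "0 \<le> \<tau>"
    and int: "m0 integrable_on {\<tau>..T}" "m1 integrable_on {\<tau>..T}"
      "n0 integrable_on {\<tau>..T}" "n1 integrable_on {\<tau>..T}"
    and m0: "\<And>s. s \<in> {\<tau>..T} \<Longrightarrow> m0 s = \<mu>0 + integral {\<tau>..s} (\<lambda>r. a * m1 r - (1/2) * b\<^sup>2 * n0 r)"
    and m1: "\<And>s. s \<in> {\<tau>..T} \<Longrightarrow> m1 s = \<mu>1 + integral {\<tau>..s} (\<lambda>r. c * m0 r)"
    and n0: "\<And>s. s \<in> {\<tau>..T} \<Longrightarrow> n0 s = integral {s..T} (\<lambda>r. c * n1 r + 2 * q * m0 r)"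
    and n1: "\<And>s. s \<in> {\<tau>..T} \<Longrightarrow> n1 s = integral {s..T} (\<lambda>r. a * n0 r)"
    and t: "t \<in> {\<tau>..T}"
  shows "n0 t = S t $ 1 $ 1 * m0 t + S t $ 1 $ 2 * m1 t
       \<and> n1 t = S t $ 2 $ 1 * m0 t + S t $ 2 $ 2 * m1 t"
proof -
  \<comment> \<open>Only integrability is known at the outset. The integral equations themselves
    raise the four functions to continuity, and a second pass through them to
    differentiability.\<close>
  have fwd: "continuous_on {\<tau>..T} f"
    if "g integrable_on {\<tau>..T}" "\<And>s. s \<in> {\<tau>..T} \<Longrightarrow> f s = \<mu> + integral {\<tau>..s} g"
    for f g :: "real \<Rightarrow> real" and \<mu>
    using indefinite_integral_continuous_1[OF that(1)] that(2)
    by (subst continuous_on_cong[OF refl that(2)]) (auto intro!: continuous_intros)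
  have bwd: "continuous_on {\<tau>..T} f"
    if "g integrable_on {\<tau>..T}" "\<And>s. s \<in> {\<tau>..T} \<Longrightarrow> f s = integral {s..T} g"
    for f g :: "real \<Rightarrow> real"
    using indefinite_integral_continuous_1'[OF that(1)] that(2)
    by (subst continuous_on_cong[OF refl that(2)]) auto
  have cont: "continuous_on {\<tau>..T} m0" "continuous_on {\<tau>..T} m1"
    "continuous_on {\<tau>..T} n0" "continuous_on {\<tau>..T} n1"
    by (rule fwd[OF _ m0], intro integrable_diff integrable_on_mult_right int, assumption)
      (rule fwd[OF _ m1], intro integrable_on_mult_right int, assumption,
       rule bwd[OF _ n0], intro integrable_add integrable_on_mult_right int, assumption,
       rule bwd[OF _ n1], intro integrable_on_mult_right int, assumption)
  have dfwd: "(f has_real_derivative g s) (at s within {\<tau>..T})"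
    if "continuous_on {\<tau>..T} g" "\<And>s. s \<in> {\<tau>..T} \<Longrightarrow> f s = \<mu> + integral {\<tau>..s} g" "s \<in> {\<tau>..T}"
    for f g :: "real \<Rightarrow> real" and \<mu> s
  proof -
    have "((\<lambda>s. \<mu> + integral {\<tau>..s} g) has_real_derivative g s) (at s within {\<tau>..T})"
      by (auto intro!: derivative_eq_intros integral_has_real_derivative that)
    then show ?thesis
      by (rule has_field_derivative_transform_within[OF _ zero_less_one \<open>s \<in> _\<close>])
        (use that(2) in auto)
  qed
  have dbwd: "(f has_real_derivative - g s) (at s within {\<tau>..T})"
    if g: "continuous_on {\<tau>..T} g" and f: "\<And>s. s \<in> {\<tau>..T} \<Longrightarrow> f s = integral {s..T} g"
      and s: "s \<in> {\<tau>..T}"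
    for f g :: "real \<Rightarrow> real" and s
  proof (rule dfwd[where \<mu> = "integral {\<tau>..T} g" and g = "\<lambda>r. - g r", OF _ _ s])
    show "continuous_on {\<tau>..T} (\<lambda>r. - g r)" using g by (intro continuous_intros)
    fix r assume r: "r \<in> {\<tau>..T}"
    have "integral {\<tau>..r} g + integral {r..T} g = integral {\<tau>..T} g"
      by (rule Henstock_Kurzweil_Integration.integral_combine) (use r g in \<open>auto intro: integrable_continuous_real\<close>)
    then show "f r = integral {\<tau>..T} g + integral {\<tau>..r} (\<lambda>r. - g r)"
      using f[OF r] by simp
  qed
  have d0: "(m0 has_real_derivative a * m1 s - (1/2) * b\<^sup>2 * n0 s) (at s within {\<tau>..T})"
    and d1: "(m1 has_real_derivative c * m0 s) (at s within {\<tau>..T})"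
    and e0: "(n0 has_real_derivative - (c * n1 s + 2 * q * m0 s)) (at s within {\<tau>..T})"
    and e1: "(n1 has_real_derivative - (a * n0 s)) (at s within {\<tau>..T})"
    if s: "s \<in> {\<tau>..T}" for s
    by (rule dfwd[OF _ m0 s], intro continuous_intros cont, assumption)
      (rule dfwd[OF _ m1 s], intro continuous_intros cont, assumption,
       rule dbwd[OF _ n0 s], intro continuous_intros cont, assumption,
       rule dbwd[OF _ n1 s], intro continuous_intros cont, assumption)
  have sub: "{\<tau>..T} \<subseteq> {0..T}" using \<open>0 \<le> \<tau>\<close> by auto
  have dS: "((\<lambda>t. S t $ 1 $ 1) has_real_derivative
           b\<^sup>2 / 2 * (S s $ 1 $ 1)\<^sup>2 - c * S s $ 1 $ 2 - c * S s $ 2 $ 1 - 2 * q) (at s within {\<tau>..T})"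
     "((\<lambda>t. S t $ 1 $ 2) has_real_derivative
           b\<^sup>2 / 2 * (S s $ 1 $ 1 * S s $ 1 $ 2) - a * S s $ 1 $ 1 - c * S s $ 2 $ 2)
           (at s within {\<tau>..T})"
    "((\<lambda>t. S t $ 2 $ 1) has_real_derivative
           b\<^sup>2 / 2 * (S s $ 2 $ 1 * S s $ 1 $ 1) - c * S s $ 2 $ 2 - a * S s $ 1 $ 1)
           (at s within {\<tau>..T})"
    "((\<lambda>t. S t $ 2 $ 2) has_real_derivative
           b\<^sup>2 / 2 * (S s $ 2 $ 1 * S s $ 1 $ 2) - a * S s $ 2 $ 1 - a * S s $ 1 $ 2)
           (at s within {\<tau>..T})"
    if s: "s \<in> {\<tau>..T}" for s
    using lq_riccati_deriv[OF S, of s] s sub by (auto intro: DERIV_subset)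
  define u where "u = (\<lambda>s. n0 s - (S s $ 1 $ 1 * m0 s + S s $ 1 $ 2 * m1 s))"
  define v where "v = (\<lambda>s. n1 s - (S s $ 2 $ 1 * m0 s + S s $ 2 $ 2 * m1 s))"
  obtain C where C: "0 \<le> C" "\<And>t i j. t \<in> {0..T} \<Longrightarrow> \<bar>S t $ i $ j\<bar> \<le> C"
    using lq_riccati_bounded[OF S] by metis
  define K where "K = b\<^sup>2 / 2 * C + \<bar>c\<bar> + \<bar>a\<bar>"
  have bS: "\<bar>b\<^sup>2 / 2 * S s $ i $ j\<bar> \<le> b\<^sup>2 / 2 * C" if "s \<in> {\<tau>..T}" for s i j
    using C(2)[of s i j] that sub by (simp add: abs_mult mult_left_mono)
  have "u t = 0 \<and> v t = 0"
  proof (rule linear_ode_terminal_zero[where u = u and v = v and K = K and \<tau> = \<tau> and T = T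
        and p = "\<lambda>s. b\<^sup>2 / 2 * S s $ 1 $ 1" and p' = "\<lambda>_. - c"
        and r = "\<lambda>s. - a + b\<^sup>2 / 2 * S s $ 2 $ 1" and r' = "\<lambda>_. 0"])
    fix s assume s: "s \<in> {\<tau>..T}"
    show "(u has_real_derivative b\<^sup>2 / 2 * S s $ 1 $ 1 * u s + - c * v s) (at s within {\<tau>..T})"
      unfolding u_def v_def
      by (auto intro!: derivative_eq_intros d0[OF s] d1[OF s] e0[OF s] e1[OF s] dS[OF s]
          simp: algebra_simps power2_eq_square)
    show "(v has_real_derivative (- a + b\<^sup>2 / 2 * S s $ 2 $ 1) * u s + 0 * v s) (at s within {\<tau>..T})"
      unfolding u_def v_def
      by (auto intro!: derivative_eq_intros d0[OF s] d1[OF s] e0[OF s] e1[OF s] dS[OF s]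
          simp: algebra_simps power2_eq_square)
    show "\<bar>b\<^sup>2 / 2 * S s $ 1 $ 1\<bar> \<le> K \<and> \<bar>- c\<bar> \<le> K \<and> \<bar>- a + b\<^sup>2 / 2 * S s $ 2 $ 1\<bar> \<le> K \<and> \<bar>0\<bar> \<le> K"
      using bS[OF s, of 1 1] bS[OF s, of 2 1] unfolding K_def by linarith
  next
    show "u T = 0" "v T = 0"
      using n0[of T] n1[of T] t by (simp_all add: u_def v_def lq_riccati_terminal[OF S])
  qed (rule t)
  then show ?thesis by (simp add: u_def v_def)
qed

text \<open>Serves two purposes: along a sample path, with \<open>g\<close> the absolute noise
  difference, and for truncated means, with \<open>g = 0\<close>. The set \<open>Z\<close> is there
  because along a path the feedback relation is available only at almost every time. In
  \<open>K\<close>, the feedback contributes \<open>b\<^sup>2 / 2 * C\<close>, rounded up to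
  \<open>b\<^sup>2 * C\<close>.\<close>

lemma lq_difference_bound:
  fixes \<delta>0 \<delta>1 g :: "real \<Rightarrow> real"
  assumes S: "\<And>t i j. t \<in> {0..T} \<Longrightarrow> \<bar>S t $ i $ j\<bar> \<le> (C::real)" and C: "0 \<le> C"
    and K: "K = \<bar>a\<bar> + \<bar>c\<bar> + b\<^sup>2 * C"
    and int: "\<delta>0 integrable_on {0..T}" "\<delta>1 integrable_on {0..T}"
      "\<eta> integrable_on {0..T}" "g integrable_on {0..T}"
      "(\<lambda>t. \<bar>\<delta>0 t\<bar>) integrable_on {0..T}" "(\<lambda>t. \<bar>\<delta>1 t\<bar>) integrable_on {0..T}"
    and \<delta>0: "\<And>t. t \<in> {0..T} \<Longrightarrow> \<delta>0 t = integral {0..t} (\<lambda>s. a * \<delta>1 s - (1/2) * b\<^sup>2 * \<eta> s)"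
    and \<delta>1: "\<And>t. t \<in> {0..T} \<Longrightarrow> \<bar>\<delta>1 t - integral {0..t} (\<lambda>s. c * \<delta>0 s)\<bar> \<le> g t"
    and \<eta>: "negligible Z" "\<And>t. t \<in> {0..T} - Z \<Longrightarrow> \<eta> t = S t $ 1 $ 1 * \<delta>0 t + S t $ 1 $ 2 * \<delta>1 t"
    and t: "t \<in> {0..T}"
  shows "\<bar>\<delta>0 t\<bar> + \<bar>\<delta>1 t\<bar> \<le> g t + K * (exp (K * t) * integral {0..t} g)"
proof (rule gronwall_integrable[OF _ _ \<open>g integrable_on _\<close> _ _ t])
  show "0 \<le> K" using C by (simp add: K)
  show *: "(\<lambda>t. \<bar>\<delta>0 t\<bar> + \<bar>\<delta>1 t\<bar>) integrable_on {0..T}" by (intro integrable_add int)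
  fix t assume t: "t \<in> {0..T}"
  then show "0 \<le> g t" using \<delta>1[OF t] by linarith
  have sub: "f integrable_on {0..t}" if "f integrable_on {0..T}" for f :: "real \<Rightarrow> real"
    using that t by (auto intro: integrable_on_subinterval)
  \<comment> \<open>Replacing \<open>\<eta>\<close> by the feedback expression leaves every integral
    unchanged, since the two differ only on the negligible set \<open>Z\<close>; the pointwise
    estimate below is then valid at all times.\<close>
  define \<eta>' where "\<eta>' = (\<lambda>s. S s $ 1 $ 1 * \<delta>0 s + S s $ 1 $ 2 * \<delta>1 s)"
  have \<eta>': "\<eta>' integrable_on {0..T}"
    by (rule integrable_spike[OF int(3) \<eta>(1)]) (use \<eta>(2) in \<open>simp add: \<eta>'_def\<close>)
  have \<delta>0': "\<delta>0 t = integral {0..t} (\<lambda>s. a * \<delta>1 s - (1/2) * b\<^sup>2 * \<eta>' s)"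
    unfolding \<delta>0[OF t]
    by (rule integral_spike[OF \<eta>(1)]) (use \<eta>(2) t in \<open>auto simp: \<eta>'_def\<close>)
  have "\<bar>\<delta>0 t\<bar> \<le> integral {0..t} (\<lambda>s. (\<bar>a\<bar> + b\<^sup>2 * C) * (\<bar>\<delta>0 s\<bar> + \<bar>\<delta>1 s\<bar>))"
    unfolding \<delta>0' real_norm_def[symmetric]
  proof (rule integral_norm_bound_integral)
    fix s assume s: "s \<in> {0..t}"
    then have s': "s \<in> {0..T}" using t by auto
    have half: "x / 2 \<le> y" if "x \<le> y" "0 \<le> x" for x y :: real using that by simp
    have "\<bar>\<eta>' s\<bar> \<le> \<bar>S s $ 1 $ 1\<bar> * \<bar>\<delta>0 s\<bar> + \<bar>S s $ 1 $ 2\<bar> * \<bar>\<delta>1 s\<bar>"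
      unfolding \<eta>'_def by (simp add: abs_mult[symmetric])
    also have "\<dots> \<le> C * \<bar>\<delta>0 s\<bar> + C * \<bar>\<delta>1 s\<bar>"
      by (intro add_mono mult_right_mono S s') auto
    finally have "b\<^sup>2 * \<bar>\<eta>' s\<bar> / 2 \<le> b\<^sup>2 * (C * \<bar>\<delta>0 s\<bar> + C * \<bar>\<delta>1 s\<bar>)"
      by (rule half[OF mult_left_mono]) simp_all
    moreover have "norm (a * \<delta>1 s - (1/2) * b\<^sup>2 * \<eta>' s) \<le> \<bar>a\<bar> * \<bar>\<delta>1 s\<bar> + b\<^sup>2 * \<bar>\<eta>' s\<bar> / 2"
      using abs_triangle_ineq4[of "a * \<delta>1 s" "(1/2) * b\<^sup>2 * \<eta>' s"] by (simp add: abs_mult)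
    ultimately have "norm (a * \<delta>1 s - (1/2) * b\<^sup>2 * \<eta>' s)
        \<le> \<bar>a\<bar> * \<bar>\<delta>1 s\<bar> + b\<^sup>2 * (C * \<bar>\<delta>0 s\<bar> + C * \<bar>\<delta>1 s\<bar>)"
      by (meson add_left_mono order_trans)
    also have "\<dots> \<le> (\<bar>a\<bar> + b\<^sup>2 * C) * (norm (\<delta>0 s) + norm (\<delta>1 s))"
      by (simp add: algebra_simps)
    finally show "norm (a * \<delta>1 s - (1/2) * b\<^sup>2 * \<eta>' s)
        \<le> (norm a + b\<^sup>2 * C) * (norm (\<delta>0 s) + norm (\<delta>1 s))"
      unfolding real_norm_def .
  qed (auto intro!: integrable_diff integrable_add integrable_on_mult_right sub int \<eta>')
  then have A: "\<bar>\<delta>0 t\<bar> \<le> (\<bar>a\<bar> + b\<^sup>2 * C) * integral {0..t} (\<lambda>s. \<bar>\<delta>0 s\<bar> + \<bar>\<delta>1 s\<bar>)"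
    by simp
  have "\<bar>integral {0..t} (\<lambda>s. c * \<delta>0 s)\<bar> \<le> integral {0..t} (\<lambda>s. \<bar>c\<bar> * (\<bar>\<delta>0 s\<bar> + \<bar>\<delta>1 s\<bar>))"
    unfolding real_norm_def[symmetric]
    by (rule integral_norm_bound_integral)
      (auto intro!: integrable_add integrable_on_mult_right sub int mult_left_mono simp: abs_mult)
  then have "\<bar>\<delta>1 t\<bar> \<le> g t + \<bar>c\<bar> * integral {0..t} (\<lambda>s. \<bar>\<delta>0 s\<bar> + \<bar>\<delta>1 s\<bar>)"
    using \<delta>1[OF t] by simp
  with A show "\<bar>\<delta>0 t\<bar> + \<bar>\<delta>1 t\<bar> \<le> g t + K * integral {0..t} (\<lambda>s. \<bar>\<delta>0 s\<bar> + \<bar>\<delta>1 s\<bar>)"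
    by (simp add: K algebra_simps)
qed

section \<open>Independence of Wiener increments\<close>

lemma space_natural_filtration [simp]: "space (natural_filtration M V t) = space M"
  by (simp add: natural_filtration_def space_measure_of_conv)

lemma sets_natural_filtration:
  "sets (natural_filtration M V t) =
     sigma_sets (space M) {X s -` B \<inter> space M | X s B. X \<in> V \<and> s \<in> {0..t} \<and> B \<in> sets borel}"
  unfolding natural_filtration_def by (rule sets_measure_of) auto

lemma sets_natural_filtration_subset:
  assumes "space N = space M" "\<And>X s. X \<in> V \<Longrightarrow> s \<in> {0..t} \<Longrightarrow> X s \<in> borel_measurable N"
  shows "sets (natural_filtration M V t) \<subseteq> sets N"
proof -
  have "X s -` B \<inter> space M \<in> sets N" if "X \<in> V" "s \<in> {0..t}" "B \<in> sets borel" for X s B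
    using measurable_sets[OF assms(2)[OF that(1,2)] that(3)] assms(1) by simp
  then show ?thesis
    unfolding sets_natural_filtration assms(1)[symmetric]
    by (intro sets.sigma_sets_subset) auto
qed

lemma measurable_natural_filtration:
  "X \<in> V \<Longrightarrow> s \<in> {0..t} \<Longrightarrow> X s \<in> borel_measurable (natural_filtration M V t)"
  by (rule measurableI) (auto simp: sets_natural_filtration)

lemma natural_filtration_mono:
  assumes "s \<le> t" "V \<subseteq> V'"
  shows "sets (natural_filtration M V s) \<subseteq> sets (natural_filtration M V' t)"
  using assms by (intro sets_natural_filtration_subset measurable_natural_filtration) auto

lemma subalgebra_natural_filtration:
  assumes "\<And>X s. X \<in> V \<Longrightarrow> 0 \<le> s \<Longrightarrow> X s \<in> borel_measurable M"
  shows "subalgebra M (natural_filtration M V t)"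
  unfolding subalgebra_def using sets_natural_filtration_subset[of M M V t] assms by simp

lemma wiener_measurable:
  "independent_wiener_processes M V \<Longrightarrow> 0 \<le> t \<Longrightarrow> V i t \<in> borel_measurable M"
  by (auto simp: independent_wiener_processes_def wiener_process_def)

lemma subalgebra_wiener_filtration:
  "independent_wiener_processes M V \<Longrightarrow> subalgebra M (natural_filtration M (V ` J) t)"
  by (rule subalgebra_natural_filtration) (auto intro: wiener_measurable)

text \<open>The past of \<open>V j\<close> up to time \<open>r\<close> together with the other processes up to time \<open>t\<close>,
  which may exceed \<open>r\<close>.\<close>

definition enlarged_past :: "'a measure \<Rightarrow> ('i \<Rightarrow> 'a process) \<Rightarrow> 'i \<Rightarrow> real \<Rightarrow> 'i set \<Rightarrow> real \<Rightarrow> 'a measure"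
  where "enlarged_past M V j r J t = sigma (space M)
     (sets (natural_filtration M {V j} r) \<union> sets (natural_filtration M (V ` J) t))"

lemma space_enlarged_past [simp]: "space (enlarged_past M V j r J t) = space M"
  by (simp add: enlarged_past_def space_measure_of_conv)

lemma sets_enlarged_past:
  "sets (enlarged_past M V j r J t) = sigma_sets (space M)
     (sets (natural_filtration M {V j} r) \<union> sets (natural_filtration M (V ` J) t))"
  unfolding enlarged_past_def
  using sets.space_closed[of "natural_filtration M {V j} r"]
    sets.space_closed[of "natural_filtration M (V ` J) t"]
  by (intro sets_measure_of) simp

text \<open>Two sources of independence have to be merged: an increment of \<open>V j\<close> is
  independent of the past of \<open>V j\<close> by the definition of a Wiener process, and the whole
  path of \<open>V j\<close> is independent of the other paths. For \<open>e\<close> in the own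
  past, \<open>g\<close> from the others and \<open>d\<close> an increment event, the second splits
  off \<open>g\<close> and the first then separates \<open>e\<close> from \<open>d\<close>.\<close>

lemma increment_indep_enlarged_past:
  assumes "prob_space M" and V: "independent_wiener_processes M V"
    and r: "0 \<le> r" "r < r'" and j: "j \<notin> J"
  shows "prob_space.indep_set M (sets (enlarged_past M V j r J t))
     (sigma_sets (space M) {(\<lambda>\<omega>. V j r' \<omega> - V j r \<omega>) -` B \<inter> space M | B. B \<in> sets borel})"
proof -
  interpret prob_space M by fact
  let ?X = "\<lambda>i \<omega>. \<lambda>t\<in>{0..}. V i t \<omega>"
  define E where "E i = {?X i -` A \<inter> space M | A. A \<in> sets (\<Pi>\<^sub>M t\<in>{0::real..}. (borel :: real measure))}" for i
  have rv: "?X i \<in> M \<rightarrow>\<^sub>M (\<Pi>\<^sub>M t\<in>{0..}. borel)" for i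
    using wiener_measurable[OF V] by (intro measurable_restrict) auto
  have E: "indep_sets E UNIV"
    using V unfolding independent_wiener_processes_def indep_vars_def2 E_def by simp
  have stable: "Int_stable (E i)" for i
  proof (rule Int_stableI)
    fix a b assume "a \<in> E i" "b \<in> E i"
    then obtain A B where "a = ?X i -` A \<inter> space M" "A \<in> sets (\<Pi>\<^sub>M t\<in>{0::real..}. (borel :: real measure))"
      "b = ?X i -` B \<inter> space M" "B \<in> sets (\<Pi>\<^sub>M t\<in>{0::real..}. (borel :: real measure))"
      unfolding E_def by blast
    then show "a \<inter> b \<in> E i"
      unfolding E_def by (intro CollectI exI[of _ "A \<inter> B"]) auto
  qed
  have E_sub: "E i \<subseteq> Pow (space M)" for i unfolding E_def by auto
  define N where "N = (\<lambda>I. sigma (space M) (\<Union>i\<in>I. E i))"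
  have sN: "sets (N I) = sigma_sets (space M) (\<Union>i\<in>I. E i)" "space (N I) = space M" for I
    unfolding N_def using E_sub by (auto intro!: sets_measure_of simp: space_measure_of_conv)
  have VN: "V i s \<in> borel_measurable (N I)" if "i \<in> I" "0 \<le> s" for i s I
  proof (rule measurableI)
    fix B :: "real set" assume B: "B \<in> sets borel"
    have "(\<lambda>p. p s) -` B \<inter> space (\<Pi>\<^sub>M t\<in>{0..}. borel) \<in> sets (\<Pi>\<^sub>M t\<in>{0::real..}. (borel :: real measure))"
      using that B by (intro measurable_sets[OF measurable_component_singleton]) auto
    moreover have "V i s -` B \<inter> space M =
        ?X i -` ((\<lambda>p. p s) -` B \<inter> space (\<Pi>\<^sub>M t\<in>{0..}. borel)) \<inter> space M"
      using that by (auto simp: space_PiM)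
    ultimately have "V i s -` B \<inter> space M \<in> E i" unfolding E_def by blast
    then show "V i s -` B \<inter> space (N I) \<in> sets (N I)"
      using that by (auto simp: sN)
  qed simp
  \<comment> \<open>Grouping the indices into \<open>{j}\<close> and its complement, coded by
    \<open>bool\<close>, turns independence of the family of paths into independence of two
    sigma-algebras, \<open>N {j}\<close> and \<open>N (- {j})\<close>.\<close>
  have "indep_sets (\<lambda>b. sigma_sets (space M) (\<Union>i\<in>(case b of True \<Rightarrow> {j} | False \<Rightarrow> - {j}). E i)) UNIV"
    by (rule indep_sets_collect_sigma)
      (auto intro: indep_sets_mono_index[OF _ E] stable simp: disjoint_family_on_def split: bool.splits)
  then have ind: "indep_set (sets (N {j})) (sets (N (- {j})))"
    unfolding indep_set_def sN by (rule indep_sets_mono_sets) (auto split: bool.split)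
  define \<Delta> where "\<Delta> = {(\<lambda>\<omega>. V j r' \<omega> - V j r \<omega>) -` B \<inter> space M | B. B \<in> sets borel}"
  define \<E> where "\<E> = sets (natural_filtration M {V j} r)"
  define \<G> where "\<G> = sets (natural_filtration M (V ` J) t)"
  \<comment> \<open>A pi-system for the enlarged past: it is closed under intersection, and it
    contains both generating sigma-algebras because each of them contains the whole space.\<close>
  define P where "P = {e \<inter> g | e g. e \<in> \<E> \<and> g \<in> \<G>}"
  have \<E>: "\<E> \<subseteq> sets (N {j})" unfolding \<E>_def
    by (rule sets_natural_filtration_subset) (auto simp: sN(2) VN)
  have \<G>: "\<G> \<subseteq> sets (N (- {j}))" unfolding \<G>_def
    by (rule sets_natural_filtration_subset) (use j in \<open>auto simp: sN(2) intro!: VN\<close>)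
  have \<Delta>: "\<Delta> \<subseteq> sets (N {j})"
  proof -
    have "(\<lambda>\<omega>. V j r' \<omega> - V j r \<omega>) \<in> borel_measurable (N {j})"
      using r by (intro borel_measurable_diff VN) auto
    from measurable_sets[OF this] show ?thesis by (auto simp: \<Delta>_def sN(2))
  qed
  have ev: "sets (N {j}) \<subseteq> events" "sets (N (- {j})) \<subseteq> events"
    using ind by (auto dest: indep_setD_ev1 indep_setD_ev2)
  have wd: "indep_set \<E> \<Delta>"
    using V r unfolding \<E>_def \<Delta>_def independent_wiener_processes_def wiener_process_def by blast
  have "indep_set P \<Delta>"
  proof (rule indep_setI)
    show "P \<subseteq> events" "\<Delta> \<subseteq> events" using \<E> \<G> \<Delta> ev unfolding P_def by (auto intro!: sets.Int)
    fix p d assume "p \<in> P" and d: "d \<in> \<Delta>"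
    then obtain e g where p: "p = e \<inter> g" and e: "e \<in> \<E>" and g: "g \<in> \<G>" unfolding P_def by blast
    have "prob (p \<inter> d) = prob ((e \<inter> d) \<inter> g)" by (simp add: p Int_ac)
    also have "\<dots> = prob (e \<inter> d) * prob g"
      by (rule indep_setD[OF ind]) (use e d g \<E> \<Delta> \<G> in auto)
    also have "\<dots> = prob e * prob d * prob g"
      using indep_setD[OF wd e d] by simp
    also have "prob e * prob d * prob g = prob p * prob d"
      using indep_setD[OF ind subsetD[OF \<E> e] subsetD[OF \<G> g]] by (simp add: p)
    finally show "prob (p \<inter> d) = prob p * prob d" .
  qed
  moreover have "Int_stable P"
  proof (rule Int_stableI)
    fix a b assume "a \<in> P" "b \<in> P"
    then obtain e g e' g' where "a = e \<inter> g" "b = e' \<inter> g'" "e \<in> \<E>" "e' \<in> \<E>" "g \<in> \<G>" "g' \<in> \<G>"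
      unfolding P_def by blast
    then show "a \<inter> b \<in> P"
      unfolding P_def by (intro CollectI exI[of _ "e \<inter> e'"] exI[of _ "g \<inter> g'"]) (auto simp: \<E>_def \<G>_def)
  qed
  moreover have "Int_stable \<Delta>"
  proof (rule Int_stableI)
    fix a b assume "a \<in> \<Delta>" "b \<in> \<Delta>"
    then obtain A B where "a = (\<lambda>\<omega>. V j r' \<omega> - V j r \<omega>) -` A \<inter> space M" "A \<in> sets borel"
      "b = (\<lambda>\<omega>. V j r' \<omega> - V j r \<omega>) -` B \<inter> space M" "B \<in> sets borel"
      unfolding \<Delta>_def by blast
    then show "a \<inter> b \<in> \<Delta>"
      unfolding \<Delta>_def by (intro CollectI exI[of _ "A \<inter> B"]) auto
  qed
  ultimately have "indep_set (sigma_sets (space M) P) (sigma_sets (space M) \<Delta>)"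
    by (rule indep_set_sigma_sets)
  moreover have "sets (enlarged_past M V j r J t) \<subseteq> sigma_sets (space M) P"
    unfolding sets_enlarged_past
  proof (rule sigma_sets_mono, safe)
    have sp: "space M \<in> \<E>" "space M \<in> \<G>"
      using sets.top[of "natural_filtration M {V j} r"] sets.top[of "natural_filtration M (V ` J) t"]
      by (auto simp: \<E>_def \<G>_def)
    fix x
    { assume x: "x \<in> sets (natural_filtration M {V j} r)"
      have "x = x \<inter> space M" using sets.sets_into_space[OF x] by auto
      then have "x \<in> P" unfolding P_def using x sp by (auto simp: \<E>_def)
      then show "x \<in> sigma_sets (space M) P" by blast }
    { assume x: "x \<in> sets (natural_filtration M (V ` J) t)"
      have "x = space M \<inter> x" using sets.sets_into_space[OF x] by auto
      then have "x \<in> P" unfolding P_def using x sp by (auto simp: \<G>_def)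
      then show "x \<in> sigma_sets (space M) P" by blast }
  qed
  ultimately show ?thesis
    unfolding indep_set_def \<Delta>_def[symmetric]
    by (elim indep_sets_mono_sets) (auto split: bool.splits)
qed

lemma wiener_increment_integrable:
  assumes "prob_space M" "independent_wiener_processes M V" "0 \<le> r" "r \<le> r'"
  shows "integrable M (\<lambda>\<omega>. V j r' \<omega> - V j r \<omega>)" "(\<integral>\<omega>. V j r' \<omega> - V j r \<omega> \<partial>M) = 0"
proof -
  interpret prob_space M by fact
  have "integrable M (\<lambda>\<omega>. V j r' \<omega> - V j r \<omega>) \<and> (\<integral>\<omega>. V j r' \<omega> - V j r \<omega> \<partial>M) = 0"
  proof (cases "r = r'")
    case False
    then have D: "distributed M lborel (\<lambda>\<omega>. V j r' \<omega> - V j r \<omega>) (normal_density 0 (sqrt (r' - r)))"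
      using assms unfolding independent_wiener_processes_def wiener_process_def by auto
    have "integrable M (\<lambda>\<omega>. V j r' \<omega> - V j r \<omega>)"
      using distributed_integrable[OF D, of "\<lambda>x. x"] integrable_normal_moment[of "sqrt (r' - r)" 0 1]
        False assms by simp
    moreover have "expectation (\<lambda>\<omega>. V j r' \<omega> - V j r \<omega>) = 0"
      by (rule normal_distributed_expectation[OF _ D]) (use False assms in auto)
    ultimately show ?thesis by simp
  qed simp
  then show "integrable M (\<lambda>\<omega>. V j r' \<omega> - V j r \<omega>)" "(\<integral>\<omega>. V j r' \<omega> - V j r \<omega> \<partial>M) = 0" by auto
qed

lemma integrable_bounded_mult:
  fixes f \<eta> :: "'a \<Rightarrow> real"
  assumes "integrable M f" "\<eta> \<in> borel_measurable M" "\<And>\<omega>. \<omega> \<in> space M \<Longrightarrow> \<bar>\<eta> \<omega>\<bar> \<le> C"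
  shows "integrable M (\<lambda>\<omega>. \<eta> \<omega> * f \<omega>)"
proof (rule Bochner_Integration.integrable_bound)
  show "integrable M (\<lambda>\<omega>. C * f \<omega>)" using assms by simp
  show "(\<lambda>\<omega>. \<eta> \<omega> * f \<omega>) \<in> borel_measurable M" using assms by measurable
  show "AE \<omega> in M. norm (\<eta> \<omega> * f \<omega>) \<le> norm (C * f \<omega>)"
    using assms(3) by (intro AE_I2) (force simp: abs_mult intro!: mult_right_mono)
qed

lemma enlarged_past_increment:
  fixes \<eta> :: "'a \<Rightarrow> real"
  assumes "prob_space M" and V: "independent_wiener_processes M V"
    and r: "0 \<le> r" "r \<le> r'" and j: "j \<notin> J"
    and \<eta>: "\<eta> \<in> borel_measurable (enlarged_past M V j r J t)"
    and C: "\<And>\<omega>. \<omega> \<in> space M \<Longrightarrow> \<bar>\<eta> \<omega>\<bar> \<le> C"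
  shows "integrable M (\<lambda>\<omega>. \<eta> \<omega> * (V j r' \<omega> - V j r \<omega>))"
    and "(\<integral>\<omega>. \<eta> \<omega> * (V j r' \<omega> - V j r \<omega>) \<partial>M) = 0"
proof -
  interpret prob_space M by fact
  have "sets (enlarged_past M V j r J t) \<subseteq> events"
    unfolding sets_enlarged_past
    using subalgebra_wiener_filtration[OF V, of "{j}" r] subalgebra_wiener_filtration[OF V, of J t]
    by (intro sets.sigma_sets_subset) (auto simp: subalgebra_def)
  then have \<eta>M: "\<eta> \<in> borel_measurable M"
    using measurable_from_subalg[OF _ \<eta>, of M] by (auto simp: subalgebra_def)
  note int = wiener_increment_integrable[OF \<open>prob_space M\<close> V r]
  show "integrable M (\<lambda>\<omega>. \<eta> \<omega> * (V j r' \<omega> - V j r \<omega>))"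
    by (rule integrable_bounded_mult[OF int(1) \<eta>M C])
  show "(\<integral>\<omega>. \<eta> \<omega> * (V j r' \<omega> - V j r \<omega>) \<partial>M) = 0"
  proof (cases "r = r'")
    case False
    with r have "r < r'" by simp
    have "indep_var borel \<eta> borel (\<lambda>\<omega>. V j r' \<omega> - V j r \<omega>)"
      unfolding indep_var_eq
    proof (intro conjI)
      show "random_variable borel \<eta>" by fact
      show "random_variable borel (\<lambda>\<omega>. V j r' \<omega> - V j r \<omega>)" using int(1) by measurable
      have "sigma_sets (space M) {\<eta> -` A \<inter> space M | A. A \<in> sets borel}
          \<subseteq> sets (enlarged_past M V j r J t)"
        using sets.sigma_sets_subset[of "{\<eta> -` A \<inter> space M | A. A \<in> sets borel}" "enlarged_past M V j r J t"]
          measurable_sets[OF \<eta>] by (force simp: subset_iff)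
      with increment_indep_enlarged_past[OF \<open>prob_space M\<close> V r(1) \<open>r < r'\<close> j, of t]
      show "indep_set (sigma_sets (space M) {\<eta> -` A \<inter> space M | A. A \<in> sets borel})
          (sigma_sets (space M) {(\<lambda>\<omega>. V j r' \<omega> - V j r \<omega>) -` A \<inter> space M | A. A \<in> sets borel})"
        unfolding indep_set_def by (elim indep_sets_mono_sets) (auto split: bool.splits)
    qed
    moreover have "integrable M \<eta>"
      using \<eta>M C by (intro integrable_const_bound[of _ C]) (auto intro: AE_I2)
    ultimately show ?thesis
      using indep_var_lebesgue_integral[of \<eta> "\<lambda>\<omega>. V j r' \<omega> - V j r \<omega>"] int by simp
  qed simp
qed

lemma wiener_increment_mean_zero:
  fixes \<eta> :: "'a \<Rightarrow> real"
  assumes "prob_space M" and V: "independent_wiener_processes M V"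
    and r: "0 \<le> r" "r \<le> r'"
    and \<eta>: "\<eta> \<in> borel_measurable (natural_filtration M (V ` J) r)"
    and C: "\<And>\<omega>. \<omega> \<in> space M \<Longrightarrow> \<bar>\<eta> \<omega>\<bar> \<le> C"
  shows "integrable M (\<lambda>\<omega>. \<eta> \<omega> * (V j r' \<omega> - V j r \<omega>))"
    and "(\<integral>\<omega>. \<eta> \<omega> * (V j r' \<omega> - V j r \<omega>) \<partial>M) = 0"
proof -
  let ?P = "enlarged_past M V j r (J - {j}) r"
  have *: "V i s \<in> borel_measurable ?P" if "i \<in> insert j J" "s \<in> {0..r}" for i s
  proof -
    have "V i s \<in> borel_measurable (natural_filtration M {V j} r)
        \<or> V i s \<in> borel_measurable (natural_filtration M (V ` (J - {j})) r)"
      using that measurable_natural_filtration[of "V i" "{V j}" s r M]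
        measurable_natural_filtration[of "V i" "V ` (J - {j})" s r M] by (cases "i = j") auto
    moreover have "subalgebra ?P (natural_filtration M {V j} r)"
      "subalgebra ?P (natural_filtration M (V ` (J - {j})) r)"
      by (auto simp: subalgebra_def sets_enlarged_past)
    ultimately show ?thesis by (auto intro: measurable_from_subalg)
  qed
  have "subalgebra ?P (natural_filtration M (V ` J) r)"
    unfolding subalgebra_def
    by (intro conjI sets_natural_filtration_subset) (auto intro!: *)
  then have "\<eta> \<in> borel_measurable ?P" using \<eta> by (rule measurable_from_subalg)
  from enlarged_past_increment[OF assms(1,2) r _ this C]
  show "integrable M (\<lambda>\<omega>. \<eta> \<omega> * (V j r' \<omega> - V j r \<omega>))"
    and "(\<integral>\<omega>. \<eta> \<omega> * (V j r' \<omega> - V j r \<omega>) \<partial>M) = 0" by auto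
qed

text \<open>The time \<open>t\<close> is not tied to \<open>r\<close> and \<open>r'\<close>: the
  weight may depend on the other processes even after \<open>r'\<close>, because entire paths are
  independent.\<close>

lemma other_wiener_mean_zero:
  fixes \<eta> :: "'a \<Rightarrow> real"
  assumes "prob_space M" and V: "independent_wiener_processes M V"
    and r: "0 \<le> r" "r \<le> r'" and j: "j \<notin> J"
    and \<eta>: "\<eta> \<in> borel_measurable (natural_filtration M (V ` J) t)"
    and C: "\<And>\<omega>. \<omega> \<in> space M \<Longrightarrow> \<bar>\<eta> \<omega>\<bar> \<le> C"
  shows "(\<integral>\<omega>. \<eta> \<omega> * (V j r' \<omega> - V j r \<omega>) \<partial>M) = 0"
proof -
  have "subalgebra (enlarged_past M V j r J t) (natural_filtration M (V ` J) t)"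
    by (auto simp: subalgebra_def sets_enlarged_past)
  from enlarged_past_increment(2)[OF assms(1,2) r j measurable_from_subalg[OF this \<eta>] C]
  show ?thesis by simp
qed

section \<open>Centred increments and the Ito integral\<close>

text \<open>The martingale property without adaptedness.\<close>

definition centred_increments :: "'a measure \<Rightarrow> (real \<Rightarrow> 'a measure) \<Rightarrow> real \<Rightarrow> 'a process \<Rightarrow> bool" where
  "centred_increments M F T G \<longleftrightarrow>
     (\<forall>t\<in>{0..T}. integrable M (G t)) \<and>
     (\<forall>t s A. 0 \<le> t \<longrightarrow> t \<le> s \<longrightarrow> s \<le> T \<longrightarrow> A \<in> sets (F t) \<longrightarrow>
        (\<integral>\<omega>. indicator A \<omega> * G s \<omega> \<partial>M) = (\<integral>\<omega>. indicator A \<omega> * G t \<omega> \<partial>M))"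

lemma centred_increments_integrable:
  "centred_increments M F T G \<Longrightarrow> t \<in> {0..T} \<Longrightarrow> integrable M (G t)"
  by (simp add: centred_increments_def)

lemma centred_increments_eq:
  "centred_increments M F T G \<Longrightarrow> 0 \<le> t \<Longrightarrow> t \<le> s \<Longrightarrow> s \<le> T \<Longrightarrow> A \<in> sets (F t) \<Longrightarrow>
    (\<integral>\<omega>. indicator A \<omega> * G s \<omega> \<partial>M) = (\<integral>\<omega>. indicator A \<omega> * G t \<omega> \<partial>M)"
  unfolding centred_increments_def by blast

lemma integrable_indicator_mult:
  fixes f :: "'a \<Rightarrow> real"
  shows "A \<in> sets M \<Longrightarrow> integrable M f \<Longrightarrow> integrable M (\<lambda>\<omega>. indicator A \<omega> * f \<omega>)"
  using integrable_mult_indicator[of A M f] by simp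

lemma subalgebra_sets: "subalgebra M N \<Longrightarrow> A \<in> sets N \<Longrightarrow> A \<in> sets M"
  by (auto simp: subalgebra_def)

lemma centred_increments_mult:
  assumes "centred_increments M F T G"
  shows "centred_increments M F T (\<lambda>t \<omega>. k * G t \<omega>)"
  unfolding centred_increments_def
proof (intro conjI ballI allI impI)
  fix t assume "t \<in> {0..T}"
  then show "integrable M (\<lambda>\<omega>. k * G t \<omega>)"
    using centred_increments_integrable[OF assms] by simp
next
  fix t s A assume ts: "0 \<le> t" "t \<le> s" "s \<le> T" and A: "A \<in> sets (F t)"
  show "(\<integral>\<omega>. indicator A \<omega> * (k * G s \<omega>) \<partial>M) = (\<integral>\<omega>. indicator A \<omega> * (k * G t \<omega>) \<partial>M)"
    unfolding mult.left_commute[of _ k] using centred_increments_eq[OF assms ts A] by simp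
qed

lemma centred_increments_sum:
  assumes "\<And>t. subalgebra M (F t)" and G: "\<And>i. i \<in> I \<Longrightarrow> centred_increments M F T (G i)"
  shows "centred_increments M F T (\<lambda>t \<omega>. \<Sum>i\<in>I. G i t \<omega>)"
  unfolding centred_increments_def
proof (intro conjI ballI allI impI)
  fix t assume "t \<in> {0..T}"
  then show "integrable M (\<lambda>\<omega>. \<Sum>i\<in>I. G i t \<omega>)"
    by (intro Bochner_Integration.integrable_sum centred_increments_integrable[OF G])
next
  fix t s A assume ts: "0 \<le> t" "t \<le> s" "s \<le> T" and A: "A \<in> sets (F t)"
  have "A \<in> sets M" using subalgebra_sets[OF assms(1) A] .
  then have int: "integrable M (\<lambda>\<omega>. indicator A \<omega> * G i r \<omega>)" if "i \<in> I" "r \<in> {t, s}" for i r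
    using G[OF that(1)] that ts
    by (intro integrable_indicator_mult) (auto intro: centred_increments_integrable)
  have "(\<integral>\<omega>. indicator A \<omega> * (\<Sum>i\<in>I. G i r \<omega>) \<partial>M) = (\<Sum>i\<in>I. \<integral>\<omega>. indicator A \<omega> * G i r \<omega> \<partial>M)"
    if "r \<in> {t, s}" for r
    unfolding sum_distrib_left using int that by (intro Bochner_Integration.integral_sum) auto
  then show "(\<integral>\<omega>. indicator A \<omega> * (\<Sum>i\<in>I. G i s \<omega>) \<partial>M) = (\<integral>\<omega>. indicator A \<omega> * (\<Sum>i\<in>I. G i t \<omega>) \<partial>M)"
    using centred_increments_eq[OF G ts A] by simp
qed

lemma wiener_centred_increments:
  assumes "prob_space M" and V: "independent_wiener_processes M V"
  shows "centred_increments M (natural_filtration M (V ` J)) T (\<lambda>t \<omega>. V j t \<omega> - V j 0 \<omega>)"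
  unfolding centred_increments_def
proof (intro conjI ballI allI impI)
  fix t assume "t \<in> {0..T}"
  then show "integrable M (\<lambda>\<omega>. V j t \<omega> - V j 0 \<omega>)"
    using wiener_increment_integrable(1)[OF assms] by simp
next
  fix t s A assume ts: "0 \<le> t" "t \<le> s" "s \<le> T" and A: "A \<in> sets (natural_filtration M (V ` J) t)"
  have "A \<in> sets M" using subalgebra_sets[OF subalgebra_wiener_filtration[OF V] A] .
  then have int: "integrable M (\<lambda>\<omega>. indicator A \<omega> * (V j t \<omega> - V j 0 \<omega>))"
    using wiener_increment_integrable(1)[OF assms order_refl ts(1), of j]
    by (rule integrable_indicator_mult)
  note inc = wiener_increment_mean_zero[OF assms ts(1,2) borel_measurable_indicator[OF A], where C = 1, of j]
  have "(\<integral>\<omega>. indicator A \<omega> * (V j s \<omega> - V j 0 \<omega>) \<partial>M)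
      = (\<integral>\<omega>. indicator A \<omega> * (V j t \<omega> - V j 0 \<omega>) + indicator A \<omega> * (V j s \<omega> - V j t \<omega>) \<partial>M)"
    by (simp add: algebra_simps)
  also have "\<dots> = (\<integral>\<omega>. indicator A \<omega> * (V j t \<omega> - V j 0 \<omega>) \<partial>M)"
    using inc int by (subst Bochner_Integration.integral_add) (auto simp: indicator_def)
  finally show "(\<integral>\<omega>. indicator A \<omega> * (V j s \<omega> - V j 0 \<omega>) \<partial>M)
      = (\<integral>\<omega>. indicator A \<omega> * (V j t \<omega> - V j 0 \<omega>) \<partial>M)" .
qed

lemma simple_integral_centred_increments:
  fixes V :: "'i \<Rightarrow> 'a process"
  assumes "prob_space M" and V: "independent_wiener_processes M V"
    and simple: "simple_integrand (natural_filtration M (V ` J)) T n \<tau> \<xi>"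
  shows "centred_increments M (natural_filtration M (V ` J)) T (simple_integral (V j) n \<tau> \<xi>)"
proof -
  let ?F = "natural_filtration M (V ` J)"
  have \<tau>: "0 \<le> \<tau> k" if "k \<le> n" for k
    using that
  proof (induction k)
    case (Suc k)
    then have "\<tau> k \<le> \<tau> (Suc k)" using simple by (simp add: simple_integrand_def)
    with Suc show ?case by simp
  qed (use simple in \<open>simp add: simple_integrand_def\<close>)
  have "centred_increments M ?F T
      (\<lambda>t \<omega>. \<xi> k \<omega> * (V j (min (\<tau> (Suc k)) t) \<omega> - V j (min (\<tau> k) t) \<omega>))" if "k < n" for k
  proof -
    let ?D = "\<lambda>t \<omega>. \<xi> k \<omega> * (V j (min (\<tau> (Suc k)) t) \<omega> - V j (min (\<tau> k) t) \<omega>)"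
    from simple that obtain C where le: "\<tau> k \<le> \<tau> (Suc k)"
      and \<xi>: "\<xi> k \<in> borel_measurable (?F (\<tau> k))" and C: "\<And>\<omega>. \<omega> \<in> space M \<Longrightarrow> \<bar>\<xi> k \<omega>\<bar> \<le> C"
      unfolding simple_integrand_def space_natural_filtration by blast
    have \<tau>k: "0 \<le> \<tau> k" using \<tau> that by auto
    have int: "integrable M (?D t)" if "0 \<le> t" for t
    proof (cases "t \<le> \<tau> k")
      case False
      then have "\<tau> k \<le> min (\<tau> (Suc k)) t" "min (\<tau> k) t = \<tau> k" using le by auto
      then show ?thesis
        using wiener_increment_mean_zero(1)[OF assms(1,2) \<tau>k _ \<xi> C, of "min (\<tau> (Suc k)) t" j] by simp
    qed (use le in simp)
    show ?thesis
      unfolding centred_increments_def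
    proof (intro conjI ballI allI impI)
      fix t assume "t \<in> {0..T}"
      then show "integrable M (?D t)" using int by auto
    next
      fix t s A assume ts: "0 \<le> t" "t \<le> s" "s \<le> T" and A: "A \<in> sets (?F t)"
      \<comment> \<open>The change of the \<open>k\<close>-th term between \<open>t\<close> and
        \<open>s\<close> is \<open>\<xi> k\<close> times one increment over \<open>[r, r1]\<close>.
        Taking \<open>r\<close> at least \<open>\<tau> k\<close> and at least \<open>t\<close> makes
        both \<open>\<xi> k\<close> and the indicator of \<open>A\<close> measurable at
        \<open>r\<close>; the outer maximum in \<open>r1\<close> makes the increment vanish when the
        two time intervals do not overlap.\<close>
      define r where "r = max (\<tau> k) t"
      define r1 where "r1 = max r (min (\<tau> (Suc k)) s)"
      have "subalgebra (?F r) (?F t)" "subalgebra (?F r) (?F (\<tau> k))"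
        unfolding subalgebra_def r_def using natural_filtration_mono[of _ _ "V ` J" "V ` J" M] by auto
      then have "A \<in> sets (?F r)" "\<xi> k \<in> borel_measurable (?F r)"
        using A \<xi> by (auto intro: subalgebra_sets measurable_from_subalg)
      then have meas: "(\<lambda>\<omega>. indicator A \<omega> * \<xi> k \<omega>) \<in> borel_measurable (?F r)"
        by measurable
      have bound: "\<bar>indicator A \<omega> * \<xi> k \<omega>\<bar> \<le> C" if "\<omega> \<in> space M" for \<omega>
        using C[OF that] by (auto simp: indicator_def split: if_splits)
      have split: "?D s \<omega> = ?D t \<omega> + \<xi> k \<omega> * (V j r1 \<omega> - V j r \<omega>)" for \<omega>
      proof -
        consider "s \<le> \<tau> k" | "t \<le> \<tau> k" "\<tau> k < s" | "\<tau> k < t" "\<tau> (Suc k) \<le> t"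
          | "\<tau> k < t" "t < \<tau> (Suc k)" by linarith
        then show ?thesis
        proof cases
          case 1
          then have "r1 = r" "min (\<tau> k) s = s" "min (\<tau> k) t = t" "min (\<tau> (Suc k)) s = s"
            "min (\<tau> (Suc k)) t = t" using ts le by (auto simp: r1_def r_def)
          then show ?thesis by simp
        next
          case 2
          then have "r1 = min (\<tau> (Suc k)) s" "r = \<tau> k" "min (\<tau> k) s = \<tau> k" "min (\<tau> k) t = t"
            "min (\<tau> (Suc k)) t = t" using ts le by (auto simp: r1_def r_def)
          then show ?thesis by simp
        next
          case 3
          then have "r1 = r" "min (\<tau> k) s = \<tau> k" "min (\<tau> k) t = \<tau> k"
            "min (\<tau> (Suc k)) s = \<tau> (Suc k)" "min (\<tau> (Suc k)) t = \<tau> (Suc k)"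
            using ts le by (auto simp: r1_def r_def)
          then show ?thesis by simp
        next
          case 4
          then have "r1 = min (\<tau> (Suc k)) s" "r = t" "min (\<tau> k) s = \<tau> k" "min (\<tau> k) t = \<tau> k"
            "min (\<tau> (Suc k)) t = t" using ts le by (auto simp: r1_def r_def)
          then show ?thesis by (simp add: algebra_simps)
        qed
      qed
      have r: "0 \<le> r" "r \<le> r1" using \<tau>k by (auto simp: r_def r1_def)
      note inc = wiener_increment_mean_zero[OF assms(1,2) r meas bound, of j]
      have "A \<in> sets M" using subalgebra_sets[OF subalgebra_wiener_filtration[OF V] A] .
      then have int': "integrable M (\<lambda>\<omega>. indicator A \<omega> * ?D t \<omega>)"
        using int[OF ts(1)] by (rule integrable_indicator_mult)
      have "(\<integral>\<omega>. indicator A \<omega> * ?D s \<omega> \<partial>M)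
          = (\<integral>\<omega>. indicator A \<omega> * ?D t \<omega> + (indicator A \<omega> * \<xi> k \<omega>) * (V j r1 \<omega> - V j r \<omega>) \<partial>M)"
        unfolding split by (simp add: distrib_left mult.assoc)
      also have "\<dots> = (\<integral>\<omega>. indicator A \<omega> * ?D t \<omega> \<partial>M)"
        using inc by (subst Bochner_Integration.integral_add[OF int']) auto
      finally show "(\<integral>\<omega>. indicator A \<omega> * ?D s \<omega> \<partial>M) = (\<integral>\<omega>. indicator A \<omega> * ?D t \<omega> \<partial>M)" .
    qed
  qed
  then have "centred_increments M ?F T (\<lambda>t \<omega>. \<Sum>k<n. \<xi> k \<omega> * (V j (min (\<tau> (Suc k)) t) \<omega> - V j (min (\<tau> k) t) \<omega>))"
    by (intro centred_increments_sum subalgebra_wiener_filtration[OF V]) auto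
  then show ?thesis by (simp add: simple_integral_def[abs_def])
qed

text \<open>On a probability space the Cauchy-Schwarz inequality against the constant 1 bounds the
  \<open>L1\<close> distance by the \<open>L2\<close> distance, and truncation by an event does not
  increase the former. Integrability of \<open>I\<close> comes from any single index at which the
  \<open>L2\<close> distance is finite.\<close>

lemma (in prob_space) L2_limit:
  fixes R :: "nat \<Rightarrow> 'a \<Rightarrow> real"
  assumes R: "\<And>m. integrable M (R m)" and I: "I \<in> borel_measurable M"
    and lim: "(\<lambda>m. \<integral>\<^sup>+\<omega>. ennreal ((R m \<omega> - I \<omega>)\<^sup>2) \<partial>M) \<longlonglongrightarrow> 0"
  shows "integrable M I"
    and "A \<in> events \<Longrightarrow> (\<lambda>m. \<integral>\<omega>. indicator A \<omega> * R m \<omega> \<partial>M) \<longlonglongrightarrow> (\<integral>\<omega>. indicator A \<omega> * I \<omega> \<partial>M)"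
proof -
  have Rm[measurable]: "R m \<in> borel_measurable M" for m using R by auto
  note I[measurable]
  have "\<exists>m. (\<integral>\<^sup>+\<omega>. ennreal ((R m \<omega> - I \<omega>)\<^sup>2) \<partial>M) < \<infinity>"
    using order_tendstoD(2)[OF lim, of \<infinity>] by (auto simp: eventually_sequentially)
  then obtain m where "(\<integral>\<^sup>+\<omega>. ennreal ((R m \<omega> - I \<omega>)\<^sup>2) \<partial>M) < \<infinity>" by blast
  then have "integrable M (\<lambda>\<omega>. (R m \<omega> - I \<omega>)\<^sup>2)"
    by (intro integrableI_bounded) auto
  then have "integrable M (\<lambda>\<omega>. R m \<omega> - I \<omega>)"
    by (rule square_integrable_imp_integrable[rotated]) measurable
  from Bochner_Integration.integrable_diff[OF R this] show int: "integrable M I"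
    by (rule back_subst[of "integrable M"]) auto
  assume A: "A \<in> events"
  define e where "e = (\<lambda>m. \<integral>\<omega>. \<bar>R m \<omega> - I \<omega>\<bar> \<partial>M)"
  have e0: "0 \<le> e m" for m unfolding e_def by simp
  have e2: "ennreal ((e m)\<^sup>2) \<le> (\<integral>\<^sup>+\<omega>. ennreal ((R m \<omega> - I \<omega>)\<^sup>2) \<partial>M)" for m
  proof -
    have "ennreal ((e m)\<^sup>2) = (ennreal (e m))\<^sup>2" by (simp add: ennreal_power e0)
    also have "ennreal (e m) = (\<integral>\<^sup>+\<omega>. ennreal \<bar>R m \<omega> - I \<omega>\<bar> * 1 \<partial>M)"
      unfolding e_def using nn_integral_eq_integral[of M "\<lambda>\<omega>. \<bar>R m \<omega> - I \<omega>\<bar>"] R[of m] int by simp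
    also have "\<dots>\<^sup>2 \<le> (\<integral>\<^sup>+\<omega>. (ennreal \<bar>R m \<omega> - I \<omega>\<bar>)\<^sup>2 \<partial>M) * (\<integral>\<^sup>+\<omega>. 1\<^sup>2 \<partial>M)"
      by (rule Cauchy_Schwarz_nn_integral) auto
    also have "\<dots> = (\<integral>\<^sup>+\<omega>. ennreal ((R m \<omega> - I \<omega>)\<^sup>2) \<partial>M)"
      by (simp add: ennreal_power emeasure_space_1)
    finally show ?thesis .
  qed
  have "(\<lambda>m. ennreal ((e m)\<^sup>2)) \<longlonglongrightarrow> ennreal 0"
    using tendsto_sandwich[of "\<lambda>_. 0" "\<lambda>m. ennreal ((e m)\<^sup>2)", OF _ _ tendsto_const lim] e2 by simp
  then have "(\<lambda>m. (e m)\<^sup>2) \<longlonglongrightarrow> 0"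
    by (rule tendsto_ennrealD) auto
  then have "(\<lambda>m. sqrt ((e m)\<^sup>2)) \<longlonglongrightarrow> sqrt 0" by (rule tendsto_real_sqrt)
  then have e: "e \<longlonglongrightarrow> 0" using e0 by (simp add: abs_of_nonneg)
  have "norm ((\<integral>\<omega>. indicator A \<omega> * R m \<omega> \<partial>M) - (\<integral>\<omega>. indicator A \<omega> * I \<omega> \<partial>M)) \<le> e m" for m
  proof -
    have "(\<integral>\<omega>. indicator A \<omega> * R m \<omega> \<partial>M) - (\<integral>\<omega>. indicator A \<omega> * I \<omega> \<partial>M)
        = (\<integral>\<omega>. indicator A \<omega> * (R m \<omega> - I \<omega>) \<partial>M)"
      unfolding right_diff_distrib
      by (rule Bochner_Integration.integral_diff[symmetric]) (intro integrable_indicator_mult A R int)+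
    also have "norm \<dots> \<le> (\<integral>\<omega>. norm (indicator A \<omega> * (R m \<omega> - I \<omega>)) \<partial>M)"
      by (rule integral_norm_bound)
    also have "\<dots> \<le> e m"
      unfolding e_def
    proof (rule integral_mono)
      show "integrable M (\<lambda>\<omega>. norm (indicator A \<omega> * (R m \<omega> - I \<omega>)))"
        by (intro integrable_norm integrable_indicator_mult Bochner_Integration.integrable_diff A R int)
      show "integrable M (\<lambda>\<omega>. \<bar>R m \<omega> - I \<omega>\<bar>)"
        using R[of m] int by simp
    qed (simp add: indicator_def)
    finally show ?thesis .
  qed
  then show "(\<lambda>m. \<integral>\<omega>. indicator A \<omega> * R m \<omega> \<partial>M) \<longlonglongrightarrow> (\<integral>\<omega>. indicator A \<omega> * I \<omega> \<partial>M)"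
    by (intro LIM_zero_cancel[OF Lim_null_comparison[OF _ e]]) auto
qed

text \<open>The martingale identity is exact for each approximating simple integral, so the two
  truncated means of \<open>I\<close> are limits of one and the same sequence.\<close>

lemma ito_integral_centred_increments:
  assumes "prob_space M" and V: "independent_wiener_processes M V"
    and ito: "is_ito_integral M (natural_filtration M (V ` J)) T (V j) H I"
  shows "centred_increments M (natural_filtration M (V ` J)) T I"
proof -
  interpret prob_space M by fact
  let ?F = "natural_filtration M (V ` J)"
  from ito obtain n \<tau> \<xi> where simple: "\<And>m. simple_integrand ?F T (n m) (\<tau> m) (\<xi> m)"
    and lim: "\<And>t. t \<in> {0..T} \<Longrightarrow>
      (\<lambda>m. \<integral>\<^sup>+\<omega>. ennreal ((simple_integral (V j) (n m) (\<tau> m) (\<xi> m) t \<omega> - I t \<omega>)\<^sup>2) \<partial>M) \<longlonglongrightarrow> 0"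
    and I: "\<And>t. t \<in> {0..T} \<Longrightarrow> I t \<in> borel_measurable M"
    unfolding is_ito_integral_def by blast
  note R = simple_integral_centred_increments[OF assms(1,2) simple, of j]
  note L = L2_limit[OF centred_increments_integrable[OF R] I lim]
  show ?thesis
    unfolding centred_increments_def
  proof (intro conjI ballI allI impI)
    fix t assume "t \<in> {0..T}"
    then show "integrable M (I t)" using L(1) by simp
  next
    fix t s A assume ts: "0 \<le> t" "t \<le> s" "s \<le> T" and A: "A \<in> sets (?F t)"
    have "A \<in> events" using subalgebra_sets[OF subalgebra_wiener_filtration[OF V] A] .
    with L(2)[of s A] L(2)[of t A] ts
    show "(\<integral>\<omega>. indicator A \<omega> * I s \<omega> \<partial>M) = (\<integral>\<omega>. indicator A \<omega> * I t \<omega> \<partial>M)"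
      unfolding centred_increments_eq[OF R ts A] by (auto intro: LIMSEQ_unique)
  qed
qed

section \<open>Fubini for processes\<close>

text \<open>Time is confined to \<open>{0..T}\<close> in the measure itself, which makes the product
  measure finite; square-integrable processes are then integrable.\<close>

definition jointly_integrable :: "'a measure \<Rightarrow> real \<Rightarrow> 'a process \<Rightarrow> bool" where
  "jointly_integrable M T H \<longleftrightarrow>
     integrable (restrict_space lborel {0..T} \<Otimes>\<^sub>M M) (\<lambda>(s, \<omega>). H s \<omega>)"

lemma jointly_integrable_mult:
  "jointly_integrable M T H \<Longrightarrow> jointly_integrable M T (\<lambda>t \<omega>. k * H t \<omega>)"
  unfolding jointly_integrable_def split_def by simp

lemma jointly_integrable_add:
  "jointly_integrable M T H \<Longrightarrow> jointly_integrable M T H' \<Longrightarrow>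
    jointly_integrable M T (\<lambda>t \<omega>. H t \<omega> + H' t \<omega>)"
  unfolding jointly_integrable_def split_def by simp

lemma jointly_integrable_diff:
  "jointly_integrable M T H \<Longrightarrow> jointly_integrable M T H' \<Longrightarrow>
    jointly_integrable M T (\<lambda>t \<omega>. H t \<omega> - H' t \<omega>)"
  unfolding jointly_integrable_def split_def by simp

lemma jointly_integrable_sum:
  "(\<And>i. i \<in> I \<Longrightarrow> jointly_integrable M T (H i)) \<Longrightarrow>
    jointly_integrable M T (\<lambda>t \<omega>. \<Sum>i\<in>I. H i t \<omega>)"
  unfolding jointly_integrable_def split_def by simp

lemma finite_measure_restrict_lborel: "finite_measure (restrict_space lborel {0..T::real})"
  by (rule finite_measureI) (simp add: emeasure_restrict_space space_restrict_space emeasure_lborel_Icc_eq)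

lemma pair_sigma_finite_restrict_lborel:
  "prob_space M \<Longrightarrow> pair_sigma_finite (restrict_space lborel {0..T::real}) M"
  by (simp add: pair_sigma_finite_def finite_measure_restrict_lborel finite_measure.axioms(1)
      prob_space_def)

lemma progressive_adapted:
  assumes "progressively_measurable F T H" "t \<in> {0..T}"
  shows "H t \<in> borel_measurable (F t)"
proof -
  have "(\<lambda>(s, \<omega>). H s \<omega>) \<in> borel_measurable (restrict_space borel {0..t} \<Otimes>\<^sub>M F t)"
    using assms by (auto simp: progressively_measurable_def)
  from measurable_compose[OF measurable_Pair1'[of t] this] assms(2)
  show ?thesis by (simp add: space_restrict_space)
qed

lemma square_integrable_progressive_jointly_integrable:
  assumes "prob_space M" and sub: "subalgebra M (F T)" and "0 \<le> T"
    and H: "square_integrable_progressive M F T H"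
  shows "jointly_integrable M T H"
proof -
  let ?L = "restrict_space lborel {0..T}"
  interpret prob_space M by fact
  interpret pair_sigma_finite ?L M using pair_sigma_finite_restrict_lborel[OF \<open>prob_space M\<close>] .
  interpret P: finite_measure "?L \<Otimes>\<^sub>M M"
    by (intro finite_measure_pair_measure finite_measure_restrict_lborel) unfold_locales
  have "(\<lambda>(s, \<omega>). H s \<omega>) \<in> borel_measurable (restrict_space borel {0..T} \<Otimes>\<^sub>M F T)"
    using H \<open>0 \<le> T\<close> by (auto simp: square_integrable_progressive_def progressively_measurable_def)
  moreover have "(\<lambda>p. p) \<in> ?L \<Otimes>\<^sub>M M \<rightarrow>\<^sub>M restrict_space borel {0..T} \<Otimes>\<^sub>M F T"
  proof (rule measurable_pair)
    show "fst \<circ> (\<lambda>p. p) \<in> ?L \<Otimes>\<^sub>M M \<rightarrow>\<^sub>M restrict_space borel {0..T}"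
      using measurable_fst[of ?L M]
      by (simp add: comp_def cong: measurable_cong_sets sets_restrict_space_cong)
    have "(\<lambda>x. x) \<in> M \<rightarrow>\<^sub>M F T" using measurable_from_subalg[OF sub measurable_ident] by (simp add: id_def)
    from measurable_compose[OF measurable_snd this]
    show "snd \<circ> (\<lambda>p. p) \<in> ?L \<Otimes>\<^sub>M M \<rightarrow>\<^sub>M F T" by (simp add: comp_def)
  qed
  ultimately have meas[measurable]: "(\<lambda>(s, \<omega>). H s \<omega>) \<in> borel_measurable (?L \<Otimes>\<^sub>M M)"
    by (rule measurable_compose[rotated])
  have "(\<integral>\<^sup>+p. ennreal (norm ((case p of (s, \<omega>) \<Rightarrow> H s \<omega>)\<^sup>2)) \<partial>(?L \<Otimes>\<^sub>M M))
      = (\<integral>\<^sup>+\<omega>. \<integral>\<^sup>+s. ennreal ((H s \<omega>)\<^sup>2) \<partial>?L \<partial>M)"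
    by (subst nn_integral_snd[symmetric]) auto
  also have "\<dots> = (\<integral>\<^sup>+\<omega>. (\<integral>\<^sup>+t\<in>{0..T}. ennreal ((H t \<omega>)\<^sup>2) \<partial>lborel) \<partial>M)"
    by (subst nn_integral_restrict_space) auto
  also have "\<dots> < \<infinity>" using H by (simp add: square_integrable_progressive_def)
  finally have "integrable (?L \<Otimes>\<^sub>M M) (\<lambda>p. (case p of (s, \<omega>) \<Rightarrow> H s \<omega>)\<^sup>2)"
    by (intro integrableI_bounded) auto
  then show ?thesis
    unfolding jointly_integrable_def by (rule P.square_integrable_imp_integrable[OF meas])
qed

lemma jointly_integrable_paths:
  assumes "prob_space M" and H: "jointly_integrable M T H"
  shows "AE \<omega> in M. set_integrable lborel {0..T} (\<lambda>s. H s \<omega>)"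
proof -
  interpret pair_sigma_finite "restrict_space lborel {0..T}" M
    using pair_sigma_finite_restrict_lborel[OF \<open>prob_space M\<close>] .
  interpret Q: pair_sigma_finite M "restrict_space lborel {0..T}" ..
  have "AE \<omega> in M. integrable (restrict_space lborel {0..T}) (\<lambda>s. H s \<omega>)"
    using Q.AE_integrable_fst'[OF integrable_product_swap[OF H[unfolded jointly_integrable_def]]] by simp
  then show ?thesis
    by (simp add: integrable_restrict_space set_integrable_def)
qed

lemma jointly_integrable_Fubini:
  assumes "prob_space M" and H: "jointly_integrable M T H" and A: "A \<in> sets M"
    and uv: "0 \<le> u" "v \<le> T"
  shows "set_integrable lborel {u..v} (\<lambda>s. \<integral>\<omega>. indicator A \<omega> * H s \<omega> \<partial>M)"
    and "integrable M (\<lambda>\<omega>. LINT s:{u..v}|lborel. H s \<omega>)"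
    and "(\<integral>\<omega>. indicator A \<omega> * (LINT s:{u..v}|lborel. H s \<omega>) \<partial>M)
       = (LINT s:{u..v}|lborel. \<integral>\<omega>. indicator A \<omega> * H s \<omega> \<partial>M)"
proof -
  let ?L = "restrict_space lborel {0..T}"
  interpret prob_space M by fact
  interpret pair_sigma_finite ?L M using pair_sigma_finite_restrict_lborel[OF \<open>prob_space M\<close>] .
  interpret Q: pair_sigma_finite M ?L ..
  have uv': "{u..v} \<inter> {0..T} = {u..v}" using uv by auto
  have uvL: "{u..v} \<in> sets ?L" using uv by (auto simp: sets_restrict_space_iff)
  have toL: "integral\<^sup>L ?L (\<lambda>s. indicator {u..v} s * f s) = (LINT s:{u..v}|lborel. f s)" for f :: "real \<Rightarrow> real"
    unfolding set_lebesgue_integral_def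
    by (subst integral_restrict_space)
      (auto intro!: Bochner_Integration.integral_cong simp: indicator_def uv split: if_splits dest: order_trans[OF uv(1)] order_trans[OF _ uv(2)])
  have toL': "integrable ?L (\<lambda>s. indicator {u..v} s * f s) \<longleftrightarrow> set_integrable lborel {u..v} f" for f :: "real \<Rightarrow> real"
    unfolding set_integrable_def
    by (subst integrable_restrict_space)
      (auto intro!: Bochner_Integration.integrable_cong simp: indicator_def uv split: if_splits dest: order_trans[OF uv(1)] order_trans[OF _ uv(2)])
  have K: "integrable (?L \<Otimes>\<^sub>M M) (\<lambda>(s, \<omega>). indicator {u..v} s * (indicator B \<omega> * H s \<omega>))" if "B \<in> events" for B
  proof -
    have "integrable (?L \<Otimes>\<^sub>M M) (\<lambda>p. indicator ({u..v} \<times> B) p *\<^sub>R (\<lambda>(s, \<omega>). H s \<omega>) p)"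
      using H[unfolded jointly_integrable_def]
      by (rule integrable_mult_indicator[rotated]) (intro pair_measureI uvL that)
    then show ?thesis
      by (rule Bochner_Integration.integrable_cong[THEN iffD1, rotated 2])
        (auto simp: indicator_def)
  qed
  show "set_integrable lborel {u..v} (\<lambda>s. \<integral>\<omega>. indicator A \<omega> * H s \<omega> \<partial>M)"
    using integrable_fst'[OF K[OF A]] by (simp add: toL')
  have "integrable M (\<lambda>\<omega>. \<integral>s. indicator {u..v} s * (indicator (space M) \<omega> * H s \<omega>) \<partial>?L)"
    using Q.integrable_fst'[OF integrable_product_swap[OF K[OF sets.top]]] by simp
  then show "integrable M (\<lambda>\<omega>. LINT s:{u..v}|lborel. H s \<omega>)"
    by (rule Bochner_Integration.integrable_cong[THEN iffD1, rotated 2]) (auto simp: toL)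
  have "(\<integral>\<omega>. indicator A \<omega> * (LINT s:{u..v}|lborel. H s \<omega>) \<partial>M)
      = (\<integral>\<omega>. \<integral>s. indicator {u..v} s * (indicator A \<omega> * H s \<omega>) \<partial>?L \<partial>M)"
    unfolding toL by simp
  also have "\<dots> = (\<integral>s. \<integral>\<omega>. indicator {u..v} s * (indicator A \<omega> * H s \<omega>) \<partial>M \<partial>?L)"
    by (rule Fubini_integral[OF K[OF A]])
  also have "\<dots> = (LINT s:{u..v}|lborel. \<integral>\<omega>. indicator A \<omega> * H s \<omega> \<partial>M)"
    by (simp add: toL)
  finally show "(\<integral>\<omega>. indicator A \<omega> * (LINT s:{u..v}|lborel. H s \<omega>) \<partial>M)
       = (LINT s:{u..v}|lborel. \<integral>\<omega>. indicator A \<omega> * H s \<omega> \<partial>M)" .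
qed

text \<open>Exchange of quantifiers through Fubini: "at every time, almost surely" becomes "almost
  surely, at almost every time". Without path regularity of the adjoint processes this is the form
  in which an identity proved time by time can be used inside a path integral.\<close>

lemma AE_time_paths:
  fixes H :: "'a process"
  assumes "prob_space M"
    and H: "(\<lambda>(s, \<omega>). H s \<omega>) \<in> borel_measurable (restrict_space lborel {0..T} \<Otimes>\<^sub>M M)"
    and zero: "\<And>t. t \<in> {0..T} \<Longrightarrow> AE \<omega> in M. H t \<omega> = 0"
  shows "AE \<omega> in M. \<exists>Z. negligible Z \<and> (\<forall>t\<in>{0..T} - Z. H t \<omega> = 0)"
proof -
  let ?L = "restrict_space lborel {0..T}"
  interpret pair_sigma_finite ?L M using pair_sigma_finite_restrict_lborel[OF \<open>prob_space M\<close>] .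
  have [measurable]: "(\<lambda>p. H (fst p) (snd p)) \<in> borel_measurable (?L \<Otimes>\<^sub>M M)"
    using H by (simp add: split_def)
  have "AE s in ?L. AE \<omega> in M. H s \<omega> = 0"
    by (rule AE_I2, rule zero) (simp add: space_restrict_space)
  then have "AE \<omega> in M. AE s in ?L. H s \<omega> = 0"
    by (subst (asm) AE_commute) measurable
  then show ?thesis
  proof eventually_elim
    case (elim \<omega>)
    then have "AE s in lborel. s \<in> {0..T} \<longrightarrow> H s \<omega> = 0"
      by (simp add: AE_restrict_space_iff)
    then obtain N where N: "N \<in> null_sets lborel" "{s. \<not> (s \<in> {0..T} \<longrightarrow> H s \<omega> = 0)} \<subseteq> N"
      by (auto elim!: AE_E simp: null_sets_def)
    then have "negligible N"
      by (simp add: negligible_iff_null_sets null_sets_completionI)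
    with N(2) show ?case by (intro exI[of _ N]) auto
  qed
qed

section \<open>Decoupling of linear forward-backward systems\<close>

text \<open>The truncating event is an arbitrary one and the noise mean is kept as a term. Events of
  the filtration at time \<open>s\<close> or earlier will later make it constant in time; the
  comparison of two systems also truncates by events that belong to a later time than
  \<open>s\<close>.\<close>

lemma forward_mean:
  assumes "prob_space M" and f: "jointly_integrable M T f"
    and G: "integrable M (G s)" and X: "X s \<in> borel_measurable M"
    and eq: "AE \<omega> in M. \<forall>t\<in>{0..T}. X t \<omega> = x + (LINT r:{0..t}|lborel. f r \<omega>) + G t \<omega>"
    and s: "s \<in> {0..T}"
  shows "integrable M (X s)"
    and "A \<in> sets M \<Longrightarrow> (\<integral>\<omega>. indicator A \<omega> * X s \<omega> \<partial>M)
      = x * measure M A + integral {0..s} (\<lambda>r. \<integral>\<omega>. indicator A \<omega> * f r \<omega> \<partial>M)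
        + (\<integral>\<omega>. indicator A \<omega> * G s \<omega> \<partial>M)"
proof -
  interpret prob_space M by fact
  note Fub = jointly_integrable_Fubini[OF \<open>prob_space M\<close> f, of _ 0 s]
  have AE: "AE \<omega> in M. X s \<omega> = x + (LINT r:{0..s}|lborel. f r \<omega>) + G s \<omega>"
    using eq s by auto
  have int: "integrable M (\<lambda>\<omega>. LINT r:{0..s}|lborel. f r \<omega>)"
    using Fub(2)[OF sets.top] s by auto
  then have "integrable M (\<lambda>\<omega>. x + (LINT r:{0..s}|lborel. f r \<omega>) + G s \<omega>)"
    using G by auto
  then show "integrable M (X s)"
    using integrable_cong_AE[OF X _ AE] by blast
  assume A: "A \<in> sets M"
  have "(\<integral>\<omega>. indicator A \<omega> * X s \<omega> \<partial>M)
      = (\<integral>\<omega>. indicator A \<omega> * (x + (LINT r:{0..s}|lborel. f r \<omega>) + G s \<omega>) \<partial>M)"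
  proof (rule integral_cong_AE)
    show "AE \<omega> in M. indicator A \<omega> * X s \<omega>
        = indicator A \<omega> * (x + (LINT r:{0..s}|lborel. f r \<omega>) + G s \<omega>)"
      using AE by eventually_elim simp
  qed (use A X int G in measurable)
  also have "\<dots> = (\<integral>\<omega>. indicator A \<omega> * x + indicator A \<omega> * (LINT r:{0..s}|lborel. f r \<omega>)
      + indicator A \<omega> * G s \<omega> \<partial>M)"
    by (simp add: distrib_left)
  also have "\<dots> = (\<integral>\<omega>. indicator A \<omega> * x \<partial>M) + (\<integral>\<omega>. indicator A \<omega> * (LINT r:{0..s}|lborel. f r \<omega>) \<partial>M)
      + (\<integral>\<omega>. indicator A \<omega> * G s \<omega> \<partial>M)"
    using integrable_indicator_mult[OF A int] integrable_indicator_mult[OF A G]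
      integrable_indicator_mult[OF A integrable_const[of x]]
    by (subst Bochner_Integration.integral_add, auto)+
  also have "(\<integral>\<omega>. indicator A \<omega> * x \<partial>M) = x * measure M A"
    using A by simp
  also have "(\<integral>\<omega>. indicator A \<omega> * (LINT r:{0..s}|lborel. f r \<omega>) \<partial>M)
      = integral {0..s} (\<lambda>r. \<integral>\<omega>. indicator A \<omega> * f r \<omega> \<partial>M)"
    using Fub(3)[OF A] set_borel_integral_eq_integral(2)[OF Fub(1)[OF A]] s by simp
  finally show "(\<integral>\<omega>. indicator A \<omega> * X s \<omega> \<partial>M)
      = x * measure M A + integral {0..s} (\<lambda>r. \<integral>\<omega>. indicator A \<omega> * f r \<omega> \<partial>M)
        + (\<integral>\<omega>. indicator A \<omega> * G s \<omega> \<partial>M)" .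
qed

lemma backward_mean:
  assumes "prob_space M" and f: "jointly_integrable M T f"
    and H: "integrable M (H s)" "integrable M (H T)" and Y: "Y s \<in> borel_measurable M"
    and eq: "AE \<omega> in M. \<forall>t\<in>{0..T}. Y t \<omega> = (LINT r:{t..T}|lborel. f r \<omega>) - (H T \<omega> - H t \<omega>)"
    and s: "s \<in> {0..T}"
  shows "integrable M (Y s)"
    and "A \<in> sets M \<Longrightarrow> (\<integral>\<omega>. indicator A \<omega> * Y s \<omega> \<partial>M)
      = integral {s..T} (\<lambda>r. \<integral>\<omega>. indicator A \<omega> * f r \<omega> \<partial>M)
        - ((\<integral>\<omega>. indicator A \<omega> * H T \<omega> \<partial>M) - (\<integral>\<omega>. indicator A \<omega> * H s \<omega> \<partial>M))"
proof -
  interpret prob_space M by fact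
  note Fub = jointly_integrable_Fubini[OF \<open>prob_space M\<close> f, of _ s T]
  have AE: "AE \<omega> in M. Y s \<omega> = (LINT r:{s..T}|lborel. f r \<omega>) - (H T \<omega> - H s \<omega>)"
    using eq s by auto
  have int: "integrable M (\<lambda>\<omega>. LINT r:{s..T}|lborel. f r \<omega>)"
    using Fub(2)[OF sets.top] s by auto
  then have "integrable M (\<lambda>\<omega>. (LINT r:{s..T}|lborel. f r \<omega>) - (H T \<omega> - H s \<omega>))"
    using H by auto
  then show "integrable M (Y s)"
    using integrable_cong_AE[OF Y _ AE] by blast
  assume A: "A \<in> sets M"
  have "(\<integral>\<omega>. indicator A \<omega> * Y s \<omega> \<partial>M)
      = (\<integral>\<omega>. indicator A \<omega> * ((LINT r:{s..T}|lborel. f r \<omega>) - (H T \<omega> - H s \<omega>)) \<partial>M)"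
  proof (rule integral_cong_AE)
    show "AE \<omega> in M. indicator A \<omega> * Y s \<omega>
        = indicator A \<omega> * ((LINT r:{s..T}|lborel. f r \<omega>) - (H T \<omega> - H s \<omega>))"
      using AE by eventually_elim simp
  qed (use A Y int H in measurable)
  also have "\<dots> = (\<integral>\<omega>. indicator A \<omega> * (LINT r:{s..T}|lborel. f r \<omega>)
      - (indicator A \<omega> * H T \<omega> - indicator A \<omega> * H s \<omega>) \<partial>M)"
    by (simp add: right_diff_distrib)
  also have "\<dots> = (\<integral>\<omega>. indicator A \<omega> * (LINT r:{s..T}|lborel. f r \<omega>) \<partial>M)
      - ((\<integral>\<omega>. indicator A \<omega> * H T \<omega> \<partial>M) - (\<integral>\<omega>. indicator A \<omega> * H s \<omega> \<partial>M))"
    using integrable_indicator_mult[OF A int] integrable_indicator_mult[OF A H(1)]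
      integrable_indicator_mult[OF A H(2)]
    by (subst Bochner_Integration.integral_diff, auto)+
  also have "(\<integral>\<omega>. indicator A \<omega> * (LINT r:{s..T}|lborel. f r \<omega>) \<partial>M)
      = integral {s..T} (\<lambda>r. \<integral>\<omega>. indicator A \<omega> * f r \<omega> \<partial>M)"
    using Fub(3)[OF A] set_borel_integral_eq_integral(2)[OF Fub(1)[OF A]] s by simp
  finally show "(\<integral>\<omega>. indicator A \<omega> * Y s \<omega> \<partial>M)
      = integral {s..T} (\<lambda>r. \<integral>\<omega>. indicator A \<omega> * f r \<omega> \<partial>M)
        - ((\<integral>\<omega>. indicator A \<omega> * H T \<omega> \<partial>M) - (\<integral>\<omega>. indicator A \<omega> * H s \<omega> \<partial>M))" .
qed

lemma (in finite_measure) AE_eq_if_integrals_eq: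
  fixes f g :: "'a \<Rightarrow> real"
  assumes sub: "subalgebra M N" and f: "integrable M f" "f \<in> borel_measurable N"
    and g: "integrable M g" "g \<in> borel_measurable N"
    and eq: "\<And>A. A \<in> sets N \<Longrightarrow>
      (\<integral>\<omega>. indicator A \<omega> * f \<omega> \<partial>M) = (\<integral>\<omega>. indicator A \<omega> * g \<omega> \<partial>M)"
  shows "AE \<omega> in M. f \<omega> = g \<omega>"
proof -
  interpret finite_measure_subalgebra M N by unfold_locales fact
  have "AE \<omega> in M. real_cond_exp M N f \<omega> = g \<omega>"
    by (rule real_cond_exp_charact) (use f g eq in \<open>auto simp: set_lebesgue_integral_def\<close>)
  moreover have "AE \<omega> in M. real_cond_exp M N f \<omega> = f \<omega>"
    using f by (rule real_cond_exp_F_meas)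
  ultimately show ?thesis by eventually_elim simp
qed

text \<open>The common form of both systems. The limit has \<open>G1 = 0\<close>, the finite game
  has \<open>D\<close> times the average of the minor noises. \<open>H0\<close> and
  \<open>H1\<close> stand for the stochastic integrals of the backward equations, of which only the
  centred increments are retained.\<close>

locale lq_fbsde = prob_space M for M :: "'a measure" +
  fixes F :: "real \<Rightarrow> 'a measure" and T a b c q x0 x1 :: real
    and X0 X1 Y0 Y1 G0 G1 H0 H1 :: "'a process"
  assumes sub: "\<And>t. subalgebra M (F t)"
    and filt: "\<And>s t. s \<le> t \<Longrightarrow> sets (F s) \<subseteq> sets (F t)"
    and adapted: "\<And>t. t \<in> {0..T} \<Longrightarrow> X0 t \<in> borel_measurable (F t)"
      "\<And>t. t \<in> {0..T} \<Longrightarrow> X1 t \<in> borel_measurable (F t)"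
      "\<And>t. t \<in> {0..T} \<Longrightarrow> Y0 t \<in> borel_measurable (F t)"
      "\<And>t. t \<in> {0..T} \<Longrightarrow> Y1 t \<in> borel_measurable (F t)"
    and joint: "jointly_integrable M T X0" "jointly_integrable M T X1"
      "jointly_integrable M T Y0" "jointly_integrable M T Y1"
    and centred: "centred_increments M F T G0" "centred_increments M F T G1"
      "centred_increments M F T H0" "centred_increments M F T H1"
    and X0_eq: "AE \<omega> in M. \<forall>t\<in>{0..T}. X0 t \<omega>
        = x0 + (LINT s:{0..t}|lborel. a * X1 s \<omega> - (1/2) * b\<^sup>2 * Y0 s \<omega>) + G0 t \<omega>"
    and X1_eq: "AE \<omega> in M. \<forall>t\<in>{0..T}. X1 t \<omega> = x1 + (LINT s:{0..t}|lborel. c * X0 s \<omega>) + G1 t \<omega>"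
    and Y0_eq: "AE \<omega> in M. \<forall>t\<in>{0..T}. Y0 t \<omega>
        = (LINT s:{t..T}|lborel. c * Y1 s \<omega> + 2 * q * X0 s \<omega>) - (H0 T \<omega> - H0 t \<omega>)"
    and Y1_eq: "AE \<omega> in M. \<forall>t\<in>{0..T}. Y1 t \<omega>
        = (LINT s:{t..T}|lborel. a * Y0 s \<omega>) - (H1 T \<omega> - H1 t \<omega>)"
begin

lemma measurable_components:
  assumes "t \<in> {0..T}"
  shows "X0 t \<in> borel_measurable M" "X1 t \<in> borel_measurable M"
    "Y0 t \<in> borel_measurable M" "Y1 t \<in> borel_measurable M"
  using adapted[OF assms] by (auto intro: measurable_from_subalg[OF sub])

lemma joint_drifts:
  "jointly_integrable M T (\<lambda>s \<omega>. a * X1 s \<omega> - (1/2) * b\<^sup>2 * Y0 s \<omega>)"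
  "jointly_integrable M T (\<lambda>s \<omega>. c * X0 s \<omega>)"
  "jointly_integrable M T (\<lambda>s \<omega>. c * Y1 s \<omega> + 2 * q * X0 s \<omega>)"
  "jointly_integrable M T (\<lambda>s \<omega>. a * Y0 s \<omega>)"
  by (intro jointly_integrable_diff jointly_integrable_add jointly_integrable_mult joint)+

lemma integrable_components:
  assumes t: "t \<in> {0..T}"
  shows "integrable M (X0 t)" "integrable M (X1 t)" "integrable M (Y0 t)" "integrable M (Y1 t)"
proof -
  have T: "T \<in> {0..T}" using t by auto
  note c = centred[THEN centred_increments_integrable]
  show "integrable M (X0 t)"
    by (rule forward_mean(1)[OF prob_space_axioms joint_drifts(1) c(1)[OF t] measurable_components(1)[OF t] X0_eq t])
  show "integrable M (X1 t)"
    by (rule forward_mean(1)[OF prob_space_axioms joint_drifts(2) c(2)[OF t] measurable_components(2)[OF t] X1_eq t])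
  show "integrable M (Y0 t)"
    by (rule backward_mean(1)[OF prob_space_axioms joint_drifts(3) c(3)[OF t] c(3)[OF T] measurable_components(3)[OF t] Y0_eq t])
  show "integrable M (Y1 t)"
    by (rule backward_mean(1)[OF prob_space_axioms joint_drifts(4) c(4)[OF t] c(4)[OF T] measurable_components(4)[OF t] Y1_eq t])
qed

definition mean :: "'a set \<Rightarrow> 'a process \<Rightarrow> real \<Rightarrow> real" where
  "mean A X t = (\<integral>\<omega>. indicator A \<omega> * X t \<omega> \<partial>M)"

lemma mean_lin:
  assumes "A \<in> events" "integrable M (X t)" "integrable M (Y t)"
  shows "(\<integral>\<omega>. indicator A \<omega> * (k * X t \<omega> + l * Y t \<omega>) \<partial>M) = k * mean A X t + l * mean A Y t"
proof -
  have "(\<integral>\<omega>. indicator A \<omega> * (k * X t \<omega> + l * Y t \<omega>) \<partial>M)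
      = (\<integral>\<omega>. k * (indicator A \<omega> * X t \<omega>) + l * (indicator A \<omega> * Y t \<omega>) \<partial>M)"
    by (simp add: algebra_simps)
  also have "\<dots> = k * mean A X t + l * mean A Y t"
    using integrable_indicator_mult[OF assms(1,2)] integrable_indicator_mult[OF assms(1,3)]
    by (simp add: mean_def)
  finally show ?thesis .
qed

lemma mean_drifts:
  assumes "A \<in> events" and r: "r \<in> {0..T}"
  shows "(\<integral>\<omega>. indicator A \<omega> * (a * X1 r \<omega> - (1/2) * b\<^sup>2 * Y0 r \<omega>) \<partial>M)
      = a * mean A X1 r - (1/2) * b\<^sup>2 * mean A Y0 r"
    and "(\<integral>\<omega>. indicator A \<omega> * (c * X0 r \<omega>) \<partial>M) = c * mean A X0 r"
    and "(\<integral>\<omega>. indicator A \<omega> * (c * Y1 r \<omega> + 2 * q * X0 r \<omega>) \<partial>M)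
      = c * mean A Y1 r + 2 * q * mean A X0 r"
    and "(\<integral>\<omega>. indicator A \<omega> * (a * Y0 r \<omega>) \<partial>M) = a * mean A Y0 r"
  using integrable_components[OF r] assms(1)
    mean_lin[where X = X1 and Y = Y0 and t = r and k = a and l = "- ((1/2) * b\<^sup>2)"]
    mean_lin[where X = X0 and Y = X0 and t = r and k = c and l = 0]
    mean_lin[where X = Y1 and Y = X0 and t = r and k = c and l = "2 * q"]
    mean_lin[where X = Y0 and Y = Y0 and t = r and k = a and l = 0]
  by simp_all

lemma mean_integrable_on:
  assumes A: "A \<in> events" and "0 \<le> \<tau>"
  shows "mean A X0 integrable_on {\<tau>..T}" "mean A X1 integrable_on {\<tau>..T}"
    "mean A Y0 integrable_on {\<tau>..T}" "mean A Y1 integrable_on {\<tau>..T}"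
  using set_borel_integral_eq_integral(1)[OF jointly_integrable_Fubini(1)[OF prob_space_axioms _ A assms(2) order_refl]] joint
  by (auto simp: mean_def[abs_def])

lemma mean_forward:
  assumes A: "A \<in> events" and s: "s \<in> {0..T}"
  shows "mean A X0 s = x0 * prob A
      + integral {0..s} (\<lambda>r. a * mean A X1 r - (1/2) * b\<^sup>2 * mean A Y0 r) + mean A G0 s"
    and "mean A X1 s = x1 * prob A + integral {0..s} (\<lambda>r. c * mean A X0 r) + mean A G1 s"
proof -
  note ci = centred[THEN centred_increments_integrable]
  have cong: "integral {0..s} f = integral {0..s} g" if "\<And>r. r \<in> {0..T} \<Longrightarrow> f r = g r"
    for f g :: "real \<Rightarrow> real"
    using that s by (intro integral_cong) auto
  show "mean A X0 s = x0 * prob A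
      + integral {0..s} (\<lambda>r. a * mean A X1 r - (1/2) * b\<^sup>2 * mean A Y0 r) + mean A G0 s"
    using forward_mean(2)[OF prob_space_axioms joint_drifts(1) ci(1)[OF s] measurable_components(1)[OF s] X0_eq s A]
      cong[OF mean_drifts(1)[OF A]] by (simp add: mean_def)
  show "mean A X1 s = x1 * prob A + integral {0..s} (\<lambda>r. c * mean A X0 r) + mean A G1 s"
    using forward_mean(2)[OF prob_space_axioms joint_drifts(2) ci(2)[OF s] measurable_components(2)[OF s] X1_eq s A]
      cong[OF mean_drifts(2)[OF A]] by (simp add: mean_def)
qed

lemma mean_decoupling:
  assumes S: "lq_riccati T a b c q S" and \<tau>: "\<tau> \<in> {0..T}" and A: "A \<in> sets (F \<tau>)"
  shows "mean A Y0 \<tau> = S \<tau> $ 1 $ 1 * mean A X0 \<tau> + S \<tau> $ 1 $ 2 * mean A X1 \<tau>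
    \<and> mean A Y1 \<tau> = S \<tau> $ 2 $ 1 * mean A X0 \<tau> + S \<tau> $ 2 $ 2 * mean A X1 \<tau>"
proof (rule riccati_decoupling[OF S, where ?\<mu>0.0 = "mean A X0 \<tau>" and ?\<mu>1.0 = "mean A X1 \<tau>"])
  have AM: "A \<in> events" using subalgebra_sets[OF sub A] .
  show "0 \<le> \<tau>" using \<tau> by simp
  then show "mean A X0 integrable_on {\<tau>..T}" "mean A X1 integrable_on {\<tau>..T}"
    "mean A Y0 integrable_on {\<tau>..T}" "mean A Y1 integrable_on {\<tau>..T}"
    using mean_integrable_on[OF AM] by auto
  show "\<tau> \<in> {\<tau>..T}" using \<tau> by simp
  have sub': "f integrable_on {0..s}" if "f integrable_on {0..T}" "s \<le> T" for f :: "real \<Rightarrow> real" and s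
    using that by (auto intro: integrable_on_subinterval)
  note int0 = mean_integrable_on[OF AM order_refl]
  fix s assume s: "s \<in> {\<tau>..T}"
  then have s': "s \<in> {0..T}" using \<tau> by auto
  have comb: "integral {0..s} f = integral {0..\<tau>} f + integral {\<tau>..s} f"
    if "f integrable_on {0..T}" for f :: "real \<Rightarrow> real"
    by (rule Henstock_Kurzweil_Integration.integral_combine[symmetric])
      (use \<tau> s sub'[OF that] in auto)
  \<comment> \<open>Since \<open>A\<close> belongs to \<open>F \<tau>\<close>, the forward noise has
    a constant truncated mean from \<open>\<tau>\<close> on and is absorbed in the initial values
    \<open>mean A X0 \<tau>\<close> and \<open>mean A X1 \<tau>\<close>.\<close>
  have G: "mean A G s = mean A G \<tau>" if "centred_increments M F T G" for G
    unfolding mean_def by (rule centred_increments_eq[OF that]) (use \<tau> s A in auto)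
  show "mean A X0 s = mean A X0 \<tau> + integral {\<tau>..s} (\<lambda>r. a * mean A X1 r - (1/2) * b\<^sup>2 * mean A Y0 r)"
    unfolding mean_forward(1)[OF AM s'] mean_forward(1)[OF AM \<tau>] G[OF centred(1)]
    by (subst comb) (auto intro!: integrable_diff integrable_on_mult_right int0)
  show "mean A X1 s = mean A X1 \<tau> + integral {\<tau>..s} (\<lambda>r. c * mean A X0 r)"
    unfolding mean_forward(2)[OF AM s'] mean_forward(2)[OF AM \<tau>] G[OF centred(2)]
    by (subst comb) (auto intro!: integrable_on_mult_right int0)
  have T: "T \<in> {0..T}" using \<tau> by auto
  \<comment> \<open>The backward noise runs from \<open>s\<close> to \<open>T\<close>, so here
    \<open>A\<close> is used as an event of the larger sigma-algebra \<open>F s\<close>.\<close>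
  have H: "(\<integral>\<omega>. indicator A \<omega> * H T \<omega> \<partial>M) = (\<integral>\<omega>. indicator A \<omega> * H s \<omega> \<partial>M)"
    if "centred_increments M F T H" for H
    using subsetD[OF filt A] s \<tau> by (intro centred_increments_eq[OF that]) auto
  note ci = centred[THEN centred_increments_integrable]
  have cong: "integral {s..T} f = integral {s..T} g" if "\<And>r. r \<in> {0..T} \<Longrightarrow> f r = g r"
    for f g :: "real \<Rightarrow> real"
    using that s' by (intro integral_cong) auto
  show "mean A Y0 s = integral {s..T} (\<lambda>r. c * mean A Y1 r + 2 * q * mean A X0 r)"
    using backward_mean(2)[OF prob_space_axioms joint_drifts(3) ci(3)[OF s'] ci(3)[OF T]
        measurable_components(3)[OF s'] Y0_eq s' AM] H[OF centred(3)] cong[OF mean_drifts(3)[OF AM]]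
    by (simp add: mean_def)
  show "mean A Y1 s = integral {s..T} (\<lambda>r. a * mean A Y0 r)"
    using backward_mean(2)[OF prob_space_axioms joint_drifts(4) ci(4)[OF s'] ci(4)[OF T]
        measurable_components(4)[OF s'] Y1_eq s' AM] H[OF centred(4)] cong[OF mean_drifts(4)[OF AM]]
    by (simp add: mean_def)
qed

lemma decoupling:
  assumes S: "lq_riccati T a b c q S" and t: "t \<in> {0..T}"
  shows "AE \<omega> in M. Y0 t \<omega> = S t $ 1 $ 1 * X0 t \<omega> + S t $ 1 $ 2 * X1 t \<omega>"
    and "AE \<omega> in M. Y1 t \<omega> = S t $ 2 $ 1 * X0 t \<omega> + S t $ 2 $ 2 * X1 t \<omega>"
proof -
  note int = integrable_components[OF t] and ad = adapted[OF t]
  have A: "A \<in> events" if "A \<in> sets (F t)" for A using subalgebra_sets[OF sub that] .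
  note md = mean_decoupling[OF S t]
  show "AE \<omega> in M. Y0 t \<omega> = S t $ 1 $ 1 * X0 t \<omega> + S t $ 1 $ 2 * X1 t \<omega>"
    by (rule AE_eq_if_integrals_eq[OF sub])
      (use int ad md mean_lin[where X = X0 and Y = X1 and t = t, OF A int(1,2)] in \<open>auto simp: mean_def[of _ Y0]\<close>)
  show "AE \<omega> in M. Y1 t \<omega> = S t $ 2 $ 1 * X0 t \<omega> + S t $ 2 $ 2 * X1 t \<omega>"
    by (rule AE_eq_if_integrals_eq[OF sub])
      (use int ad md mean_lin[where X = X0 and Y = X1 and t = t, OF A int(1,2)] in \<open>auto simp: mean_def[of _ Y1]\<close>)
qed

text \<open>Once the feedback relation holds almost surely it may be integrated over any event, not
  only over those of \<open>F t\<close>. The comparison of two systems needs this, as one event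
  serves there for all times.\<close>

lemma mean_decoupled:
  assumes S: "lq_riccati T a b c q S" and t: "t \<in> {0..T}" and A: "A \<in> events"
  shows "mean A Y0 t = S t $ 1 $ 1 * mean A X0 t + S t $ 1 $ 2 * mean A X1 t"
proof -
  have "mean A Y0 t = (\<integral>\<omega>. indicator A \<omega> * (S t $ 1 $ 1 * X0 t \<omega> + S t $ 1 $ 2 * X1 t \<omega>) \<partial>M)"
    unfolding mean_def
    by (rule integral_cong_AE) (use measurable_components[OF t] decoupling(1)[OF S t] A in auto)
  then show ?thesis
    using mean_lin[where X = X0 and Y = X1 and t = t, OF A integrable_components(1,2)[OF t]] by simp
qed

end

section \<open>Comparison of two systems that share the noise of the major player\<close>

lemma drift_diff:
  fixes a b :: real
  shows "(a * x' - (1/2) * b\<^sup>2 * y') - (a * x - (1/2) * b\<^sup>2 * y)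
    = a * (x' - x) - (1/2) * b\<^sup>2 * (y' - y)"
  by (simp add: algebra_simps diff_divide_distrib)

text \<open>The filtrations \<open>F\<close> and \<open>F'\<close> may differ, since each is used
  only to decouple its own system; afterwards everything is pathwise. The shared \<open>G0\<close>
  cancels, which leaves \<open>G1' - G1\<close> as the only forcing.\<close>

lemma lq_fbsde_difference_paths:
  fixes S :: "real \<Rightarrow> real^2^2"
  assumes "lq_fbsde M F T a b c q x0 x1 X0 X1 Y0 Y1 G0 G1 H0 H1"
    and "lq_fbsde M F' T a b c q x0 x1 X0' X1' Y0' Y1' G0 G1' H0' H1'"
    and S: "lq_riccati T a b c q S"
    and C: "\<And>t i j. t \<in> {0..T} \<Longrightarrow> \<bar>S t $ i $ j\<bar> \<le> C" "0 \<le> C"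
    and K: "K = \<bar>a\<bar> + \<bar>c\<bar> + b\<^sup>2 * C"
    and cont: "AE \<omega> in M. continuous_on {0..T} (\<lambda>t. G1' t \<omega> - G1 t \<omega>)"
  shows "AE \<omega> in M. \<forall>t\<in>{0..T}. \<bar>X0' t \<omega> - X0 t \<omega>\<bar> + \<bar>X1' t \<omega> - X1 t \<omega>\<bar>
     \<le> \<bar>G1' t \<omega> - G1 t \<omega>\<bar> + K * (exp (K * t) * integral {0..t} (\<lambda>s. \<bar>G1' s \<omega> - G1 s \<omega>\<bar>))"
proof -
  interpret P: lq_fbsde M F T a b c q x0 x1 X0 X1 Y0 Y1 G0 G1 H0 H1 by fact
  interpret Q: lq_fbsde M F' T a b c q x0 x1 X0' X1' Y0' Y1' G0 G1' H0' H1' by fact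
  note ps = P.prob_space_axioms
  let ?L = "restrict_space lborel {0..T}"
  \<comment> \<open>The defect of the feedback relation for the difference. It vanishes almost
    surely at each time by the two decouplings with the same \<open>S\<close>.\<close>
  define E where "E = (\<lambda>s \<omega>. (Y0' s \<omega> - Y0 s \<omega>) -
    (S s $ 1 $ 1 * (X0' s \<omega> - X0 s \<omega>) + S s $ 1 $ 2 * (X1' s \<omega> - X1 s \<omega>)))"
  have "AE \<omega> in M. \<exists>Z. negligible Z \<and> (\<forall>t\<in>{0..T} - Z. E t \<omega> = 0)"
  proof (rule AE_time_paths[OF ps])
    have [measurable]: "(\<lambda>s. S s $ i $ j) \<in> borel_measurable ?L" for i j
      using borel_measurable_continuous_on_restrict[of "{0..T}" "\<lambda>s. S s $ i $ j"]
        continuous_on_component[OF continuous_on_component[OF lq_riccati_continuous[OF S]]]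
      by (simp cong: measurable_cong_sets sets_restrict_space_cong)
    have meas: "(\<lambda>p. H (fst p) (snd p)) \<in> borel_measurable (?L \<Otimes>\<^sub>M M)"
      if "jointly_integrable M T H" for H
      using that unfolding jointly_integrable_def split_def by (rule borel_measurable_integrable)
    note [measurable] = P.joint(1-3)[THEN meas] Q.joint(1-3)[THEN meas]
    show "(\<lambda>(s, \<omega>). E s \<omega>) \<in> borel_measurable (?L \<Otimes>\<^sub>M M)"
      unfolding E_def split_def by measurable
    fix t assume t: "t \<in> {0..T}"
    from P.decoupling(1)[OF S t] Q.decoupling(1)[OF S t]
    show "AE \<omega> in M. E t \<omega> = 0"
      by eventually_elim (simp add: E_def algebra_simps)
  qed
  moreover note P.X0_eq P.X1_eq Q.X0_eq Q.X1_eq cont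
    P.joint(1-3)[THEN jointly_integrable_paths[OF ps]]
    Q.joint(1-3)[THEN jointly_integrable_paths[OF ps]]
  ultimately show ?thesis
  proof eventually_elim
    case (elim \<omega>)
    from elim(1) obtain Z where Z: "negligible Z" "\<And>t. t \<in> {0..T} - Z \<Longrightarrow> E t \<omega> = 0" by blast
    define \<delta>0 where "\<delta>0 = (\<lambda>s. X0' s \<omega> - X0 s \<omega>)"
    define \<delta>1 where "\<delta>1 = (\<lambda>s. X1' s \<omega> - X1 s \<omega>)"
    define \<eta> where "\<eta> = (\<lambda>s. Y0' s \<omega> - Y0 s \<omega>)"
    define g where "g = (\<lambda>s. \<bar>G1' s \<omega> - G1 s \<omega>\<bar>)"
    note paths = elim(7-12)
    have lint: "(LINT s:{0..t}|lborel. f s) = integral {0..t} f" "f integrable_on {0..t}"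
      if "set_integrable lborel {0..T} f" "t \<in> {0..T}" for f :: "real \<Rightarrow> real" and t
      using set_borel_integral_eq_integral[OF set_integrable_subset[OF that(1), of "{0..t}"]] that(2)
      by auto
    have si: "set_integrable lborel {0..T} \<delta>0" "set_integrable lborel {0..T} \<delta>1"
      "set_integrable lborel {0..T} \<eta>"
      unfolding \<delta>0_def \<delta>1_def \<eta>_def by (intro set_integral_diff(1) paths)+
    have dX0: "\<delta>0 t = integral {0..t} (\<lambda>s. a * \<delta>1 s - (1/2) * b\<^sup>2 * \<eta> s)"
      and dX1: "\<delta>1 t = integral {0..t} (\<lambda>s. c * \<delta>0 s) + (G1' t \<omega> - G1 t \<omega>)"
      if t: "t \<in> {0..T}" for t
    proof -
      have dr: "set_integrable lborel {0..T} (\<lambda>s. a * f s - (1/2) * b\<^sup>2 * h s)"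
        if "set_integrable lborel {0..T} f" "set_integrable lborel {0..T} h" for f h :: "real \<Rightarrow> real"
        by (intro set_integral_diff(1) set_integrable_mult_right that)
      note l = lint[OF dr t]
      have "\<delta>0 t = integral {0..t} (\<lambda>s. a * X1' s \<omega> - (1/2) * b\<^sup>2 * Y0' s \<omega>)
          - integral {0..t} (\<lambda>s. a * X1 s \<omega> - (1/2) * b\<^sup>2 * Y0 s \<omega>)"
        using elim(2,4) t l(1)[OF paths(2,3)] l(1)[OF paths(5,6)] by (simp add: \<delta>0_def)
      also have "\<dots> = integral {0..t} (\<lambda>s. (a * X1' s \<omega> - (1/2) * b\<^sup>2 * Y0' s \<omega>)
          - (a * X1 s \<omega> - (1/2) * b\<^sup>2 * Y0 s \<omega>))"
        by (rule Henstock_Kurzweil_Integration.integral_diff[symmetric]) (intro l(2) paths)+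
      finally show "\<delta>0 t = integral {0..t} (\<lambda>s. a * \<delta>1 s - (1/2) * b\<^sup>2 * \<eta> s)"
        unfolding drift_diff \<delta>1_def \<eta>_def .
      note m = lint[OF set_integrable_mult_right t]
      have "\<delta>1 t = integral {0..t} (\<lambda>s. c * X0' s \<omega>) - integral {0..t} (\<lambda>s. c * X0 s \<omega>)
          + (G1' t \<omega> - G1 t \<omega>)"
        using elim(3,5) t lint(1)[OF paths(1) t] lint(1)[OF paths(4) t]
        by (simp add: \<delta>1_def)
      also have "integral {0..t} (\<lambda>s. c * X0' s \<omega>) - integral {0..t} (\<lambda>s. c * X0 s \<omega>)
          = integral {0..t} (\<lambda>s. c * X0' s \<omega> - c * X0 s \<omega>)"
        by (rule Henstock_Kurzweil_Integration.integral_diff[symmetric]) (intro m(2) paths)+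
      finally show "\<delta>1 t = integral {0..t} (\<lambda>s. c * \<delta>0 s) + (G1' t \<omega> - G1 t \<omega>)"
        by (simp add: \<delta>0_def algebra_simps)
    qed
    have "\<bar>\<delta>0 t\<bar> + \<bar>\<delta>1 t\<bar> \<le> g t + K * (exp (K * t) * integral {0..t} g)" if t: "t \<in> {0..T}" for t
    proof (rule lq_difference_bound[OF C K _ _ _ _ _ _ dX0 _ Z(1) _ t])
      show "g integrable_on {0..T}"
        unfolding g_def by (intro integrable_continuous_real continuous_intros elim(6))
      show "\<delta>0 integrable_on {0..T}" "\<delta>1 integrable_on {0..T}" "\<eta> integrable_on {0..T}"
        "(\<lambda>t. \<bar>\<delta>0 t\<bar>) integrable_on {0..T}" "(\<lambda>t. \<bar>\<delta>1 t\<bar>) integrable_on {0..T}"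
        using si si[THEN set_integrable_abs] by (auto dest: set_borel_integral_eq_integral(1))
      show "\<bar>\<delta>1 t - integral {0..t} (\<lambda>s. c * \<delta>0 s)\<bar> \<le> g t" if "t \<in> {0..T}" for t
        using dX1[OF that] by (simp add: g_def)
      show "\<eta> t = S t $ 1 $ 1 * \<delta>0 t + S t $ 1 $ 2 * \<delta>1 t" if "t \<in> {0..T} - Z" for t
        using Z(2)[OF that] by (simp add: E_def \<eta>_def \<delta>0_def \<delta>1_def)
    qed
    then show ?case by (simp add: \<delta>0_def \<delta>1_def g_def)
  qed
qed

text \<open>Truncation by an event on which the minor noises have equal means removes the forcing
  altogether, so the linear estimate yields equality and not merely closeness.\<close>

lemma lq_fbsde_difference_means:
  fixes S :: "real \<Rightarrow> real^2^2"
  assumes "lq_fbsde M F T a b c q x0 x1 X0 X1 Y0 Y1 G0 G1 H0 H1"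
    and "lq_fbsde M F' T a b c q x0 x1 X0' X1' Y0' Y1' G0 G1' H0' H1'"
    and S: "lq_riccati T a b c q S"
    and A: "A \<in> sets M"
    and G: "\<And>s. s \<in> {0..T} \<Longrightarrow>
      (\<integral>\<omega>. indicator A \<omega> * G1' s \<omega> \<partial>M) = (\<integral>\<omega>. indicator A \<omega> * G1 s \<omega> \<partial>M)"
    and t: "t \<in> {0..T}"
  shows "(\<integral>\<omega>. indicator A \<omega> * Y0' t \<omega> \<partial>M) = (\<integral>\<omega>. indicator A \<omega> * Y0 t \<omega> \<partial>M)"
proof -
  interpret P: lq_fbsde M F T a b c q x0 x1 X0 X1 Y0 Y1 G0 G1 H0 H1 by fact
  interpret Q: lq_fbsde M F' T a b c q x0 x1 X0' X1' Y0' Y1' G0 G1' H0' H1' by fact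
  obtain C where C: "\<And>t i j. t \<in> {0..T} \<Longrightarrow> \<bar>S t $ i $ j\<bar> \<le> C" "0 \<le> C"
    using lq_riccati_bounded[OF S] by metis
  let ?K = "\<bar>a\<bar> + \<bar>c\<bar> + b\<^sup>2 * C"
  define \<delta>0 where "\<delta>0 = (\<lambda>s. P.mean A X0' s - P.mean A X0 s)"
  define \<delta>1 where "\<delta>1 = (\<lambda>s. P.mean A X1' s - P.mean A X1 s)"
  define \<eta> where "\<eta> = (\<lambda>s. P.mean A Y0' s - P.mean A Y0 s)"
  have sub: "f integrable_on {0..s}" if "f integrable_on {0..T}" "s \<in> {0..T}" for f :: "real \<Rightarrow> real" and s
    using that by (auto intro: integrable_on_subinterval)
  note int = P.mean_integrable_on[OF A order_refl] Q.mean_integrable_on[OF A order_refl]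
  have dX0: "\<delta>0 t = integral {0..t} (\<lambda>s. a * \<delta>1 s - (1/2) * b\<^sup>2 * \<eta> s)"
    and dX1: "\<delta>1 t = integral {0..t} (\<lambda>s. c * \<delta>0 s)"
    if t: "t \<in> {0..T}" for t
  proof -
    have "\<delta>0 t = integral {0..t} (\<lambda>s. a * P.mean A X1' s - (1/2) * b\<^sup>2 * P.mean A Y0' s)
        - integral {0..t} (\<lambda>s. a * P.mean A X1 s - (1/2) * b\<^sup>2 * P.mean A Y0 s)"
      using P.mean_forward(1)[OF A t] Q.mean_forward(1)[OF A t] by (simp add: \<delta>0_def)
    also have "\<dots> = integral {0..t} (\<lambda>s. (a * P.mean A X1' s - (1/2) * b\<^sup>2 * P.mean A Y0' s)
        - (a * P.mean A X1 s - (1/2) * b\<^sup>2 * P.mean A Y0 s))"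
      by (rule Henstock_Kurzweil_Integration.integral_diff[symmetric])
        (intro integrable_diff integrable_on_mult_right sub[OF _ t] int)+
    finally show "\<delta>0 t = integral {0..t} (\<lambda>s. a * \<delta>1 s - (1/2) * b\<^sup>2 * \<eta> s)"
      unfolding drift_diff \<delta>1_def \<eta>_def .
    have "\<delta>1 t = integral {0..t} (\<lambda>s. c * P.mean A X0' s) - integral {0..t} (\<lambda>s. c * P.mean A X0 s)"
      using P.mean_forward(2)[OF A t] Q.mean_forward(2)[OF A t] G[OF t]
      by (simp add: \<delta>1_def P.mean_def)
    also have "\<dots> = integral {0..t} (\<lambda>s. c * P.mean A X0' s - c * P.mean A X0 s)"
      by (rule Henstock_Kurzweil_Integration.integral_diff[symmetric])
        (intro integrable_on_mult_right sub[OF _ t] int)+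
    finally show "\<delta>1 t = integral {0..t} (\<lambda>s. c * \<delta>0 s)"
      by (simp add: \<delta>0_def algebra_simps)
  qed
  have i: "\<delta>0 integrable_on {0..T}" "\<delta>1 integrable_on {0..T}" "\<eta> integrable_on {0..T}"
    unfolding \<delta>0_def \<delta>1_def \<eta>_def by (intro integrable_diff int)+
  \<comment> \<open>Gauge integrability does not carry over to absolute values, so the integrability
    of \<open>\<bar>\<delta>0\<bar>\<close> and \<open>\<bar>\<delta>1\<bar>\<close> is obtained
    from continuity, which the integral equations provide.\<close>
  have "(\<lambda>s. a * \<delta>1 s - (1/2) * b\<^sup>2 * \<eta> s) integrable_on {0..T}" "(\<lambda>s. c * \<delta>0 s) integrable_on {0..T}"
    by (intro integrable_diff integrable_on_mult_right i)+
  note ic = this[THEN indefinite_integral_continuous_1]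
  have "continuous_on {0..T} \<delta>0 = continuous_on {0..T} (\<lambda>x. integral {0..x} (\<lambda>s. a * \<delta>1 s - (1/2) * b\<^sup>2 * \<eta> s))"
    "continuous_on {0..T} \<delta>1 = continuous_on {0..T} (\<lambda>x. integral {0..x} (\<lambda>s. c * \<delta>0 s))"
    by (rule continuous_on_cong[OF refl dX0], assumption) (rule continuous_on_cong[OF refl dX1], assumption)
  with ic have cont: "continuous_on {0..T} \<delta>0" "continuous_on {0..T} \<delta>1" by blast+
  have "\<bar>\<delta>0 t\<bar> + \<bar>\<delta>1 t\<bar> \<le> 0 + ?K * (exp (?K * t) * integral {0..t} (\<lambda>_. 0))"
  proof (rule lq_difference_bound[OF C refl i _ _ _ dX0 _ negligible_empty _ t])
    show "(\<lambda>t. \<bar>\<delta>0 t\<bar>) integrable_on {0..T}" "(\<lambda>t. \<bar>\<delta>1 t\<bar>) integrable_on {0..T}"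
      by (intro integrable_continuous_real continuous_intros cont)+
    show "\<bar>\<delta>1 t - integral {0..t} (\<lambda>s. c * \<delta>0 s)\<bar> \<le> 0" if "t \<in> {0..T}" for t
      using dX1[OF that] by simp
    show "\<eta> t = S t $ 1 $ 1 * \<delta>0 t + S t $ 1 $ 2 * \<delta>1 t" if "t \<in> {0..T} - {}" for t
      using P.mean_decoupled[OF S _ A, of t] Q.mean_decoupled[OF S _ A, of t] that
      by (simp add: \<eta>_def \<delta>0_def \<delta>1_def algebra_simps)
  qed auto
  then have "\<delta>0 t = 0" "\<delta>1 t = 0" by simp_all
  then have "P.mean A Y0' t = P.mean A Y0 t"
    using P.mean_decoupled[OF S t A] Q.mean_decoupled[OF S t A] by (simp add: \<delta>0_def \<delta>1_def)
  then show ?thesis by (simp add: P.mean_def)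
qed

section \<open>Averages of independent Wiener processes\<close>

text \<open>Applied with \<open>Some\<close>, it drops the representative player's noise from the
  family and keeps the players of the finite games.\<close>

lemma independent_wiener_reindex:
  assumes "prob_space M" "inj f" and V: "independent_wiener_processes M V"
  shows "independent_wiener_processes M (\<lambda>i. V (f i))"
proof -
  interpret prob_space M by fact
  let ?X = "\<lambda>i \<omega>. \<lambda>t\<in>{0..}. V i t \<omega>"
  define E where "E i = {?X i -` A \<inter> space M | A. A \<in> sets (\<Pi>\<^sub>M t\<in>{0::real..}. (borel :: real measure))}" for i
  have rv: "\<forall>i. ?X i \<in> M \<rightarrow>\<^sub>M (\<Pi>\<^sub>M t\<in>{0..}. borel)" and E: "indep_sets E UNIV"
    using V unfolding independent_wiener_processes_def indep_vars_def2 E_def by auto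
  have "indep_sets (\<lambda>i. E (f i)) UNIV"
  proof (rule indep_setsI)
    show "E (f i) \<subseteq> events" for i using E by (auto simp: indep_sets_def)
    fix A J assume J: "J \<noteq> {}" "finite J" "\<forall>j\<in>J. A j \<in> E (f j)"
    \<comment> \<open>Independence is available for events indexed by the original family;
      \<open>inv f\<close> transports the given events to the indices in the image of
      \<open>f\<close>.\<close>
    have "prob (\<Inter>k\<in>f ` J. A (inv f k)) = (\<Prod>k\<in>f ` J. prob (A (inv f k)))"
      by (rule indep_setsD[OF E]) (use J \<open>inj f\<close> in auto)
    then show "prob (\<Inter>j\<in>J. A j) = (\<Prod>j\<in>J. prob (A j))"
      using \<open>inj f\<close> by (simp add: prod.reindex inj_on_subset)
  qed
  with rv have "indep_vars (\<lambda>_. \<Pi>\<^sub>M t\<in>{0..}. borel) (\<lambda>i. ?X (f i)) UNIV"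
    unfolding indep_vars_def2 E_def by blast
  then show ?thesis
    using V by (simp add: independent_wiener_processes_def)
qed

text \<open>Increments from time 0 match the form of the forward equations; \<open>W i 0\<close>
  vanishes only almost surely. For \<open>N = 0\<close> the value is 0, division by zero being
  zero.\<close>

definition noise_mean :: "(nat \<Rightarrow> 'a process) \<Rightarrow> nat \<Rightarrow> 'a process" where
  "noise_mean W N t \<omega> = (1 / real N) * (\<Sum>i=1..N. W i t \<omega> - W i 0 \<omega>)"

text \<open>The average is a centred Gaussian of variance \<open>t / N\<close>, with fourth moment
  \<open>3 * (t / N)^2\<close>. The second moment, of order \<open>1 / N\<close>, would not be
  summable. For \<open>t = 0\<close> or \<open>N = 0\<close> both sides vanish.\<close>

lemma noise_mean_moment4:
  assumes "prob_space M" and W: "independent_wiener_processes M W" and t: "0 \<le> t"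
  shows "(\<integral>\<^sup>+\<omega>. ennreal ((noise_mean W N t \<omega>)^4) \<partial>M) \<le> ennreal (3 * t\<^sup>2 / (real N)\<^sup>2)"
proof (cases "t = 0 \<or> N = 0")
  case False
  interpret prob_space M by fact
  let ?S = "\<lambda>\<omega>. \<Sum>i=1..N. W i t \<omega> - W i 0 \<omega>"
  let ?\<sigma> = "sqrt (\<Sum>i=1..N. (sqrt t)\<^sup>2)"
  have t0: "0 < t" and N: "0 < N" using False t by auto
  have "indep_vars (\<lambda>_. \<Pi>\<^sub>M t\<in>{0..}. borel) (\<lambda>i \<omega>. \<lambda>t\<in>{0..}. W i t \<omega>) UNIV"
    using W by (simp add: independent_wiener_processes_def)
  then have "indep_vars (\<lambda>_. borel) (\<lambda>i \<omega>. (\<lambda>p. p t - p 0) (\<lambda>t\<in>{0..}. W i t \<omega>)) UNIV"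
    by (rule indep_vars_compose2)
      (use t in \<open>intro borel_measurable_diff measurable_component_singleton; simp\<close>)
  then have "indep_vars (\<lambda>_. borel) (\<lambda>i \<omega>. W i t \<omega> - W i 0 \<omega>) UNIV"
    using t by simp
  then have ind: "indep_vars (\<lambda>_. borel) (\<lambda>i \<omega>. W i t \<omega> - W i 0 \<omega>) {1..N}"
    by (rule indep_vars_subset) simp
  have nd: "distributed M lborel (\<lambda>\<omega>. W i t \<omega> - W i 0 \<omega>) (normal_density 0 (sqrt t))" for i
  proof -
    have "\<forall>s t. 0 \<le> s \<and> s < t \<longrightarrow>
        distributed M lborel (\<lambda>\<omega>. W i t \<omega> - W i s \<omega>) (normal_density 0 (sqrt (t - s)))"
      using W by (simp add: independent_wiener_processes_def wiener_process_def)
    from this[rule_format, of 0 t] t0 show ?thesis by simp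
  qed
  have D: "distributed M lborel ?S (normal_density 0 ?\<sigma>)"
    using sum_indep_normal[of "{1..N}" "\<lambda>i \<omega>. W i t \<omega> - W i 0 \<omega>" "\<lambda>_. sqrt t" "\<lambda>_. 0"] ind nd t0 N
    by simp
  have \<sigma>: "?\<sigma>\<^sup>2 = real N * t" using t0 by simp
  have "(\<integral>\<^sup>+\<omega>. ennreal ((noise_mean W N t \<omega>)^4) \<partial>M)
      = (\<integral>\<^sup>+x. ennreal (normal_density 0 ?\<sigma> x) * ennreal (((1 / real N) * x)^4) \<partial>lborel)"
    unfolding noise_mean_def by (rule distributed_nn_integral[OF D, symmetric]) measurable
  also have "\<dots> = (\<integral>\<^sup>+x. ennreal ((1 / real N)^4 * (normal_density 0 ?\<sigma> x * (x - 0)^(2 * 2))) \<partial>lborel)"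
    by (intro nn_integral_cong)
      (simp add: ennreal_mult[symmetric] normal_density_nonneg power_divide ac_simps)
  \<comment> \<open>The general formula for even normal moments; at order 4 it amounts to three
    times the squared variance.\<close>
  also have "\<dots> = ennreal ((1 / real N)^4 * (fact (2 * 2) / ((2 / ?\<sigma>\<^sup>2)^2 * fact 2)))"
  proof -
    have "has_bochner_integral lborel (\<lambda>x. normal_density 0 ?\<sigma> x * (x - 0)^(2 * 2))
        (fact (2 * 2) / ((2 / ?\<sigma>\<^sup>2)^2 * fact 2))"
      by (rule normal_moment_even) (use t0 N in simp)
    then show ?thesis
      by (subst nn_integral_eq_integral)
        (auto simp: has_bochner_integral_iff normal_density_nonneg)
  qed
  also have "(1 / real N)^4 * (fact (2 * 2) / ((2 / ?\<sigma>\<^sup>2)^2 * fact 2)) = 3 * t\<^sup>2 / (real N)\<^sup>2"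
    unfolding \<sigma> using N t0 by (simp add: field_simps fact_numeral eval_nat_numeral)
  finally show ?thesis by simp
qed (auto simp: noise_mean_def)

text \<open>The whole series is integrated at once: its expectation is finite, so it converges
  almost surely and its terms tend to 0. The finiteness clause rules out the value 0 that
  \<open>enn2real\<close> takes at infinity, which would make the limit meaningless.\<close>

lemma AE_tendsto_0_if_summable:
  fixes Z :: "nat \<Rightarrow> 'a \<Rightarrow> ennreal"
  assumes Z: "\<And>n. Z n \<in> borel_measurable M" and le: "\<And>n. (\<integral>\<^sup>+\<omega>. Z n \<omega> \<partial>M) \<le> ennreal (k n)"
    and k: "\<And>n. 0 \<le> k n" "summable k"
  shows "AE \<omega> in M. (\<lambda>n. enn2real (Z n \<omega>)) \<longlonglongrightarrow> 0 \<and> (\<forall>n. Z n \<omega> < \<infinity>)"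
proof -
  have "(\<integral>\<^sup>+\<omega>. (\<Sum>n. Z n \<omega>) \<partial>M) = (\<Sum>n. \<integral>\<^sup>+\<omega>. Z n \<omega> \<partial>M)"
    using Z by (rule nn_integral_suminf)
  also have "\<dots> \<le> (\<Sum>n. ennreal (k n))"
    by (intro suminf_le le) auto
  also have "\<dots> = ennreal (\<Sum>n. k n)" by (rule suminf_ennreal2[OF k])
  finally have "(\<integral>\<^sup>+\<omega>. (\<Sum>n. Z n \<omega>) \<partial>M) \<noteq> \<infinity>" by (auto simp: top_unique)
  then have "AE \<omega> in M. (\<Sum>n. Z n \<omega>) \<noteq> \<infinity>"
    by (intro nn_integral_PInf_AE) (use Z in measurable)
  then show ?thesis
  proof eventually_elim
    case (elim \<omega>)
    have fin: "Z n \<omega> < top" for n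
      by (rule ennreal_suminf_lessD[of "\<lambda>n. Z n \<omega>"]) (use elim in \<open>simp add: less_top\<close>)
    then have "(\<Sum>n. ennreal (enn2real (Z n \<omega>))) \<noteq> top" using elim by simp
    then have "summable (\<lambda>n. enn2real (Z n \<omega>))" by (intro summable_suminf_not_top) auto
    with fin show ?case by (auto dest: summable_LIMSEQ_zero)
  qed
qed

lemma noise_mean_measurable:
  "independent_wiener_processes M W \<Longrightarrow> 0 \<le> t \<Longrightarrow> noise_mean W N t \<in> borel_measurable M"
  unfolding noise_mean_def[abs_def]
  by (intro borel_measurable_times borel_measurable_sum borel_measurable_diff borel_measurable_const
      wiener_measurable) auto

lemma summable_noise_bound: "summable (\<lambda>N. C / (real N)\<^sup>2)"
  using summable_mult[OF inverse_power_summable[of 2, where 'a = real], of C]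
  by (simp add: divide_inverse power_inverse)

lemma noise_mean_tendsto_0:
  assumes "prob_space M" and W: "independent_wiener_processes M W" and t: "0 \<le> t"
  shows "AE \<omega> in M. (\<lambda>N. noise_mean W N t \<omega>) \<longlonglongrightarrow> 0"
proof -
  note [measurable] = noise_mean_measurable[OF W t]
  have "AE \<omega> in M. (\<lambda>N. enn2real (ennreal ((noise_mean W N t \<omega>)^4))) \<longlonglongrightarrow> 0
      \<and> (\<forall>N. ennreal ((noise_mean W N t \<omega>)^4) < \<infinity>)"
    by (rule AE_tendsto_0_if_summable[OF _ noise_mean_moment4[OF assms] _ summable_noise_bound]) auto
  then show ?thesis
  proof eventually_elim
    case (elim \<omega>)
    then have "(\<lambda>N. (noise_mean W N t \<omega>)^4) \<longlonglongrightarrow> 0" by simp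
    then have "(\<lambda>N. root 4 ((noise_mean W N t \<omega>)^4)) \<longlonglongrightarrow> root 4 0"
      by (rule tendsto_real_root)
    moreover have "root 4 (x ^ 4) = \<bar>x\<bar>" for x :: real
      using real_root_power_cancel[of 4 "\<bar>x\<bar>"] by simp
    ultimately show ?case by (simp add: tendsto_rabs_zero_iff)
  qed
qed

text \<open>A Wiener process is given as measurable at each time with almost surely continuous
  paths, whereas Fubini's theorem needs measurability in time and sample jointly. Setting the
  process to zero on a null set makes every remaining path continuous, hence a limit of paths frozen
  on finer and finer grids.\<close>

lemma jointly_measurable_modification:
  fixes W :: "'a process"
  assumes W: "\<And>t. 0 \<le> t \<Longrightarrow> W t \<in> borel_measurable M"
    and cont: "AE \<omega> in M. continuous_on {0..} (\<lambda>t. W t \<omega>)"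
  obtains V where "(\<lambda>(s, \<omega>). V s \<omega>) \<in> borel_measurable (borel \<Otimes>\<^sub>M M)"
    and "AE \<omega> in M. \<forall>t\<ge>0. V t \<omega> = W t \<omega>"
proof -
  obtain N where N: "N \<in> sets M" "emeasure M N = 0"
    "{\<omega>\<in>space M. \<not> continuous_on {0..} (\<lambda>t. W t \<omega>)} \<subseteq> N"
    using cont by (auto elim!: AE_E)
  define V where "V = (\<lambda>s \<omega>. indicator (space M - N) \<omega> * W (max 0 s) \<omega>)"
  define g where "g n s = \<lfloor>real (Suc n) * s\<rfloor>" for n and s :: real
  \<comment> \<open>The time argument takes countably many values, which gives joint measurability.
    \<open>Suc n\<close> avoids a zero mesh denominator, and \<open>max 0\<close> keeps the argument
    where the process is measurable and continuous.\<close>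
  define Vn where "Vn n s \<omega> = indicator (space M - N) \<omega> * W (max 0 (of_int (g n s) / real (Suc n))) \<omega>" for n s \<omega>
  have "(\<lambda>p. Vn n (fst p) (snd p)) \<in> borel_measurable (borel \<Otimes>\<^sub>M M)" for n
  proof -
    have [measurable]: "W (max 0 s) \<in> borel_measurable M" for s by (rule W) simp
    have 1: "(\<lambda>p. indicator (space M - N) (snd p) * W (max 0 (of_int i / real (Suc n))) (snd p))
        \<in> borel_measurable (borel \<Otimes>\<^sub>M M)" for i :: int
      using N(1) by measurable
    have 2: "(\<lambda>p. g n (fst p)) \<in> borel \<Otimes>\<^sub>M M \<rightarrow>\<^sub>M count_space UNIV"
      unfolding g_def by measurable
    show ?thesis
      unfolding Vn_def using measurable_compose_countable[OF 1 2] .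
  qed
  moreover have "(\<lambda>n. Vn n (fst p) (snd p)) \<longlonglongrightarrow> V (fst p) (snd p)" if "p \<in> space (borel \<Otimes>\<^sub>M M)" for p
  proof (cases "snd p \<in> space M - N")
    case True
    then have c: "continuous_on {0..} (\<lambda>t. W t (snd p))" using N(3) by auto
    have "(\<lambda>n. of_int (g n (fst p)) / real (Suc n)) \<longlonglongrightarrow> fst p"
    proof (rule LIM_zero_cancel, rule Lim_null_comparison[OF _ lim_inverse_n'[THEN LIMSEQ_Suc]], intro always_eventually allI)
      fix n
      have "\<bar>of_int (g n (fst p)) - real (Suc n) * fst p\<bar> \<le> 1"
        unfolding g_def by linarith
      then have "\<bar>of_int (g n (fst p)) - real (Suc n) * fst p\<bar> / real (Suc n) \<le> 1 / real (Suc n)"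
        by (rule divide_right_mono) simp
      moreover have "of_int (g n (fst p)) / real (Suc n) - fst p
          = (of_int (g n (fst p)) - real (Suc n) * fst p) / real (Suc n)"
        by (simp add: field_simps)
      ultimately show "norm (of_int (g n (fst p)) / real (Suc n) - fst p) \<le> 1 / real (Suc n)"
        by (simp only: real_norm_def abs_divide abs_of_nat)
    qed
    then have "(\<lambda>n. max 0 (of_int (g n (fst p)) / real (Suc n))) \<longlonglongrightarrow> max 0 (fst p)"
      by (intro tendsto_intros)
    then have "(\<lambda>n. W (max 0 (of_int (g n (fst p)) / real (Suc n))) (snd p)) \<longlonglongrightarrow> W (max 0 (fst p)) (snd p)"
      by (rule continuous_on_tendsto_compose[OF c]) auto
    then show ?thesis using True by (simp add: V_def Vn_def)
  qed (simp add: V_def Vn_def)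
  ultimately have "(\<lambda>p. V (fst p) (snd p)) \<in> borel_measurable (borel \<Otimes>\<^sub>M M)"
    by (rule borel_measurable_LIMSEQ_real[rotated])
  moreover have "AE \<omega> in M. \<omega> \<notin> N" using N by (intro AE_not_in) auto
  then have "AE \<omega> in M. \<forall>t\<ge>0. V t \<omega> = W t \<omega>"
    using AE_space by eventually_elim (simp add: V_def)
  ultimately show ?thesis using that by (simp add: split_def)
qed

text \<open>Almost sure convergence at each fixed time gives no domination along a path, so the
  integral in Gronwall's bound needs its own argument. The time integral of the fourth power again
  has expectations summable in \<open>N\<close>, and it controls the integral of the absolute
  value.\<close>

lemma noise_mean_integral_tendsto_0:
  assumes "prob_space M" and W: "independent_wiener_processes M W" and T: "0 \<le> T"
  shows "AE \<omega> in M. (\<lambda>N. integral {0..T} (\<lambda>s. \<bar>noise_mean W N s \<omega>\<bar>)) \<longlonglongrightarrow> 0"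
proof -
  interpret prob_space M by fact
  let ?L = "restrict_space lborel {0..T}"
  interpret pair_sigma_finite ?L M using pair_sigma_finite_restrict_lborel[OF \<open>prob_space M\<close>] .
  have cont: "AE \<omega> in M. continuous_on {0..} (\<lambda>t. W i t \<omega>)" for i
    using W by (simp add: independent_wiener_processes_def wiener_process_def)
  have "\<exists>V. (\<lambda>(s, \<omega>). V s \<omega>) \<in> borel_measurable (borel \<Otimes>\<^sub>M M) \<and> (AE \<omega> in M. \<forall>t\<ge>0. V t \<omega> = W i t \<omega>)" for i
    by (rule jointly_measurable_modification[OF wiener_measurable[OF W] cont[of i]]) blast+
  from choice[OF allI, OF this]
  obtain V where VV: "\<forall>i. (\<lambda>(s, \<omega>). V i s \<omega>) \<in> borel_measurable (borel \<Otimes>\<^sub>M M)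
      \<and> (AE \<omega> in M. \<forall>t\<ge>0. V i t \<omega> = W i t \<omega>)" ..
  note V = VV[rule_format, THEN conjunct1] and VW = VV[rule_format, THEN conjunct2]
  have VW': "AE \<omega> in M. \<forall>i. \<forall>t\<ge>0. V i t \<omega> = W i t \<omega>" using VW by (simp add: AE_all_countable)
  have cont': "AE \<omega> in M. \<forall>i. continuous_on {0..} (\<lambda>t. W i t \<omega>)" using cont by (simp add: AE_all_countable)
  have [measurable]: "(\<lambda>p. V i (fst p) (snd p)) \<in> borel_measurable (?L \<Otimes>\<^sub>M M)" for i
  proof -
    have "(\<lambda>p. (fst p, snd p)) \<in> ?L \<Otimes>\<^sub>M M \<rightarrow>\<^sub>M borel \<Otimes>\<^sub>M M"
      by (intro measurable_Pair measurable_snd measurable_compose[OF measurable_fst] measurable_restrict_space1) simp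
    from measurable_compose[OF this V[of i]] show ?thesis by (simp add: split_def)
  qed
  have [measurable]: "V i 0 \<in> borel_measurable M" for i
    using measurable_compose[OF measurable_Pair1'[of "0::real" borel M] V[of i]] by simp
  \<comment> \<open>Formed with the modifications \<open>V\<close>, so that it is a random variable
    and Fubini applies; on almost every path it agrees with the integral of the original
    noise.\<close>
  define Z where "Z N \<omega> = (\<integral>\<^sup>+s. ennreal ((noise_mean V N s \<omega>)^4) \<partial>?L)" for N \<omega>
  have [measurable]: "(\<lambda>p. noise_mean V N (fst p) (snd p)) \<in> borel_measurable (?L \<Otimes>\<^sub>M M)" for N
    unfolding noise_mean_def by measurable
  have m: "(\<lambda>(s, \<omega>). ennreal ((noise_mean V N s \<omega>)^4)) \<in> borel_measurable (?L \<Otimes>\<^sub>M M)" for N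
    unfolding split_def by measurable
  have mZ: "Z N \<in> borel_measurable M" for N
    unfolding Z_def[abs_def] using M1.borel_measurable_nn_integral[of "\<lambda>\<omega> s. ennreal ((noise_mean V N s \<omega>)^4)" M]
      measurable_compose[OF measurable_pair_swap'[of M ?L] m[of N]] by (simp add: split_def)
  have bZ: "(\<integral>\<^sup>+\<omega>. Z N \<omega> \<partial>M) \<le> ennreal (3 * T^3 / (real N)\<^sup>2)" for N
  proof -
    have "(\<integral>\<^sup>+\<omega>. Z N \<omega> \<partial>M) = (\<integral>\<^sup>+s. \<integral>\<^sup>+\<omega>. ennreal ((noise_mean V N s \<omega>)^4) \<partial>M \<partial>?L)"
      unfolding Z_def by (rule Fubini'[OF m])
    also have "\<dots> \<le> (\<integral>\<^sup>+s. ennreal (3 * T\<^sup>2 / (real N)\<^sup>2) \<partial>?L)"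
    proof (rule nn_integral_mono)
      fix s assume "s \<in> space ?L"
      then have s: "0 \<le> s" "s \<le> T" by (auto simp: space_restrict_space)
      have "(\<integral>\<^sup>+\<omega>. ennreal ((noise_mean V N s \<omega>)^4) \<partial>M) = (\<integral>\<^sup>+\<omega>. ennreal ((noise_mean W N s \<omega>)^4) \<partial>M)"
        by (rule nn_integral_cong_AE) (use VW' in eventually_elim, use s in \<open>simp add: noise_mean_def\<close>)
      also have "\<dots> \<le> ennreal (3 * s\<^sup>2 / (real N)\<^sup>2)"
        by (rule noise_mean_moment4[OF \<open>prob_space M\<close> W s(1)])
      also have "\<dots> \<le> ennreal (3 * T\<^sup>2 / (real N)\<^sup>2)"
        using s by (intro ennreal_leI divide_right_mono mult_left_mono power_mono) auto
      finally show "(\<integral>\<^sup>+\<omega>. ennreal ((noise_mean V N s \<omega>)^4) \<partial>M) \<le> ennreal (3 * T\<^sup>2 / (real N)\<^sup>2)" .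
    qed
    also have "\<dots> = ennreal (3 * T^3 / (real N)\<^sup>2)"
      using T by (simp add: emeasure_restrict_space space_restrict_space ennreal_mult[symmetric]
          power2_eq_square power3_eq_cube ac_simps)
    finally show ?thesis .
  qed
  have "AE \<omega> in M. (\<lambda>n. enn2real (Z n \<omega>)) \<longlonglongrightarrow> 0 \<and> (\<forall>n. Z n \<omega> < \<infinity>)"
    by (rule AE_tendsto_0_if_summable[OF mZ bZ _ summable_noise_bound]) (use T in auto)
  then show ?thesis
    using VW' cont'
  proof eventually_elim
    case (elim \<omega>)
    let ?g = "\<lambda>N s. noise_mean W N s \<omega>"
    have cg: "continuous_on {0..T} (?g N)" for N
      unfolding noise_mean_def using elim(3)
      by (intro continuous_intros) (auto intro: continuous_on_subset)
    have Zi: "enn2real (Z N \<omega>) = integral {0..T} (\<lambda>s. (?g N s)^4)" for N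
    proof -
      have si: "set_integrable lborel {0..T} (\<lambda>s. (?g N s)^4)"
        by (rule borel_integrable_atLeastAtMost') (intro continuous_intros cg)
      have "Z N \<omega> = (\<integral>\<^sup>+s. ennreal ((?g N s)^4) \<partial>?L)"
        unfolding Z_def using elim(2)
        by (intro nn_integral_cong) (auto simp: space_restrict_space noise_mean_def)
      also have "\<dots> = (\<integral>\<^sup>+s. ennreal (indicator {0..T} s *\<^sub>R (?g N s)^4) \<partial>lborel)"
        by (subst nn_integral_restrict_space) (auto intro!: nn_integral_cong simp: indicator_def)
      also have "\<dots> = ennreal (LINT s:{0..T}|lborel. (?g N s)^4)"
        using si unfolding set_integrable_def set_lebesgue_integral_def
        by (intro nn_integral_eq_integral) auto
      finally have "enn2real (Z N \<omega>) = (LINT s:{0..T}|lborel. (?g N s)^4)"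
        by (simp add: set_lebesgue_integral_def integral_nonneg_AE)
      then show ?thesis using set_borel_integral_eq_integral(2)[OF si] by simp
    qed
    have lim: "(\<lambda>N. integral {0..T} (\<lambda>s. (?g N s)^4)) \<longlonglongrightarrow> 0"
      using elim(1) by (simp add: Zi)
    \<comment> \<open>Splitting at the level \<open>e\<close> passes from the fourth power to the
      first: values above \<open>e\<close> satisfy \<open>x * e^3 \<le> x^4\<close>, the others are
      at most \<open>e\<close>.\<close>
    have young: "x \<le> e + x^4 / e^3" if "0 < e" "0 \<le> x" for e x :: real
    proof (cases "x \<le> e")
      case False
      then have "e^3 \<le> x^3" using that by (intro power_mono) auto
      then have "x * e^3 \<le> x * x^3" using that by (intro mult_left_mono) auto
      then have "x \<le> x^4 / e^3" using that by (simp add: field_simps eval_nat_numeral)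
      then show ?thesis using that by simp
    qed (use that in \<open>simp add: add_increasing2\<close>)
    have bound: "integral {0..T} (\<lambda>s. \<bar>?g N s\<bar>) \<le> e * T + integral {0..T} (\<lambda>s. (?g N s)^4) / e^3"
      if e: "0 < e" for e N
    proof -
      have i: "(\<lambda>s. (?g N s)^4 / e^3) integrable_on {0..T}"
        using e by (intro integrable_continuous_real continuous_intros cg) auto
      have "integral {0..T} (\<lambda>s. \<bar>?g N s\<bar>) \<le> integral {0..T} (\<lambda>s. e + (?g N s)^4 / e^3)"
        using young[OF e, of "\<bar>?g N s\<bar>" for s] i e
        by (intro integral_le integrable_continuous_real continuous_intros cg integrable_add) auto
      also have "\<dots> = e * T + integral {0..T} (\<lambda>s. (?g N s)^4) / e^3"
        using T i by (subst Henstock_Kurzweil_Integration.integral_add) auto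
      finally show ?thesis .
    qed
    show ?case
    proof (rule LIMSEQ_I)
      fix r :: real assume r: "0 < r"
      \<comment> \<open>Makes the level contribute less than \<open>r / 2\<close> over the whole
        interval; \<open>T + 1\<close> keeps the denominator positive when the interval is a single
        point.\<close>
      define e where "e = r / (2 * (T + 1))"
      have e: "0 < e" "e * T < r / 2"
        using r T by (simp_all add: e_def field_simps)
      have "(\<lambda>N. integral {0..T} (\<lambda>s. (?g N s)^4) / e^3) \<longlonglongrightarrow> 0 / e^3"
        by (intro tendsto_divide lim tendsto_const) (use e in auto)
      then have "\<forall>\<^sub>F N in sequentially. integral {0..T} (\<lambda>s. (?g N s)^4) / e^3 < r / 2"
        using r by (intro order_tendstoD) auto
      then obtain n0 where n0: "\<And>N. n0 \<le> N \<Longrightarrow> integral {0..T} (\<lambda>s. (?g N s)^4) / e^3 < r / 2"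
        by (auto simp: eventually_sequentially)
      have "norm (integral {0..T} (\<lambda>s. \<bar>?g N s\<bar>) - 0) < r" if "n0 \<le> N" for N
      proof -
        have "0 \<le> integral {0..T} (\<lambda>s. \<bar>?g N s\<bar>)"
          by (intro integral_nonneg integrable_continuous_real continuous_intros cg) auto
        then show ?thesis using bound[OF e(1), of N] n0[OF that] e(2) unfolding real_norm_def by linarith
      qed
      then show "\<exists>no. \<forall>n\<ge>no. norm (integral {0..T} (\<lambda>s. \<bar>?g n s\<bar>) - 0) < r" by blast
    qed
  qed
qed

section \<open>The finite-player and limiting systems\<close>

lemma adapted_joint:
  assumes "prob_space M" and W: "independent_wiener_processes M W" and "0 < T"
    and H: "square_integrable_progressive M (natural_filtration M (W ` J)) T H"
  shows "jointly_integrable M T H"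
    and "t \<in> {0..T} \<Longrightarrow> H t \<in> borel_measurable (natural_filtration M (W ` J) t)"
proof -
  show "jointly_integrable M T H"
    using square_integrable_progressive_jointly_integrable[OF assms(1) subalgebra_wiener_filtration[OF W] _ H]
      \<open>0 < T\<close> by simp
  show "t \<in> {0..T} \<Longrightarrow> H t \<in> borel_measurable (natural_filtration M (W ` J) t)"
    using H progressive_adapted[of "natural_filtration M (W ` J)" T H t]
    by (simp add: square_integrable_progressive_def)
qed

lemma limiting_system_fbsde:
  fixes W :: "nat \<Rightarrow> 'a process"
  assumes "prob_space M" "0 < T" and W: "independent_wiener_processes M W"
    and sys: "limiting_system M (W 0) Wlim T a b c q D0 D x00 x0 X0 Xlim Xbar P0bar Pbar Q00 Q10"
  shows "\<exists>H0 H1. lq_fbsde M (natural_filtration M (W ` {0})) T a b c q x00 x0 X0 Xbar P0bar Pbar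
    (\<lambda>t \<omega>. D0 * (W 0 t \<omega> - W 0 0 \<omega>)) (\<lambda>t \<omega>. 0 * (W 0 t \<omega> - W 0 0 \<omega>)) H0 H1"
proof -
  interpret prob_space M by fact
  let ?F = "natural_filtration M (W ` {0})"
  have F: "natural_filtration M {W 0} = ?F" by simp
  note sys' = sys[unfolded limiting_system_def Let_def F forward_equation_def]
  from sys' have X0: "square_integrable_progressive M ?F T X0"
    and Xbar: "square_integrable_progressive M ?F T Xbar"
    and X0_eq: "AE \<omega> in M. \<forall>t\<in>{0..T}. X0 t \<omega> = x00
        + (LINT s:{0..t}|lborel. a * Xbar s \<omega> - 1 / 2 * b\<^sup>2 * P0bar s \<omega>) + D0 * (W 0 t \<omega> - W 0 0 \<omega>)"
    and Xbar_eq: "AE \<omega> in M. \<forall>t\<in>{0..T}. Xbar t \<omega>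
        = x0 + (LINT s:{0..t}|lborel. c * X0 s \<omega>) + 0 * (W 0 t \<omega> - W 0 0 \<omega>)"
    and B0: "backward_equation M ?F T {()} (\<lambda>_. W 0) (\<lambda>t \<omega>. 2 * q * X0 t \<omega> + c * Pbar t \<omega>) P0bar (\<lambda>_. Q00)"
    and B1: "backward_equation M ?F T {()} (\<lambda>_. W 0) (\<lambda>t \<omega>. a * P0bar t \<omega>) Pbar (\<lambda>_. Q10)"
    by blast+
  from B0 obtain I0 where P0: "square_integrable_progressive M ?F T P0bar"
    and I0: "is_ito_integral M ?F T (W 0) Q00 (I0 ())"
    and P0_eq: "AE \<omega> in M. \<forall>t\<in>{0..T}. P0bar t \<omega>
        = (LINT s:{t..T}|lborel. c * Pbar s \<omega> + 2 * q * X0 s \<omega>) - (I0 () T \<omega> - I0 () t \<omega>)"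
    unfolding backward_equation_def by (auto simp: add.commute)
  from B1 obtain I1 where P1: "square_integrable_progressive M ?F T Pbar"
    and I1: "is_ito_integral M ?F T (W 0) Q10 (I1 ())"
    and P1_eq: "AE \<omega> in M. \<forall>t\<in>{0..T}. Pbar t \<omega>
        = (LINT s:{t..T}|lborel. a * P0bar s \<omega>) - (I1 () T \<omega> - I1 () t \<omega>)"
    unfolding backward_equation_def by auto
  note aj = adapted_joint[OF assms(1) W assms(2)]
  have "lq_fbsde M ?F T a b c q x00 x0 X0 Xbar P0bar Pbar
    (\<lambda>t \<omega>. D0 * (W 0 t \<omega> - W 0 0 \<omega>)) (\<lambda>t \<omega>. 0 * (W 0 t \<omega> - W 0 0 \<omega>)) (I0 ()) (I1 ())"
    by unfold_locales
      (fact subalgebra_wiener_filtration[OF W] natural_filtration_mono[OF _ order_refl]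
        aj[OF X0] aj[OF Xbar] aj[OF P0] aj[OF P1] X0_eq Xbar_eq P0_eq P1_eq
        centred_increments_mult[OF wiener_centred_increments[OF assms(1) W]]
        ito_integral_centred_increments[OF assms(1) W I0]
        ito_integral_centred_increments[OF assms(1) W I1])+
  then show ?thesis by blast
qed

text \<open>Averaging the minor states and summing their adjoints closes the system in four
  processes: the drifts \<open>a / real N\<close> of the minor adjoint equations add up to
  \<open>a\<close>. No conditioning takes place here; the decoupling is carried out in the
  filtration of all the noises \<open>W 0\<close> to \<open>W N\<close>.\<close>

lemma finite_player_system_fbsde:
  fixes W :: "nat \<Rightarrow> 'a process"
  assumes "prob_space M" "0 < T" and W: "independent_wiener_processes M W" and N: "1 \<le> N"
    and sys: "finite_player_system M W T a b c q D0 D x00 x0 N X Y Z"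
  shows "\<exists>H0 H1. lq_fbsde M (natural_filtration M (W ` {0..N})) T a b c q x00 x0
    (X 0) (empirical_mean N X) (Y 0) (aggregate N Y)
    (\<lambda>t \<omega>. D0 * (W 0 t \<omega> - W 0 0 \<omega>)) (\<lambda>t \<omega>. D * noise_mean W N t \<omega>) H0 H1"
proof -
  interpret prob_space M by fact
  let ?F = "natural_filtration M (W ` {0..N})"
  note sys' = sys[unfolded finite_player_system_def Let_def forward_equation_def]
  from sys' have X0: "square_integrable_progressive M ?F T (X 0)"
    and Xi: "\<And>i. i \<in> {1..N} \<Longrightarrow> square_integrable_progressive M ?F T (X i)"
    and X0_eq: "AE \<omega> in M. \<forall>t\<in>{0..T}. X 0 t \<omega> = x00
        + (LINT s:{0..t}|lborel. a * empirical_mean N X s \<omega> - 1 / 2 * b\<^sup>2 * Y 0 s \<omega>)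
        + D0 * (W 0 t \<omega> - W 0 0 \<omega>)"
    and Xi_eq: "\<And>i. i \<in> {1..N} \<Longrightarrow> AE \<omega> in M. \<forall>t\<in>{0..T}. X i t \<omega>
        = x0 + (LINT s:{0..t}|lborel. c * X 0 s \<omega>) + D * (W i t \<omega> - W i 0 \<omega>)"
    and B0: "backward_equation M ?F T {0..N} W (\<lambda>t \<omega>. c * aggregate N Y t \<omega> + 2 * q * X 0 t \<omega>) (Y 0) (Z 0)"
    and Bi: "\<And>i. i \<in> {1..N} \<Longrightarrow>
        backward_equation M ?F T {0..N} W (\<lambda>t \<omega>. (a / real N) * Y 0 t \<omega>) (Y i) (Z i)"
    by blast+
  from B0 obtain I0 where Y0: "square_integrable_progressive M ?F T (Y 0)"
    and I0: "\<And>j. j \<in> {0..N} \<Longrightarrow> is_ito_integral M ?F T (W j) (Z 0 j) (I0 j)"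
    and Y0_eq: "AE \<omega> in M. \<forall>t\<in>{0..T}. Y 0 t \<omega>
        = (LINT s:{t..T}|lborel. c * aggregate N Y s \<omega> + 2 * q * X 0 s \<omega>)
          - (\<Sum>j\<in>{0..N}. I0 j T \<omega> - I0 j t \<omega>)"
    unfolding backward_equation_def by blast
  \<comment> \<open>Stochastic integrals are given by a relation, so a version has to be fixed for
    each pair of indices before the minor equations can be summed.\<close>
  have "\<forall>i\<in>{1..N}. \<exists>I. (\<forall>j\<in>{0..N}. is_ito_integral M ?F T (W j) (Z i j) (I j)) \<and>
      (AE \<omega> in M. \<forall>t\<in>{0..T}. Y i t \<omega> = (LINT s:{t..T}|lborel. (a / real N) * Y 0 s \<omega>)
          - (\<Sum>j\<in>{0..N}. I j T \<omega> - I j t \<omega>))"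
    using Bi unfolding backward_equation_def by blast
  from bchoice[OF this] obtain I where I: "\<And>i j. i \<in> {1..N} \<Longrightarrow> j \<in> {0..N} \<Longrightarrow>
      is_ito_integral M ?F T (W j) (Z i j) (I i j)"
    and Yi_eq: "\<And>i. i \<in> {1..N} \<Longrightarrow> AE \<omega> in M. \<forall>t\<in>{0..T}. Y i t \<omega>
        = (LINT s:{t..T}|lborel. (a / real N) * Y 0 s \<omega>) - (\<Sum>j\<in>{0..N}. I i j T \<omega> - I i j t \<omega>)"
    by blast
  have Yi: "\<And>i. i \<in> {1..N} \<Longrightarrow> square_integrable_progressive M ?F T (Y i)"
    using Bi by (simp add: backward_equation_def)
  define H0 where "H0 = (\<lambda>t \<omega>. \<Sum>j\<in>{0..N}. I0 j t \<omega>)"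
  define H1 where "H1 = (\<lambda>t \<omega>. \<Sum>i\<in>{1..N}. \<Sum>j\<in>{0..N}. I i j t \<omega>)"
  note aj = adapted_joint[OF assms(1) W assms(2)]
  note sub = subalgebra_wiener_filtration[OF W]
  note ito = ito_integral_centred_increments[OF assms(1) W]
  have cH: "centred_increments M ?F T H0" "centred_increments M ?F T H1"
    unfolding H0_def H1_def by (intro centred_increments_sum sub ito[OF I0] ito[OF I]; assumption)+
  have cG: "centred_increments M ?F T (\<lambda>t \<omega>. D * noise_mean W N t \<omega>)"
    unfolding noise_mean_def
    by (intro centred_increments_mult centred_increments_sum sub wiener_centred_increments[OF assms(1) W])
  have jX: "jointly_integrable M T (empirical_mean N X)"
    unfolding empirical_mean_def[abs_def]
    by (intro jointly_integrable_mult jointly_integrable_sum aj(1)[OF Xi])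
  have jY: "jointly_integrable M T (aggregate N Y)"
    unfolding aggregate_def[abs_def] by (intro jointly_integrable_sum aj(1)[OF Yi])
  have aX: "empirical_mean N X t \<in> borel_measurable (?F t)" if "t \<in> {0..T}" for t
    unfolding empirical_mean_def[abs_def]
    by (intro borel_measurable_times borel_measurable_sum borel_measurable_const aj(2)[OF Xi that])
  have aY: "aggregate N Y t \<in> borel_measurable (?F t)" if "t \<in> {0..T}" for t
    unfolding aggregate_def[abs_def]
    by (intro borel_measurable_sum aj(2)[OF Yi that])
  have "AE \<omega> in M. \<forall>i\<in>{1..N}. \<forall>t\<in>{0..T}. X i t \<omega>
        = x0 + (LINT s:{0..t}|lborel. c * X 0 s \<omega>) + D * (W i t \<omega> - W i 0 \<omega>)"
    by (rule AE_finite_allI[OF finite_atLeastAtMost Xi_eq])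
  then have X1_eq: "AE \<omega> in M. \<forall>t\<in>{0..T}. empirical_mean N X t \<omega>
        = x0 + (LINT s:{0..t}|lborel. c * X 0 s \<omega>) + D * noise_mean W N t \<omega>"
  proof eventually_elim
    case (elim \<omega>)
    show ?case
    proof
      fix t assume t: "t \<in> {0..T}"
      let ?L = "LINT s:{0..t}|lborel. c * X 0 s \<omega>"
      have "(\<Sum>i=1..N. X i t \<omega>) = (\<Sum>i=1..N. x0 + ?L + D * (W i t \<omega> - W i 0 \<omega>))"
        using elim t by (intro sum.cong) auto
      also have "\<dots> = real N * (x0 + ?L) + D * (\<Sum>i=1..N. W i t \<omega> - W i 0 \<omega>)"
        by (simp add: sum.distrib sum_distrib_left)
      finally show "empirical_mean N X t \<omega> = x0 + ?L + D * noise_mean W N t \<omega>"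
        unfolding empirical_mean_def noise_mean_def using N by (simp add: field_simps)
    qed
  qed
  have "AE \<omega> in M. \<forall>i\<in>{1..N}. \<forall>t\<in>{0..T}. Y i t \<omega>
        = (LINT s:{t..T}|lborel. (a / real N) * Y 0 s \<omega>) - (\<Sum>j\<in>{0..N}. I i j T \<omega> - I i j t \<omega>)"
    by (rule AE_finite_allI[OF finite_atLeastAtMost Yi_eq])
  then have Y1_eq: "AE \<omega> in M. \<forall>t\<in>{0..T}. aggregate N Y t \<omega>
        = (LINT s:{t..T}|lborel. a * Y 0 s \<omega>) - (H1 T \<omega> - H1 t \<omega>)"
    by eventually_elim (use N in \<open>simp add: aggregate_def H1_def sum_subtractf\<close>)
  have Y0_eq': "AE \<omega> in M. \<forall>t\<in>{0..T}. Y 0 t \<omega>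
        = (LINT s:{t..T}|lborel. c * aggregate N Y s \<omega> + 2 * q * X 0 s \<omega>) - (H0 T \<omega> - H0 t \<omega>)"
    using Y0_eq by (simp add: H0_def sum_subtractf)
  have "lq_fbsde M ?F T a b c q x00 x0 (X 0) (empirical_mean N X) (Y 0) (aggregate N Y)
    (\<lambda>t \<omega>. D0 * (W 0 t \<omega> - W 0 0 \<omega>)) (\<lambda>t \<omega>. D * noise_mean W N t \<omega>) H0 H1"
    by unfold_locales
      (fact sub natural_filtration_mono[OF _ order_refl]
        aj[OF X0] aj[OF Y0] jX jY aX aY X0_eq X1_eq Y0_eq' Y1_eq cG cH
        centred_increments_mult[OF wiener_centred_increments[OF assms(1) W]])+
  then show ?thesis by blast
qed

text \<open>The times \<open>s\<close> and \<open>t\<close> are unrelated: the minor noises are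
  independent of the entire path of \<open>W 0\<close>, so one event at time \<open>t\<close>
  annihilates the noise mean at all times.\<close>

lemma noise_mean_truncated_zero:
  assumes "prob_space M" and W: "independent_wiener_processes M W" and "0 \<le> s"
    and A: "A \<in> sets (natural_filtration M (W ` {0}) t)"
  shows "(\<integral>\<omega>. indicator A \<omega> * noise_mean W N s \<omega> \<partial>M) = 0"
proof -
  have AM: "A \<in> sets M" using subalgebra_sets[OF subalgebra_wiener_filtration[OF W] A] .
  have i: "integrable M (\<lambda>\<omega>. indicator A \<omega> * (W i s \<omega> - W i 0 \<omega>))" for i
    by (intro integrable_indicator_mult AM wiener_increment_integrable[OF assms(1) W order_refl \<open>0 \<le> s\<close>])
  have "(\<integral>\<omega>. indicator A \<omega> * noise_mean W N s \<omega> \<partial>M)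
      = (\<integral>\<omega>. (1 / real N) * (\<Sum>i=1..N. indicator A \<omega> * (W i s \<omega> - W i 0 \<omega>)) \<partial>M)"
    unfolding noise_mean_def mult.left_commute[of _ "1 / real N"] sum_distrib_left by (rule refl)
  also have "\<dots> = (1 / real N) * (\<Sum>i=1..N. \<integral>\<omega>. indicator A \<omega> * (W i s \<omega> - W i 0 \<omega>) \<partial>M)"
    by (simp only: integral_mult_right_zero Bochner_Integration.integral_sum[OF i])
  also have "(\<Sum>i=1..N. \<integral>\<omega>. indicator A \<omega> * (W i s \<omega> - W i 0 \<omega>) \<partial>M) = 0"
  proof (rule sum.neutral, rule ballI)
    fix i assume "i \<in> {1..N}"
    then have "i \<notin> {0}" by simp
    from other_wiener_mean_zero[OF assms(1) W order_refl \<open>0 \<le> s\<close> this borel_measurable_indicator[OF A], of 1]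
    show "(\<integral>\<omega>. indicator A \<omega> * (W i s \<omega> - W i 0 \<omega>) \<partial>M) = 0"
      by (simp add: indicator_def)
  qed
  finally show ?thesis by simp
qed

section \<open>The exponential constant and the convergence theorem\<close>

lemma one_plus_mult_exp_le:
  fixes x :: real
  assumes "0 \<le> x"
  shows "1 + x * exp x \<le> exp (2 * x)"
proof -
  have "1 + x * exp x \<le> exp x * (1 + x)" using assms by (simp add: algebra_simps)
  also have "\<dots> \<le> exp x * exp x" by (intro mult_left_mono exp_ge_add_one_self) simp
  finally show ?thesis by (simp add: exp_add[symmetric])
qed

text \<open>With \<open>m\<close> the supremum of the noise, both terms are multiples of
  \<open>k * m\<close>, with total factor \<open>1 + x * exp x\<close> for \<open>x = K * t\<close>.
  Absorbing the polynomial factor into \<open>exp (2 * x)\<close> is the origin of the doubled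
  rate.\<close>

lemma gronwall_sup_bound:
  fixes p :: "real \<Rightarrow> real"
  assumes p: "continuous_on {0..t} p" and "0 \<le> t" "0 \<le> k" "0 \<le> K"
  shows "k * \<bar>p t\<bar> + K * (exp (K * t) * integral {0..t} (\<lambda>s. k * \<bar>p s\<bar>))
    \<le> exp (2 * K * t) * k * (SUP s\<in>{0..t}. \<bar>p s\<bar>)"
proof -
  define m where "m = (SUP s\<in>{0..t}. \<bar>p s\<bar>)"
  have cont: "continuous_on {0..t} (\<lambda>s. \<bar>p s\<bar>)" using p by (intro continuous_intros)
  then have "bdd_above ((\<lambda>s. \<bar>p s\<bar>) ` {0..t})"
    by (intro bounded_imp_bdd_above compact_imp_bounded compact_continuous_image) auto
  then have m: "\<bar>p s\<bar> \<le> m" if "s \<in> {0..t}" for s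
    unfolding m_def using that by (intro cSUP_upper)
  then have m0: "0 \<le> m" using m[of 0] \<open>0 \<le> t\<close> by force
  have "integral {0..t} (\<lambda>s. k * \<bar>p s\<bar>) \<le> integral {0..t} (\<lambda>_. k * m)"
    using m \<open>0 \<le> k\<close>
    by (intro integral_le integrable_continuous_real continuous_intros cont mult_left_mono) auto
  then have "integral {0..t} (\<lambda>s. k * \<bar>p s\<bar>) \<le> t * (k * m)"
    using \<open>0 \<le> t\<close> by (simp add: ac_simps)
  then have "k * \<bar>p t\<bar> + K * (exp (K * t) * integral {0..t} (\<lambda>s. k * \<bar>p s\<bar>))
      \<le> k * m + K * (exp (K * t) * (t * (k * m)))"
    using m[of t] assms by (intro add_mono mult_left_mono) auto
  also have "\<dots> = (1 + (K * t) * exp (K * t)) * (k * m)" by (simp add: algebra_simps)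
  also have "\<dots> \<le> exp (2 * (K * t)) * (k * m)"
    using assms m0 by (intro mult_right_mono one_plus_mult_exp_le mult_nonneg_nonneg) auto
  finally show ?thesis by (simp add: m_def mult.assoc)
qed

theorem proposition6p1:
  fixes M :: "'a measure"
    and W :: "nat \<Rightarrow> 'a process" and Wlim :: "'a process"
    and T a b c q D0 D x00 x0 :: real
    and X Y :: "nat \<Rightarrow> nat \<Rightarrow> 'a process" and Z :: "nat \<Rightarrow> nat \<Rightarrow> nat \<Rightarrow> 'a process"
    and X0 Xlim Xbar P0bar Pbar Q00 Q10 :: "'a process"
    and u0N :: "nat \<Rightarrow> 'a process" and u0 :: "'a process"
  assumes "prob_space M"
    and "0 < T"
    and "independent_wiener_processes M (case_option Wlim W)"
    and "riccati_uniquely_solvable T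
           (mat22 0 a c 0) (mat22 (- (b\<^sup>2 / 2)) 0 0 0) (mat22 (2 * q) 0 0 0) (mat22 0 c a 0)"
    and "\<And>N. N \<ge> 1 \<Longrightarrow>
           finite_player_system M W T a b c q D0 D x00 x0 N (X N) (Y N) (Z N)"
    and "\<And>N t. N \<ge> 1 \<Longrightarrow> t \<in> {0..T} \<Longrightarrow>
           AE \<omega> in M. u0N N t \<omega> =
             - (b / 2) * real_cond_exp M (natural_filtration M {W 0} t) (Y N 0 t) \<omega>"
    and "limiting_system M (W 0) Wlim T a b c q D0 D x00 x0 X0 Xlim Xbar P0bar Pbar Q00 Q10"
    and "\<And>t. t \<in> {0..T} \<Longrightarrow> AE \<omega> in M. u0 t \<omega> = - (b / 2) * P0bar t \<omega>"
  shows "(\<exists>K. \<forall>N\<ge>1. AE \<omega> in M. \<forall>t\<in>{0..T}.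
            \<bar>X N 0 t \<omega> - X0 t \<omega>\<bar> + \<bar>empirical_mean N (X N) t \<omega> - Xbar t \<omega>\<bar>
              \<le> exp (K * t) * (\<bar>D\<bar> / real N) * (SUP s\<in>{0..t}. \<bar>\<Sum>i=1..N. W i s \<omega>\<bar>))
       \<and> (\<forall>t\<in>{0..T}. AE \<omega> in M.
            (\<lambda>N. X N 0 t \<omega>) \<longlonglongrightarrow> X0 t \<omega> \<and>
            (\<lambda>N. empirical_mean N (X N) t \<omega>) \<longlonglongrightarrow> Xbar t \<omega> \<and>
            (\<lambda>N. Y N 0 t \<omega>) \<longlonglongrightarrow> P0bar t \<omega> \<and>
            (\<lambda>N. aggregate N (Y N) t \<omega>) \<longlonglongrightarrow> Pbar t \<omega>)
       \<and> (\<forall>t\<in>{0..T}. AE \<omega> in M. (\<lambda>N. u0N N t \<omega>) \<longlonglongrightarrow> u0 t \<omega>)"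
proof -
  interpret prob_space M by fact
  have W: "independent_wiener_processes M W"
    using independent_wiener_reindex[OF assms(1) _ assms(3), of Some] by simp
  obtain S where S: "lq_riccati T a b c q S"
    using assms(4) unfolding riccati_uniquely_solvable_def lq_riccati_def by blast
  obtain C where C: "\<And>t i j. t \<in> {0..T} \<Longrightarrow> \<bar>S t $ i $ j\<bar> \<le> C" "0 \<le> C"
    using lq_riccati_bounded[OF S] by metis
  \<comment> \<open>The constant depends only on the coefficients and on a bound for
    \<open>S\<close>, hence neither on \<open>N\<close> nor on the sample point.\<close>
  define K where "K = \<bar>a\<bar> + \<bar>c\<bar> + b\<^sup>2 * C"
  have K0: "0 \<le> K" using C by (simp add: K_def)
  obtain H0 H1 where P: "lq_fbsde M (natural_filtration M (W ` {0})) T a b c q x00 x0 X0 Xbar P0bar Pbar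
      (\<lambda>t \<omega>. D0 * (W 0 t \<omega> - W 0 0 \<omega>)) (\<lambda>t \<omega>. 0 * (W 0 t \<omega> - W 0 0 \<omega>)) H0 H1"
    using limiting_system_fbsde[OF assms(1,2) W assms(7)] by blast
  \<comment> \<open>The two backward martingale parts are packed into a pair so that one choice
    serves all \<open>N\<close>; at \<open>N = 0\<close> nothing is asked of it.\<close>
  have "\<exists>H. 1 \<le> N \<longrightarrow> lq_fbsde M (natural_filtration M (W ` {0..N})) T a b c q x00 x0
      (X N 0) (empirical_mean N (X N)) (Y N 0) (aggregate N (Y N))
      (\<lambda>t \<omega>. D0 * (W 0 t \<omega> - W 0 0 \<omega>)) (\<lambda>t \<omega>. D * noise_mean W N t \<omega>) (fst H) (snd H)" for N
  proof (cases "1 \<le> N")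
    case True
    from finite_player_system_fbsde[OF assms(1,2) W True assms(5)[OF True]]
    obtain H0 H1 where "lq_fbsde M (natural_filtration M (W ` {0..N})) T a b c q x00 x0
      (X N 0) (empirical_mean N (X N)) (Y N 0) (aggregate N (Y N))
      (\<lambda>t \<omega>. D0 * (W 0 t \<omega> - W 0 0 \<omega>)) (\<lambda>t \<omega>. D * noise_mean W N t \<omega>) H0 H1" by blast
    then show ?thesis by (intro exI[of _ "(H0, H1)"]) simp
  qed simp
  from choice[OF allI, OF this]
  obtain H where "\<forall>N. 1 \<le> N \<longrightarrow> lq_fbsde M (natural_filtration M (W ` {0..N})) T a b c q x00 x0
      (X N 0) (empirical_mean N (X N)) (Y N 0) (aggregate N (Y N))
      (\<lambda>t \<omega>. D0 * (W 0 t \<omega> - W 0 0 \<omega>)) (\<lambda>t \<omega>. D * noise_mean W N t \<omega>) (fst (H N)) (snd (H N))" ..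
  note Q = this[rule_format]
  have cont: "AE \<omega> in M. \<forall>i. continuous_on {0..} (\<lambda>t. W i t \<omega>)"
    and zero: "AE \<omega> in M. \<forall>i. W i 0 \<omega> = 0"
    using W by (simp_all add: AE_all_countable independent_wiener_processes_def wiener_process_def)
  have cnm: "AE \<omega> in M. continuous_on {0..T} (\<lambda>t. noise_mean W N t \<omega>)" for N
    using cont
  proof eventually_elim
    case (elim \<omega>)
    show ?case
      unfolding noise_mean_def
      by (intro continuous_on_mult_left continuous_on_sum continuous_on_diff continuous_on_const)
        (rule continuous_on_subset[OF elim[rule_format]], simp)
  qed
  have bound: "AE \<omega> in M. \<forall>t\<in>{0..T}.
      \<bar>X N 0 t \<omega> - X0 t \<omega>\<bar> + \<bar>empirical_mean N (X N) t \<omega> - Xbar t \<omega>\<bar>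
      \<le> \<bar>D * noise_mean W N t \<omega>\<bar>
        + K * (exp (K * t) * integral {0..t} (\<lambda>s. \<bar>D * noise_mean W N s \<omega>\<bar>))" if "1 \<le> N" for N
  proof -
    have "AE \<omega> in M. continuous_on {0..T} (\<lambda>t. D * noise_mean W N t \<omega> - 0 * (W 0 t \<omega> - W 0 0 \<omega>))"
      using cnm[of N] by eventually_elim (simp add: continuous_on_mult_left)
    from lq_fbsde_difference_paths[OF P Q[OF that] S C K_def this] show ?thesis by simp
  qed
  have part1: "\<exists>K. \<forall>N\<ge>1. AE \<omega> in M. \<forall>t\<in>{0..T}.
      \<bar>X N 0 t \<omega> - X0 t \<omega>\<bar> + \<bar>empirical_mean N (X N) t \<omega> - Xbar t \<omega>\<bar>
        \<le> exp (K * t) * (\<bar>D\<bar> / real N) * (SUP s\<in>{0..t}. \<bar>\<Sum>i=1..N. W i s \<omega>\<bar>)"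
  proof (intro exI[of _ "2 * K"] allI impI)
    fix N :: nat assume N: "1 \<le> N"
    show "AE \<omega> in M. \<forall>t\<in>{0..T}.
      \<bar>X N 0 t \<omega> - X0 t \<omega>\<bar> + \<bar>empirical_mean N (X N) t \<omega> - Xbar t \<omega>\<bar>
        \<le> exp (2 * K * t) * (\<bar>D\<bar> / real N) * (SUP s\<in>{0..t}. \<bar>\<Sum>i=1..N. W i s \<omega>\<bar>)"
      using bound[OF N] cont zero
    proof eventually_elim
      case (elim \<omega>)
      \<comment> \<open>Passing from increments to the processes themselves uses that all of them
        start at zero on this path.\<close>
      have nm: "\<bar>D * noise_mean W N s \<omega>\<bar> = (\<bar>D\<bar> / real N) * \<bar>\<Sum>i=1..N. W i s \<omega>\<bar>" for s
        using elim(3) by (simp add: noise_mean_def abs_mult)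
      show ?case
      proof
        fix t assume t: "t \<in> {0..T}"
        have "continuous_on {0..t} (\<lambda>s. \<Sum>i=1..N. W i s \<omega>)"
          using elim(2) by (auto intro!: continuous_intros intro: continuous_on_subset)
        from gronwall_sup_bound[OF this _ _ K0, of "\<bar>D\<bar> / real N"] t elim(1)
        show "\<bar>X N 0 t \<omega> - X0 t \<omega>\<bar> + \<bar>empirical_mean N (X N) t \<omega> - Xbar t \<omega>\<bar>
            \<le> exp (2 * K * t) * (\<bar>D\<bar> / real N) * (SUP s\<in>{0..t}. \<bar>\<Sum>i=1..N. W i s \<omega>\<bar>)"
          unfolding nm by (auto intro: order_trans)
      qed
    qed
  qed
  have part2: "AE \<omega> in M.
      (\<lambda>N. X N 0 t \<omega>) \<longlonglongrightarrow> X0 t \<omega> \<and>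
      (\<lambda>N. empirical_mean N (X N) t \<omega>) \<longlonglongrightarrow> Xbar t \<omega> \<and>
      (\<lambda>N. Y N 0 t \<omega>) \<longlonglongrightarrow> P0bar t \<omega> \<and>
      (\<lambda>N. aggregate N (Y N) t \<omega>) \<longlonglongrightarrow> Pbar t \<omega>" if t: "t \<in> {0..T}" for t
  proof -
    \<comment> \<open>Countably many player numbers, so one null set serves for all of them before
      the limit is taken.\<close>
    have b: "AE \<omega> in M. \<forall>N\<ge>1. \<bar>X N 0 t \<omega> - X0 t \<omega>\<bar> + \<bar>empirical_mean N (X N) t \<omega> - Xbar t \<omega>\<bar>
      \<le> \<bar>D * noise_mean W N t \<omega>\<bar>
        + K * (exp (K * t) * integral {0..t} (\<lambda>s. \<bar>D * noise_mean W N s \<omega>\<bar>))"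
      unfolding AE_all_countable
    proof
      fix N
      show "AE \<omega> in M. 1 \<le> N \<longrightarrow> \<bar>X N 0 t \<omega> - X0 t \<omega>\<bar> + \<bar>empirical_mean N (X N) t \<omega> - Xbar t \<omega>\<bar>
        \<le> \<bar>D * noise_mean W N t \<omega>\<bar>
          + K * (exp (K * t) * integral {0..t} (\<lambda>s. \<bar>D * noise_mean W N s \<omega>\<bar>))"
      proof (cases "1 \<le> N")
        case True
        from bound[OF True] show ?thesis by eventually_elim (use t in auto)
      qed simp
    qed
    have d: "AE \<omega> in M. \<forall>N\<ge>1.
        Y N 0 t \<omega> = S t $ 1 $ 1 * X N 0 t \<omega> + S t $ 1 $ 2 * empirical_mean N (X N) t \<omega> \<and>
        aggregate N (Y N) t \<omega> = S t $ 2 $ 1 * X N 0 t \<omega> + S t $ 2 $ 2 * empirical_mean N (X N) t \<omega>"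
      unfolding AE_all_countable
    proof
      fix N
      show "AE \<omega> in M. 1 \<le> N \<longrightarrow>
        Y N 0 t \<omega> = S t $ 1 $ 1 * X N 0 t \<omega> + S t $ 1 $ 2 * empirical_mean N (X N) t \<omega> \<and>
        aggregate N (Y N) t \<omega> = S t $ 2 $ 1 * X N 0 t \<omega> + S t $ 2 $ 2 * empirical_mean N (X N) t \<omega>"
      proof (cases "1 \<le> N")
        case True
        from lq_fbsde.decoupling[OF Q[OF True] S t] show ?thesis by eventually_elim simp
      qed simp
    qed
    have t0: "0 \<le> t" using t by simp
    from b d lq_fbsde.decoupling[OF P S t] noise_mean_tendsto_0[OF assms(1) W t0]
      noise_mean_integral_tendsto_0[OF assms(1) W t0]
    show ?thesis
    proof eventually_elim
      case (elim \<omega>)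
      let ?e = "\<lambda>N. \<bar>D * noise_mean W N t \<omega>\<bar>
        + K * (exp (K * t) * integral {0..t} (\<lambda>s. \<bar>D * noise_mean W N s \<omega>\<bar>))"
      have "?e \<longlonglongrightarrow> \<bar>D * 0\<bar> + K * (exp (K * t) * (\<bar>D\<bar> * 0))"
        unfolding abs_mult integral_mult_right
        by (intro tendsto_intros elim(5,6) tendsto_rabs)
      then have e: "?e \<longlonglongrightarrow> 0" by simp
      have ev: "\<forall>\<^sub>F N in sequentially. 1 \<le> (N::nat)" by (rule eventually_ge_at_top)
      have X: "(\<lambda>N. X N 0 t \<omega>) \<longlonglongrightarrow> X0 t \<omega>"
        by (rule LIM_zero_cancel, rule Lim_null_comparison[OF _ e], use ev in eventually_elim)
          (use elim(1) in fastforce)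
      have Xm: "(\<lambda>N. empirical_mean N (X N) t \<omega>) \<longlonglongrightarrow> Xbar t \<omega>"
        by (rule LIM_zero_cancel, rule Lim_null_comparison[OF _ e], use ev in eventually_elim)
          (use elim(1) in fastforce)
      have "(\<lambda>N. Y N 0 t \<omega>) \<longlonglongrightarrow> P0bar t \<omega>"
        unfolding elim(3)
      proof (rule Lim_transform_eventually)
        show "(\<lambda>N. S t $ 1 $ 1 * X N 0 t \<omega> + S t $ 1 $ 2 * empirical_mean N (X N) t \<omega>)
          \<longlonglongrightarrow> S t $ 1 $ 1 * X0 t \<omega> + S t $ 1 $ 2 * Xbar t \<omega>"
          by (intro tendsto_intros X Xm)
        show "\<forall>\<^sub>F N in sequentially. S t $ 1 $ 1 * X N 0 t \<omega> + S t $ 1 $ 2 * empirical_mean N (X N) t \<omega> = Y N 0 t \<omega>"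
          using ev by eventually_elim (use elim(2) in simp)
      qed
      moreover have "(\<lambda>N. aggregate N (Y N) t \<omega>) \<longlonglongrightarrow> Pbar t \<omega>"
        unfolding elim(4)
      proof (rule Lim_transform_eventually)
        show "(\<lambda>N. S t $ 2 $ 1 * X N 0 t \<omega> + S t $ 2 $ 2 * empirical_mean N (X N) t \<omega>)
          \<longlonglongrightarrow> S t $ 2 $ 1 * X0 t \<omega> + S t $ 2 $ 2 * Xbar t \<omega>"
          by (intro tendsto_intros X Xm)
        show "\<forall>\<^sub>F N in sequentially. S t $ 2 $ 1 * X N 0 t \<omega> + S t $ 2 $ 2 * empirical_mean N (X N) t \<omega> = aggregate N (Y N) t \<omega>"
          using ev by eventually_elim (use elim(2) in simp)
      qed
      ultimately show ?case using X Xm by blast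
    qed
  qed
  have part3: "AE \<omega> in M. (\<lambda>N. u0N N t \<omega>) \<longlonglongrightarrow> u0 t \<omega>" if t: "t \<in> {0..T}" for t
  proof -
    let ?F = "natural_filtration M (W ` {0}) t"
    interpret finite_measure_subalgebra M ?F
      by unfold_locales (rule subalgebra_wiener_filtration[OF W])
    have "AE \<omega> in M. 1 \<le> N \<longrightarrow> u0N N t \<omega> = u0 t \<omega>" for N
    proof (cases "1 \<le> N")
      case N: True
      \<comment> \<open>An identity for each \<open>N\<close>, not a limit: conditioning on the
        filtration of \<open>W 0\<close> averages out all minor noise, and the system being linear,
        what remains is the limiting adjoint process.\<close>
      have "AE \<omega> in M. real_cond_exp M ?F (Y N 0 t) \<omega> = P0bar t \<omega>"
      proof (rule real_cond_exp_charact)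
        show "integrable M (Y N 0 t)" "integrable M (P0bar t)"
          using lq_fbsde.integrable_components(3)[OF Q[OF N] t] lq_fbsde.integrable_components(3)[OF P t] .
        show "P0bar t \<in> borel_measurable ?F"
          using lq_fbsde.adapted(3)[OF P t] .
        fix A assume A: "A \<in> sets ?F"
        have AM: "A \<in> events" using subalgebra_sets[OF subalgebra_wiener_filtration[OF W] A] .
        have "(\<integral>\<omega>. indicator A \<omega> * Y N 0 t \<omega> \<partial>M) = (\<integral>\<omega>. indicator A \<omega> * P0bar t \<omega> \<partial>M)"
        proof (rule lq_fbsde_difference_means[OF P Q[OF N] S AM _ t])
          fix s assume "s \<in> {0..T}"
          then show "(\<integral>\<omega>. indicator A \<omega> * (D * noise_mean W N s \<omega>) \<partial>M)
            = (\<integral>\<omega>. indicator A \<omega> * (0 * (W 0 s \<omega> - W 0 0 \<omega>)) \<partial>M)"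
            using noise_mean_truncated_zero[OF assms(1) W _ A, of s N] by (simp add: mult.left_commute)
        qed
        then show "(LINT \<omega>:A|M. Y N 0 t \<omega>) = (LINT \<omega>:A|M. P0bar t \<omega>)"
          by (simp add: set_lebesgue_integral_def)
      qed
      with assms(6)[OF N t] assms(8)[OF t] show ?thesis
        by eventually_elim simp
    qed simp
    then have "AE \<omega> in M. \<forall>N\<ge>1. u0N N t \<omega> = u0 t \<omega>" by (simp add: AE_all_countable)
    then show ?thesis
      \<comment> \<open>The sequence of controls is constant from index 1 on; its term at index 0 is
        unconstrained.\<close>
      by eventually_elim (auto intro!: tendsto_eventually eventually_sequentiallyI[of 1])
  qed
  show ?thesis using part1 part2 part3 by blast
qed

end
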